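(* Let $B_1\subset\mathbb{R}^2$ be the open unit disc and let $K\in L^\infty(B_1)$ be nonnegative. Let $u\in C^2(B_1\setminus\{0\})$ be a solution of \[ -\Delta u = K(x)e^{u}\quad\text{in } B_1\setminus\{0\} \] satisfying \[ \int_{B_1\setminus\{0\}} e^{u(x)}\,dx<+\infty . \] Then there exist a constant $\alpha>-2$, a radius $\rho\in(0,1)$, an exponent $\gamma\in(0,1)$ and a function $\varphi\in C^{\gamma}(B_\rho)$ (Hölder continuous on $B_\rho$) such that \[ u(x)=\alpha\ln|x|+\varphi(x)\quad\text{for all } x\in B_\rho\setminus\{0\}. \]
   Context: $B_r$ denotes the open ball of radius $r$ centered at the origin. The equation holds pointwise in $B_1\setminus\{0\}$. *)

theory Defs
  imports "HOL-Analysis.Analysis"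
begin

definition partial_deriv :: "('a::euclidean_space \<Rightarrow> real) \<Rightarrow> 'a \<Rightarrow> 'a \<Rightarrow> real" where
  "partial_deriv u e x = frechet_derivative u (at x) e"

definition C2_on :: "'a::euclidean_space set \<Rightarrow> ('a \<Rightarrow> real) \<Rightarrow> bool" where
  "C2_on S u \<longleftrightarrow>
     (\<forall>x\<in>S. u differentiable (at x)) \<and>
     (\<forall>i\<in>Basis. \<forall>x\<in>S. partial_deriv u i differentiable (at x)) \<and>
     (\<forall>i\<in>Basis. continuous_on S (partial_deriv u i)) \<and>
     (\<forall>i\<in>Basis. \<forall>j\<in>Basis. continuous_on S (partial_deriv (partial_deriv u i) j))"

definition laplacian :: "('a::euclidean_space \<Rightarrow> real) \<Rightarrow> 'a \<Rightarrow> real" where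
  "laplacian u x = (\<Sum>i\<in>Basis. partial_deriv (partial_deriv u i) i x)"

definition holder_on :: "real \<Rightarrow> 'a::metric_space set \<Rightarrow> ('a \<Rightarrow> real) \<Rightarrow> bool" where
  "holder_on g S f \<longleftrightarrow> (\<exists>C. \<forall>x\<in>S. \<forall>y\<in>S. \<bar>f x - f y\<bar> \<le> C * dist x y powr g)"

end

theory Submission
  imports Defs
begin

text \<open>
  Everything is read in logarithmic polar coordinates: \<open>V s \<theta> = u (exp s * cos \<theta>, exp s * sin \<theta>)\<close>
  has the cylinder Laplacian \<open>- exp (2 * s) * K * exp u\<close>.

  The circular average \<open>m\<close> of \<open>V\<close> is concave in \<open>s\<close>, and \<open>m'\<close> is bounded because \<open>K * exp u\<close> is
  integrable. Hence \<open>m'\<close> increases to a limit \<open>\<alpha>\<close> as \<open>s\<close> tends to minus infinity; since \<open>m' \<le> \<alpha>\<close>,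
  Jensen's inequality makes \<open>exp ((\<alpha> + 2) * s)\<close> integrable there, so \<open>\<alpha> > -2\<close>.

  Near the origin \<open>exp u * |x|\<^sup>2\<close> is bounded (small energy regularity), so the right-hand side is
  bounded on the cylinder. The energy \<open>E s = \<integral> (V - m)\<^sup>2 d\<theta>\<close> then satisfies \<open>E'' \<ge> k * E - C\<close> by
  Wirtinger's inequality, and it grows too slowly to be unbounded. Mean value estimates turn
  this into a bound for \<open>u - m\<close>, whence \<open>exp u * |x|\<^sup>2\<close> decays like a power of \<open>|x|\<close>. Running the
  argument once more with this decay gives \<open>u - \<alpha> * ln |x| - c = O(|x| powr \<gamma>)\<close>, and an interior
  estimate at scale \<open>|x|\<close> upgrades this to Hoelder continuity.
\<close>

subsection \<open>Logarithmic polar coordinates\<close>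

text \<open>The obstacle is the puncture: nothing is known across the origin, so a priori
  \<open>u\<close> could carry singular harmonics such as
  \<open>cos (k * \<theta>) * exp (- k * s)\<close>. Growth alone excludes them. The energy
  inequality leaves two alternatives: \<open>E\<close> is of the order of its source, or it grows at
  an exponential rate towards minus infinity. The bound on \<open>exp u * |x|\<^sup>2\<close> from
  above, together with the slope bound on \<open>m\<close>, makes \<open>u\<close> grow at most
  logarithmically, which rules out the second.

  The oscillation estimate runs twice because decay is known at first only for
  \<open>exp m * |x|\<^sup>2\<close>. A bounded right-hand side already makes \<open>u - m\<close>
  bounded, and only then does the decay pass from \<open>m\<close> to \<open>u\<close>.

  Wirtinger's inequality is used with the constant \<open>4 * pi\<^sup>2\<close>, so the rate
  available for the energy is \<open>1 / (2 * pi)\<close>, which exceeds \<open>1 / 8\<close>. The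
  energy is quadratic, hence the limits \<open>\<gamma> \<le> 1 / 16\<close> on the decay and
  \<open>1 / 32\<close> on the growth of \<open>u\<close>. Any positive exponent suffices for the
  theorem, so nothing is lost by these crude values.\<close>

definition dir :: "real \<Rightarrow> real^2" where
  "dir \<theta> = cos \<theta> *\<^sub>R axis 1 1 + sin \<theta> *\<^sub>R axis 2 1"

definition expolar :: "real \<Rightarrow> real \<Rightarrow> real^2" where
  "expolar s \<theta> = exp s *\<^sub>R dir \<theta>"

lemma dir_nth [simp]: "dir \<theta> $ 1 = cos \<theta>" "dir \<theta> $ 2 = sin \<theta>"
  by (simp_all add: dir_def axis_def)

lemma expolar_nth [simp]: "expolar s \<theta> $ 1 = exp s * cos \<theta>" "expolar s \<theta> $ 2 = exp s * sin \<theta>"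
  by (simp_all add: expolar_def)

lemma vec2_eq_iff: "(x::'a^2) = y \<longleftrightarrow> x $ 1 = y $ 1 \<and> x $ 2 = y $ 2"
  by (auto simp: vec_eq_iff forall_2)

lemma inner_vec2: "(x::real^2) \<bullet> y = x $ 1 * y $ 1 + x $ 2 * y $ 2"
  by (simp add: inner_vec_def sum_2)

lemma norm_vec2: "norm (x::real^2) = sqrt ((x $ 1)\<^sup>2 + (x $ 2)\<^sup>2)"
  by (simp add: norm_eq_sqrt_inner inner_vec2 power2_eq_square)

lemma norm_dir [simp]: "norm (dir \<theta>) = 1"
  by (simp add: norm_vec2)

lemma norm_expolar [simp]: "norm (expolar s \<theta>) = exp s"
  by (simp add: expolar_def)

lemma expolar_nonzero [simp]: "expolar s \<theta> \<noteq> 0"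
  by (metis exp_not_eq_zero norm_expolar norm_zero)

lemma dir_2pi [simp]: "dir (2 * pi) = dir 0"
  by (simp add: dir_def)

lemma expolar_2pi [simp]: "expolar s (2 * pi) = expolar s 0"
  by (simp add: expolar_def)

lemma continuous_on_dir [continuous_intros]:
  fixes f :: "'a::t2_space \<Rightarrow> real"
  shows
  "continuous_on S f \<Longrightarrow> continuous_on S (\<lambda>x. dir (f x))"
  unfolding dir_def by (intro continuous_intros continuous_on_cos continuous_on_sin)

lemma continuous_on_expolar [continuous_intros]:
  fixes f g :: "'a::t2_space \<Rightarrow> real"
  shows
  "continuous_on S f \<Longrightarrow> continuous_on S g \<Longrightarrow> continuous_on S (\<lambda>x. expolar (f x) (g x))"
  unfolding expolar_def by (intro continuous_intros)

lemma ex_expolar: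
  fixes z :: "real^2"
  assumes "z \<noteq> 0"
  shows "\<exists>\<theta>. 0 \<le> \<theta> \<and> \<theta> < 2 * pi \<and> z = expolar (ln (norm z)) \<theta>"
proof -
  define x y where "x = z $ 1 / norm z" and "y = z $ 2 / norm z"
  have "(norm z)\<^sup>2 = (z $ 1)\<^sup>2 + (z $ 2)\<^sup>2"
    by (simp add: norm_vec2)
  then have "x\<^sup>2 + y\<^sup>2 = 1"
    using assms by (simp add: x_def y_def power_divide flip: add_divide_distrib) (auto simp: vec2_eq_iff)
  then obtain t where "0 \<le> t" "t < 2 * pi" "x = cos t" "y = sin t"
    using sincos_total_2pi by metis
  moreover have "z $ 1 = norm z * x" "z $ 2 = norm z * y"
    using assms by (simp_all add: x_def y_def)
  ultimately show ?thesis
    using assms by (intro exI[of _ t]) (simp only: vec2_eq_iff expolar_nth exp_ln zero_less_norm_iff simp_thms)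
qed

lemma expolar_inj:
  assumes "expolar s \<theta> = expolar s' \<theta>'" "\<theta> \<in> {0<..<2*pi}" "\<theta>' \<in> {0<..<2*pi}"
  shows "s = s' \<and> \<theta> = \<theta>'"
proof -
  have "exp s = exp s'"
    using assms(1) by (metis norm_expolar)
  then have s: "s = s'" by simp
  with assms(1) have "dir \<theta> = dir \<theta>'" by (simp add: expolar_def)
  then have "sin \<theta> = sin \<theta>' \<and> cos \<theta> = cos \<theta>'" by (metis dir_nth)
  then obtain n :: int where n: "\<theta> = \<theta>' + 2 * pi * n"
    using sin_cos_eq_iff by blast
  have "\<theta> - \<theta>' < 2 * pi" "\<theta>' - \<theta> < 2 * pi"
    using assms(2,3) unfolding greaterThanLessThan_iff by linarith+
  with n have "2 * pi * of_int n < 2 * pi * 1" "2 * pi * (- of_int n) < 2 * pi * 1"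
    by auto
  then have "of_int n < (1::real)" "- of_int n < (1::real)"
    using mult_less_cancel_left_pos[of "2 * pi"] by (meson pi_gt_zero mult_pos_pos zero_less_numeral)+
  then have "n = 0" by linarith
  with n s show ?thesis by simp
qed

text \<open>Expressing the derivative as a shift by \<open>pi / 2\<close> keeps all angular
  derivatives within \<open>dir\<close> and \<open>expolar\<close>; two shifts amount to a change of
  sign.\<close>

lemma has_derivative_dir [derivative_intros]:
  assumes "(f has_derivative f') (at x within S)"
  shows "((\<lambda>x. dir (f x)) has_derivative (\<lambda>h. f' h *\<^sub>R dir (f x + pi / 2))) (at x within S)"
proof -
  have "(\<lambda>h. f' h *\<^sub>R dir (f x + pi / 2)) =
      (\<lambda>h. (f' h * - sin (f x)) *\<^sub>R axis 1 1 + (f' h * cos (f x)) *\<^sub>R axis 2 1)"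
    by (auto simp: fun_eq_iff vec2_eq_iff axis_def sin_add cos_add)
  then show ?thesis
    unfolding dir_def[of "f _"] using assms by (auto intro!: derivative_eq_intros)
qed

lemma has_derivative_expolar [derivative_intros]:
  assumes "(f has_derivative f') (at x within S)" "(g has_derivative g') (at x within S)"
  shows "((\<lambda>x. expolar (f x) (g x)) has_derivative
    (\<lambda>h. f' h *\<^sub>R expolar (f x) (g x) + g' h *\<^sub>R expolar (f x) (g x + pi / 2))) (at x within S)"
  unfolding expolar_def using assms
  by (auto intro!: derivative_eq_intros simp: algebra_simps fun_eq_iff)

section \<open>Lebesgue measure in logarithmic polar coordinates\<close>

lemma lborel_vec2_eq:
  "lborel = distr (lborel \<Otimes>\<^sub>M lborel) borel (\<lambda>(x, y). vector [x, y] :: real^2)"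
proof (rule lborel_eqI)
  have "(\<lambda>(x, y). vector [x, y] :: real^2) = (\<lambda>(x, y). x *\<^sub>R axis 1 1 + y *\<^sub>R axis 2 1)"
    by (auto simp: fun_eq_iff vec2_eq_iff axis_def)
  then have m [measurable]: "(\<lambda>(x, y). vector [x, y] :: real^2) \<in> borel \<Otimes>\<^sub>M borel \<rightarrow>\<^sub>M borel"
    by simp
  fix l u :: "real^2"
  assume lu: "\<And>b. b \<in> Basis \<Longrightarrow> l \<bullet> b \<le> u \<bullet> b"
  then have le: "l $ 1 \<le> u $ 1" "l $ 2 \<le> u $ 2"
    by (metis axis_in_Basis_iff inner_axis' real_inner_1_right inner_commute Basis_real_def insertI1)+
  have vim: "(\<lambda>(x, y). vector [x, y] :: real^2) -` box l u = box (l $ 1) (u $ 1) \<times> box (l $ 2) (u $ 2)"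
    by (auto simp: mem_box_cart forall_2)
  have "emeasure (distr (lborel \<Otimes>\<^sub>M lborel) borel (\<lambda>(x, y). vector [x, y] :: real^2)) (box l u)
      = emeasure (lborel \<Otimes>\<^sub>M lborel) (box (l $ 1) (u $ 1) \<times> box (l $ 2) (u $ 2))"
    using vim by (subst emeasure_distr) (auto simp: space_pair_measure)
  also have "\<dots> = ennreal (u $ 1 - l $ 1) * ennreal (u $ 2 - l $ 2)"
    using le by (subst lborel.emeasure_pair_measure_Times) (auto simp: box_real)
  also have "\<dots> = ennreal (\<Prod>b\<in>Basis. (u - l) \<bullet> b)"
  proof -
    have B: "(Basis :: (real^2) set) = {axis 1 1, axis 2 1}"
      by (auto simp: Basis_vec_def UNIV_2)
    have "axis 1 1 \<noteq> (axis 2 1 :: real^2)"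
      by (simp add: axis_eq_axis)
    then have "(\<Prod>b\<in>(Basis :: (real^2) set). (u - l) \<bullet> b) = (u - l) \<bullet> axis 1 1 * ((u - l) \<bullet> axis 2 1)"
      unfolding B by (subst prod.insert) auto
    then have "(\<Prod>b\<in>(Basis :: (real^2) set). (u - l) \<bullet> b) = (u $ 1 - l $ 1) * (u $ 2 - l $ 2)"
      by (simp only: inner_axis vector_minus_component inner_real_def mult_1_right)
    with le show ?thesis
      by (simp only: ennreal_mult diff_ge_0_iff_ge)
  qed
  finally show "emeasure (distr (lborel \<Otimes>\<^sub>M lborel) borel (\<lambda>(x, y). vector [x, y] :: real^2)) (box l u)
    = ennreal (\<Prod>b\<in>Basis. (u - l) \<bullet> b)" .
qed simp

lemma borel_measurable_expolar [measurable]: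
  "(\<lambda>w. expolar (fst w) (snd w)) \<in> borel_measurable borel"
  "(\<lambda>w::real^2. expolar (w $ 1) (w $ 2)) \<in> borel_measurable borel"
  by (intro borel_measurable_continuous_onI continuous_intros)+

text \<open>Change of variables, tested on boxes. The open interval of angles makes the map
  injective and loses only a ray inside the null line \<open>z $ 2 = 0\<close>; the Jacobian of
  \<open>expolar\<close> is \<open>exp (2 * s)\<close>. The coordinates are packed into
  \<open>real^2\<close> because the area formula concerns maps of one space into itself;
  \<open>lborel_polar\<close> unpacks them into a product, ready for Fubini.\<close>

lemma lborel_polar_vec:
  "lborel = distr (density lborel (\<lambda>w::real^2. ennreal (exp (2 * w $ 1)) * indicator {w. 0 < w $ 2 \<and> w $ 2 < 2 * pi} w))
     borel (\<lambda>w. expolar (w $ 1) (w $ 2))" (is "_ = distr (density _ ?d) _ ?P")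
proof (rule lborel_eqI)
  fix l u :: "real^2"
  assume lu: "\<And>b. b \<in> Basis \<Longrightarrow> l \<bullet> b \<le> u \<bullet> b"
  define S where "S = {w::real^2. 0 < w $ 2 \<and> w $ 2 < 2 * pi}"
  have Sm [measurable]: "S \<in> sets borel" unfolding S_def by measurable
  define T where "T = ?P -` box l u \<inter> S"
  have Tm [measurable]: "T \<in> sets borel"
    unfolding T_def using measurable_sets[OF borel_measurable_expolar(2), of "box l u"] by simp
  have im: "?P ` T = box l u \<inter> ?P ` S" by (auto simp: T_def)
  have cov: "- {z. z $ 2 = 0} \<subseteq> ?P ` S"
  proof
    fix z :: "real^2" assume "z \<in> - {z. z $ 2 = 0}"
    then have z2: "z $ 2 \<noteq> 0" by simp
    then have "z \<noteq> 0" by auto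
    then obtain t where t: "0 \<le> t" "t < 2 * pi" "z = expolar (ln (norm z)) t"
      using ex_expolar by blast
    have "t \<noteq> 0" using z2 t(3) by (metis expolar_nth(2) mult_eq_0_iff sin_zero)
    then show "z \<in> ?P ` S"
      using t by (intro image_eqI[of _ _ "vector [ln (norm z), t]"]) (auto simp: S_def)
  qed
  have neg: "negligible (box l u - ?P ` T)"
    by (rule negligible_subset[of "{z::real^2. z $ 2 = 0}"])
       (use cov im in \<open>auto intro: negligible_standard_hyperplane_cart\<close>)
  have "?P ` T = box l u - (box l u - ?P ` T)" using im by auto
  moreover have "box l u - (box l u - ?P ` T) \<in> lmeasurable"
    using neg by (intro fmeasurable.Diff lmeasurable_box negligible_imp_measurable)
  moreover have "measure lebesgue (box l u - (box l u - ?P ` T)) = measure lebesgue (box l u)"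
    using neg by (intro measure_Diff_null_set) (auto simp: negligible_iff_null_sets)
  ultimately have PT: "?P ` T \<in> lmeasurable" "measure lebesgue (?P ` T) = measure lebesgue (box l u)"
    by simp_all
  have der: "(?P has_derivative (\<lambda>h. h $ 1 *\<^sub>R ?P x + h $ 2 *\<^sub>R expolar (x $ 1) (x $ 2 + pi / 2))) (at x within T)" for x
    by (intro derivative_intros bounded_linear_imp_has_derivative bounded_linear_vec_nth)
  have det: "\<bar>det (matrix (\<lambda>h. h $ 1 *\<^sub>R ?P x + h $ 2 *\<^sub>R expolar (x $ 1) (x $ 2 + pi / 2)))\<bar> = exp (2 * x $ 1)" for x
  proof -
    have "det (matrix (\<lambda>h. h $ 1 *\<^sub>R ?P x + h $ 2 *\<^sub>R expolar (x $ 1) (x $ 2 + pi / 2)))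
       = exp (x $ 1) * cos (x $ 2) * (exp (x $ 1) * cos (x $ 2)) + exp (x $ 1) * sin (x $ 2) * (exp (x $ 1) * sin (x $ 2))"
      by (simp add: det_2 matrix_def axis_def sin_add cos_add)
    also have "\<dots> = exp (x $ 1) * exp (x $ 1) * ((cos (x $ 2))\<^sup>2 + (sin (x $ 2))\<^sup>2)"
      by (simp only: power2_eq_square distrib_left mult_ac)
    also have "\<dots> = exp (2 * x $ 1)" by (simp only: sin_cos_squared_add2) (simp flip: exp_add)
    finally show ?thesis by simp
  qed
  have inj: "inj_on ?P T"
  proof (rule inj_onI)
    fix v w assume "v \<in> T" "w \<in> T" "?P v = ?P w"
    then have "v $ 1 = w $ 1 \<and> v $ 2 = w $ 2"
      by (intro expolar_inj) (auto simp: T_def S_def)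
    then show "v = w" by (simp add: vec2_eq_iff)
  qed
  have hi: "((\<lambda>x. exp (2 * x $ 1)) has_integral measure lebesgue (box l u)) T"
    using has_measure_differentiable_image[OF _ der inj, of "measure lebesgue (box l u)"] PT
    unfolding det by simp
  have "emeasure (distr (density lborel ?d) borel ?P) (box l u) = (\<integral>\<^sup>+w. ?d w * indicator (?P -` box l u) w \<partial>lborel)"
  proof -
    have "?P -` box l u \<in> sets borel"
      using measurable_sets[OF borel_measurable_expolar(2), of "box l u"] by simp
    then show ?thesis
      by (subst emeasure_distr) (simp_all add: emeasure_density)
  qed
  also have "\<dots> = (\<integral>\<^sup>+w. ennreal (exp (2 * w $ 1)) * indicator T w \<partial>lborel)"
    by (intro nn_integral_cong) (auto simp: indicator_def T_def S_def)
  also have "\<dots> = ennreal (measure lebesgue (box l u))"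
    using nn_integral_has_integral_lebesgue[OF _ hi]
    by (simp add: ennreal_mult ennreal_indicator mult.commute)
  also have "\<dots> = ennreal (\<Prod>b\<in>Basis. (u - l) \<bullet> b)"
    using lu by simp
  finally show "emeasure (distr (density lborel ?d) borel ?P) (box l u) = ennreal (\<Prod>b\<in>Basis. (u - l) \<bullet> b)" .
qed simp

lemma lborel_polar:
  "(lborel :: (real^2) measure) = distr (density (lborel \<Otimes>\<^sub>M lborel)
      (\<lambda>w. ennreal (exp (2 * fst w) * indicator {0<..<2*pi} (snd w)))) borel (\<lambda>w. expolar (fst w) (snd w))"
  (is "_ = distr (density _ ?d) _ ?P")
proof (rule measure_eqI)
  fix A :: "(real^2) set" assume "A \<in> sets lborel"
  then have [measurable]: "A \<in> sets borel" by simp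
  have "(\<lambda>(x, y). vector [x, y] :: real^2) = (\<lambda>(x, y). x *\<^sub>R axis 1 1 + y *\<^sub>R axis 2 1)"
    by (auto simp: fun_eq_iff vec2_eq_iff axis_def)
  then have m [measurable]: "(\<lambda>(x, y). vector [x, y] :: real^2) \<in> borel \<Otimes>\<^sub>M borel \<rightarrow>\<^sub>M borel"
    by simp
  let ?e = "\<lambda>w::real^2. ennreal (exp (2 * w $ 1)) * indicator {w. 0 < w $ 2 \<and> w $ 2 < 2 * pi} w"
  let ?Q = "\<lambda>w::real^2. expolar (w $ 1) (w $ 2)"
  have P [measurable]: "?P \<in> borel \<Otimes>\<^sub>M borel \<rightarrow>\<^sub>M borel"
    using borel_measurable_expolar(1) by (simp add: borel_prod)
  have "emeasure lborel A = emeasure (distr (density lborel ?e) borel ?Q) A"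
    by (subst lborel_polar_vec) simp
  also have "\<dots> = (\<integral>\<^sup>+w. ?e w * indicator A (?Q w) \<partial>lborel)"
  proof -
    have "?Q -` A \<in> sets borel"
      using measurable_sets[OF borel_measurable_expolar(2), of A] by simp
    then show ?thesis
      by (subst emeasure_distr) (simp_all add: emeasure_density indicator_def vimage_def)
  qed
  also have "\<dots> = (\<integral>\<^sup>+w. ?e (case w of (x, y) \<Rightarrow> vector [x, y]) * indicator A (?Q (case w of (x, y) \<Rightarrow> vector [x, y])) \<partial>(lborel \<Otimes>\<^sub>M lborel))"
    by (subst lborel_vec2_eq, subst nn_integral_distr) auto
  also have "\<dots> = (\<integral>\<^sup>+w. ?d w * indicator A (?P w) \<partial>(lborel \<Otimes>\<^sub>M lborel))"
    by (intro nn_integral_cong) (auto simp: indicator_def split: prod.splits)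
  also have "\<dots> = emeasure (distr (density (lborel \<Otimes>\<^sub>M lborel) ?d) borel ?P) A"
  proof -
    have "?P -` A \<in> sets (borel \<Otimes>\<^sub>M borel)"
      using measurable_sets[OF P, of A] by (simp add: space_pair_measure)
    then show ?thesis
      by (subst emeasure_distr) (simp_all add: emeasure_density indicator_def vimage_def space_pair_measure)
  qed
  finally show "emeasure lborel A = emeasure (distr (density (lborel \<Otimes>\<^sub>M lborel) ?d) borel ?P) A" .
qed simp

lemma integral_polar:
  fixes h :: "real^2 \<Rightarrow> real"
  assumes h: "integrable lborel h"
  shows "(\<integral>z. h z \<partial>lborel) = (\<integral>s. exp (2 * s) * (LINT \<theta>:{0<..<2*pi}|lborel. h (expolar s \<theta>)) \<partial>lborel)"
    and "integrable lborel (\<lambda>s. exp (2 * s) * (LINT \<theta>:{0<..<2*pi}|lborel. h (expolar s \<theta>)))"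
proof -
  have [measurable]: "h \<in> borel_measurable borel" using h by auto
  let ?P = "\<lambda>w. expolar (fst w) (snd w)"
  have P [measurable]: "?P \<in> borel \<Otimes>\<^sub>M borel \<rightarrow>\<^sub>M borel"
    using borel_measurable_expolar(1) by (simp add: borel_prod)
  let ?g = "\<lambda>w. (exp (2 * fst w) * indicator {0<..<2*pi} (snd w)) *\<^sub>R h (?P w)"
  have "integrable (distr (density (lborel \<Otimes>\<^sub>M lborel) (\<lambda>w. ennreal (exp (2 * fst w) * indicator {0<..<2*pi} (snd w)))) borel ?P) h"
    using h by (subst (asm) lborel_polar)
  then have i: "integrable (lborel \<Otimes>\<^sub>M lborel) ?g"
    by (subst (asm) integrable_distr_eq) (simp_all add: integrable_density)
  have "(\<integral>z. h z \<partial>lborel) = (\<integral>w. ?g w \<partial>(lborel \<Otimes>\<^sub>M lborel))"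
    by (subst lborel_polar, subst integral_distr) (auto simp: integral_density)
  also have "\<dots> = (\<integral>s. \<integral>\<theta>. ?g (s, \<theta>) \<partial>lborel \<partial>lborel)"
    using lborel_pair.integral_fst'[OF i] by simp
  also have "\<dots> = (\<integral>s. exp (2 * s) * (LINT \<theta>:{0<..<2*pi}|lborel. h (expolar s \<theta>)) \<partial>lborel)"
    unfolding set_lebesgue_integral_def by (simp add: mult.assoc)
  finally show "(\<integral>z. h z \<partial>lborel) = (\<integral>s. exp (2 * s) * (LINT \<theta>:{0<..<2*pi}|lborel. h (expolar s \<theta>)) \<partial>lborel)" .
  have "integrable lborel (\<lambda>s. \<integral>\<theta>. ?g (s, \<theta>) \<partial>lborel)"
    using lborel_pair.integrable_fst'[OF i] by simp
  then show "integrable lborel (\<lambda>s. exp (2 * s) * (LINT \<theta>:{0<..<2*pi}|lborel. h (expolar s \<theta>)))"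
    unfolding set_lebesgue_integral_def by (simp add: mult.assoc)
qed

subsection \<open>Circular averages and energy on the cylinder\<close>

abbreviation cint :: "(real \<Rightarrow> real) \<Rightarrow> real" where
  "cint f \<equiv> integral {0..2*pi} f"

lemma cint_const [simp]: "cint (\<lambda>_. c) = 2 * pi * c"
  by simp

lemma cint_has_real_derivative:
  fixes F F' :: "real \<Rightarrow> real \<Rightarrow> real"
  assumes d: "\<And>s \<theta>. s < T \<Longrightarrow> ((\<lambda>s. F s \<theta>) has_real_derivative F' s \<theta>) (at s)"
    and c: "\<And>s. s < T \<Longrightarrow> continuous_on UNIV (F s)"
    and c': "continuous_on ({..<T} \<times> UNIV) (\<lambda>(s, \<theta>). F' s \<theta>)"
    and "s < T"
  shows "((\<lambda>s. cint (F s)) has_real_derivative cint (F' s)) (at s)"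
proof -
  have "((\<lambda>s. integral (cbox 0 (2*pi)) (F s)) has_field_derivative integral (cbox 0 (2*pi)) (F' s)) (at s within {..<T})"
  proof (rule leibniz_rule_field_derivative)
    show "((\<lambda>s. F s \<theta>) has_real_derivative F' s \<theta>) (at s within {..<T})" if "s \<in> {..<T}" for s \<theta>
      using d that by (auto intro: DERIV_subset)
    show "F s integrable_on cbox 0 (2*pi)" if "s \<in> {..<T}" for s
      using c that by (intro integrable_continuous) (auto intro: continuous_on_subset)
    show "continuous_on ({..<T} \<times> cbox 0 (2*pi)) (\<lambda>(s, \<theta>). F' s \<theta>)"
      by (rule continuous_on_subset[OF c']) auto
  qed (use assms in auto)
  moreover have "at s within {..<T} = at s"
    using assms by (intro at_within_open) auto
  ultimately show ?thesis by simp
qed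

text \<open>Cauchy-Schwarz against the constant 1, read off from the nonnegativity of the variance
  of \<open>f\<close>.\<close>

lemma integral_square_ge:
  fixes f :: "real \<Rightarrow> real"
  assumes c: "continuous_on {0..2*pi} f"
  shows "(cint f)\<^sup>2 \<le> 2 * pi * cint (\<lambda>x. (f x)\<^sup>2)"
proof -
  define a where "a = cint f / (2 * pi)"
  have i: "f integrable_on {0..2*pi}" "(\<lambda>x. (f x)\<^sup>2) integrable_on {0..2*pi}"
    using c by (auto intro!: integrable_continuous_interval continuous_intros)
  have "0 \<le> cint (\<lambda>x. (f x - a)\<^sup>2)"
    using c by (intro integral_nonneg integrable_continuous_interval continuous_intros) auto
  also have "(\<lambda>x. (f x - a)\<^sup>2) = (\<lambda>x. ((f x)\<^sup>2 - (2 * a) * f x) + a\<^sup>2)"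
    by (auto simp: power2_eq_square algebra_simps)
  also have "cint \<dots> = cint (\<lambda>x. (f x)\<^sup>2) - (2 * a) * cint f + 2 * pi * a\<^sup>2"
    using i by (subst integral_add integral_diff integral_mult_right; auto intro!: integrable_diff integrable_on_mult_right)+
  also have "\<dots> = cint (\<lambda>x. (f x)\<^sup>2) - (cint f)\<^sup>2 / (2 * pi)"
    by (simp add: a_def power2_eq_square field_simps)
  finally show ?thesis by (simp add: field_simps)
qed

text \<open>Averaging \<open>f y - f x\<close> over \<open>y\<close> gives \<open>- f x\<close>, so
  a function of mean zero is bounded by the integral \<open>D\<close> of
  \<open>\<bar>f'\<bar>\<close>; Cauchy-Schwarz turns \<open>D\<close> into the L2 norm of
  \<open>f'\<close>. The sharp constant for periodic functions is 1; the factor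
  \<open>4 * pi\<^sup>2\<close> only lowers the admissible exponents.\<close>

lemma wirtinger_weak:
  fixes f f' :: "real \<Rightarrow> real"
  assumes d: "\<And>x. (f has_real_derivative f' x) (at x)"
    and c': "continuous_on UNIV f'" and z: "cint f = 0"
  shows "cint (\<lambda>x. (f x)\<^sup>2) \<le> 4 * pi\<^sup>2 * cint (\<lambda>x. (f' x)\<^sup>2)"
proof -
  have c: "continuous_on A f" for A
    using d by (meson DERIV_continuous_on has_field_derivative_at_within)
  have c'A: "continuous_on A f'" for A
    using c' continuous_on_subset by blast
  define D where "D = cint (\<lambda>x. \<bar>f' x\<bar>)"
  have D0: "0 \<le> D"
    unfolding D_def using c'A by (intro integral_nonneg integrable_continuous_interval continuous_intros) auto
  have aux: "\<bar>f y - f x\<bar> \<le> D" if "x \<in> {0..2*pi}" "y \<in> {0..2*pi}" "x \<le> y" for x y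
  proof -
    have "(f' has_integral f y - f x) {x..y}"
      using that d by (intro fundamental_theorem_of_calculus)
        (auto simp: has_real_derivative_iff_has_vector_derivative[symmetric] intro: DERIV_subset)
    then have "\<bar>f y - f x\<bar> = \<bar>integral {x..y} f'\<bar>"
      by (simp add: integral_unique)
    also have "\<dots> \<le> integral {x..y} (\<lambda>t. \<bar>f' t\<bar>)"
      using integral_norm_bound_integral[of f' "{x..y}" "\<lambda>t. \<bar>f' t\<bar>"] c'A
      by (auto intro!: integrable_continuous_interval continuous_intros)
    also have "\<dots> \<le> D"
      unfolding D_def using that c'A
      by (intro integral_subset_le integrable_continuous_interval continuous_intros) auto
    finally show ?thesis .
  qed
  have diff: "\<bar>f y - f x\<bar> \<le> D" if "x \<in> {0..2*pi}" "y \<in> {0..2*pi}" for x y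
    using aux[of x y] aux[of y x] that by (cases "x \<le> y") (auto simp: abs_minus_commute)
  have bd: "\<bar>f x\<bar> \<le> D" if x: "x \<in> {0..2*pi}" for x
  proof -
    have i: "f integrable_on {0..2*pi}" using c by (intro integrable_continuous_interval)
    have "cint (\<lambda>y. f y - f x) = - 2 * pi * f x"
      using i z by (subst integral_diff) auto
    moreover have "\<bar>cint (\<lambda>y. f y - f x)\<bar> \<le> cint (\<lambda>y. D)"
      unfolding real_norm_def[symmetric]
      by (rule integral_norm_bound_integral) (use diff x i in \<open>auto intro!: integrable_diff\<close>)
    ultimately have "2 * pi * \<bar>f x\<bar> \<le> 2 * pi * D"
      by (simp add: abs_mult)
    then show ?thesis by simp
  qed
  have "cint (\<lambda>x. (f x)\<^sup>2) \<le> cint (\<lambda>x. D\<^sup>2)"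
    using bd D0 c by (intro integral_le integrable_continuous_interval continuous_intros)
      (auto simp flip: abs_le_square_iff)
  also have "\<dots> = 2 * pi * D\<^sup>2" by simp
  also have "\<dots> \<le> 2 * pi * (2 * pi * cint (\<lambda>x. \<bar>f' x\<bar>\<^sup>2))"
    using c'A unfolding D_def
    by (intro mult_left_mono integral_square_ge continuous_intros) auto
  finally show ?thesis by (simp add: power2_eq_square mult_ac)
qed

section \<open>Comparison and decay for second-order differential inequalities\<close>

lemma second_order_comparison:
  fixes N N1 N2 :: "real \<Rightarrow> real"
  assumes d1: "\<And>s. s \<le> T \<Longrightarrow> (N has_real_derivative N1 s) (at s)"
    and d2: "\<And>s. s \<le> T \<Longrightarrow> (N1 has_real_derivative N2 s) (at s)"
    and k: "k > 0" and N2: "\<And>s. s \<le> T \<Longrightarrow> N2 s \<le> k * N s"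
    and T: "N T \<ge> 0" and bot: "\<And>s. s \<le> S \<Longrightarrow> N s \<ge> 0"
    and t: "t \<le> T"
  shows "N t \<ge> 0"
proof (rule ccontr)
  assume neg: "\<not> N t \<ge> 0"
  \<comment> \<open>The left end is placed where \<open>N\<close> is known to be nonnegative, so
    that a negative minimum over \<open>{a..T}\<close> must be interior.\<close>
  define a where "a = min S t"
  have aT: "a \<le> T" using t a_def by auto
  have Na: "N a \<ge> 0"
    by (rule bot) (auto simp: a_def)
  have "continuous_on {a..T} N"
    using d1 by (intro DERIV_continuous_on) (auto intro: DERIV_subset)
  then obtain x where x: "x \<in> {a..T}" "\<And>y. y \<in> {a..T} \<Longrightarrow> N x \<le> N y"
    using continuous_attains_inf[of "{a..T}" N] aT by auto
  have Nx: "N x < 0" using x(2)[of t] neg t a_def by auto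
  have xin: "a < x" "x < T" using x(1) Nx Na T by (auto simp: less_le)
  have z: "N1 x = 0"
    by (rule DERIV_local_min[OF d1, of x "min (x - a) (T - x)"]) (use xin x(2) in \<open>auto simp: abs_if split: if_splits\<close>)
  \<comment> \<open>At a negative interior minimum the differential inequality makes the second
    derivative negative, so \<open>N1\<close> becomes negative just to the right of \<open>x\<close>
    and \<open>N\<close> falls below its minimum.\<close>
  have "N2 x < 0"
    using N2[of x] k Nx xin mult_pos_neg[of k "N x"] by auto
  then obtain e where e: "e > 0" "\<And>h. 0 < h \<Longrightarrow> h < e \<Longrightarrow> N1 (x + h) < 0"
    using DERIV_neg_dec_right[OF d2, of x] xin z by auto
  define h where "h = min (e/2) (T - x)"
  have h: "0 < h" "h < e" "x + h \<le> T" using e xin by (auto simp: h_def)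
  have "N (x + h) < N x"
  proof (rule DERIV_neg_imp_decreasing_open[where f = N and a = x and b = "x + h"])
    show "\<exists>y. (N has_real_derivative y) (at z) \<and> 0 > y" if "x < z" "z < x + h" for z
      using d1[of z] e(2)[of "z - x"] that h by auto
    show "continuous_on {x..x + h} N"
      by (rule DERIV_continuous_on[where D = N1], rule has_field_derivative_at_within, rule d1)
         (use h in auto)
  qed (use h in auto)
  moreover have "N x \<le> N (x + h)" using h xin by (intro x(2)) auto
  ultimately show False by simp
qed

text \<open>A Phragmen-Lindelof argument. \<open>exp (- l * s)\<close> solves the homogeneous
  equation and, since \<open>b < l\<close>, eventually dominates \<open>E\<close> towards minus
  infinity with any prefactor \<open>e > 0\<close>. The term \<open>D * exp (a * s)\<close> absorbs
  the source because \<open>a < l\<close>. Comparison with the sum holds for every \<open>e\<close>,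
  and \<open>e\<close> then tends to 0 at a fixed point.\<close>

lemma exponential_decay:
  fixes E E1 E2 :: "real \<Rightarrow> real"
  assumes d1: "\<And>s. s \<le> T \<Longrightarrow> (E has_real_derivative E1 s) (at s)"
    and d2: "\<And>s. s \<le> T \<Longrightarrow> (E1 has_real_derivative E2 s) (at s)"
    and E2: "\<And>s. s \<le> T \<Longrightarrow> E2 s \<ge> l\<^sup>2 * E s - B * exp (a * s)"
    and B: "B \<ge> 0" and a: "0 \<le> a" "a < l" and b: "b < l" and C: "C \<ge> 0"
    and growth: "\<And>s. s \<le> T \<Longrightarrow> E s \<le> C * exp (- b * s)"
  shows "\<exists>D. \<forall>s\<le>T. E s \<le> D * exp (a * s)"
proof -
  have al: "a\<^sup>2 < l\<^sup>2" using a by (simp add: power_strict_mono)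
  \<comment> \<open>The first entry makes \<open>D * exp (a * s)\<close> a supersolution; the second
    puts it above \<open>E\<close> at \<open>T\<close>.\<close>
  define D where "D = max (B / (l\<^sup>2 - a\<^sup>2)) (E T * exp (- a * T))"
  have D: "D * (l\<^sup>2 - a\<^sup>2) \<ge> B" "D * exp (a * T) \<ge> E T"
  proof -
    have "B / (l\<^sup>2 - a\<^sup>2) \<le> D" by (simp add: D_def)
    then show "D * (l\<^sup>2 - a\<^sup>2) \<ge> B" using al by (simp add: field_simps)
    have "E T * exp (- a * T) * exp (a * T) \<le> D * exp (a * T)"
      unfolding D_def by (intro mult_right_mono) auto
    then show "D * exp (a * T) \<ge> E T" by (simp add: mult.assoc flip: exp_add)
  qed
  have "B / (l\<^sup>2 - a\<^sup>2) \<ge> 0" using B al by simp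
  then have D0: "D \<ge> 0" by (simp add: D_def)
  have main: "E t \<le> D * exp (a * t) + e * exp (- l * t)" if e: "e > 0" and t: "t \<le> T" for e t
  proof -
    let ?N = "\<lambda>s. D * exp (a * s) + e * exp (- l * s) - E s"
    have "?N t \<ge> 0"
    \<comment> \<open>The second entry of \<open>S\<close> is the point below which
      \<open>(C + 1) * exp (- b * s) \<le> e * exp (- l * s)\<close>, so the growth bound on
      \<open>E\<close> is beaten there.\<close>
    proof (rule second_order_comparison[where N = ?N and T = T and t = t and k = "l\<^sup>2" and S = "min T (- ln ((C + 1) / e) / (l - b))"
          and ?N1.0 = "\<lambda>s. a * D * exp (a * s) - l * e * exp (- l * s) - E1 s"
          and ?N2.0 = "\<lambda>s. a * a * D * exp (a * s) + l * l * e * exp (- l * s) - E2 s"])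
      show "(?N has_real_derivative (a * D * exp (a * s) - l * e * exp (- l * s) - E1 s)) (at s)" if "s \<le> T" for s
        using that d1 by (auto intro!: derivative_eq_intros)
      show "((\<lambda>s. a * D * exp (a * s) - l * e * exp (- l * s) - E1 s) has_real_derivative
          (a * a * D * exp (a * s) + l * l * e * exp (- l * s) - E2 s)) (at s)" if "s \<le> T" for s
        using that d2 by (auto intro!: derivative_eq_intros)
      show "l\<^sup>2 > 0" using a by simp
      show "a * a * D * exp (a * s) + l * l * e * exp (- l * s) - E2 s \<le> l\<^sup>2 * ?N s" if "s \<le> T" for s
      proof -
        have "B * exp (a * s) \<le> D * (l\<^sup>2 - a\<^sup>2) * exp (a * s)"
          using D by (intro mult_right_mono) auto
        then show ?thesis using E2[OF that] by (simp add: power2_eq_square algebra_simps)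
      qed
      show "?N T \<ge> 0" using D(2) e by (simp add: add_increasing2)
      show "?N s \<ge> 0" if "s \<le> min T (- ln ((C + 1) / e) / (l - b))" for s
      proof -
        have "s \<le> - ln ((C + 1) / e) / (l - b)" by (rule min.boundedE[OF that])
        then have "ln ((C + 1) / e) \<le> (l - b) * (- s)"
          using b by (simp add: field_simps)
        then have "(C + 1) / e \<le> exp ((l - b) * (- s))"
          using C e by (metis add_nonneg_pos divide_pos_pos exp_le_cancel_iff exp_ln zero_less_one)
        then have "C + 1 \<le> e * exp ((l - b) * (- s))"
          using e by (simp add: field_simps)
        then have "(C + 1) * exp (- b * s) \<le> e * exp ((l - b) * (- s)) * exp (- b * s)"
          by (intro mult_right_mono) auto
        also have "\<dots> = e * exp (- l * s)"
          unfolding mult.assoc exp_add[symmetric] by (simp add: algebra_simps)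
        finally have "(C + 1) * exp (- b * s) \<le> e * exp (- l * s)" .
        moreover have "C * exp (- b * s) \<le> (C + 1) * exp (- b * s)"
          by (intro mult_right_mono) auto
        moreover have "E s \<le> C * exp (- b * s)"
          by (rule growth) (rule min.boundedE[OF that])
        moreover have "0 \<le> D * exp (a * s)" using D0 by (intro mult_nonneg_nonneg) simp_all
        ultimately show ?thesis by linarith
      qed
    qed (use t in auto)
    then show ?thesis by simp
  qed
  have "E t \<le> D * exp (a * t)" if "t \<le> T" for t
  proof (rule field_le_epsilon)
    fix e :: real assume "e > 0"
    then show "E t \<le> D * exp (a * t) + e"
      using main[of "e * exp (l * t)" t] that by (simp add: exp_minus field_simps)
  qed
  then show ?thesis by blast
qed

section \<open>Circular mean and energy of a function on a half-cylinder\<close>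

locale cylinder_C2 =
  fixes T :: real and V Vs Vss Vt Vtt :: "real \<Rightarrow> real \<Rightarrow> real"
  assumes ds: "\<And>s \<theta>. s < T \<Longrightarrow> ((\<lambda>s. V s \<theta>) has_real_derivative Vs s \<theta>) (at s)"
    and dss: "\<And>s \<theta>. s < T \<Longrightarrow> ((\<lambda>s. Vs s \<theta>) has_real_derivative Vss s \<theta>) (at s)"
    and dt: "\<And>s \<theta>. s < T \<Longrightarrow> (V s has_real_derivative Vt s \<theta>) (at \<theta>)"
    and dtt: "\<And>s \<theta>. s < T \<Longrightarrow> (Vt s has_real_derivative Vtt s \<theta>) (at \<theta>)"
    and cV: "continuous_on ({..<T} \<times> UNIV) (\<lambda>(s, \<theta>). V s \<theta>)"
    and cVs: "continuous_on ({..<T} \<times> UNIV) (\<lambda>(s, \<theta>). Vs s \<theta>)"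
    and cVss: "continuous_on ({..<T} \<times> UNIV) (\<lambda>(s, \<theta>). Vss s \<theta>)"
    and cVt: "continuous_on ({..<T} \<times> UNIV) (\<lambda>(s, \<theta>). Vt s \<theta>)"
    and cVtt: "continuous_on ({..<T} \<times> UNIV) (\<lambda>(s, \<theta>). Vtt s \<theta>)"
    and per: "\<And>s. s < T \<Longrightarrow> V s (2*pi) = V s 0" "\<And>s. s < T \<Longrightarrow> Vt s (2*pi) = Vt s 0"
begin

definition L :: "real \<Rightarrow> real \<Rightarrow> real" where "L s \<theta> = Vss s \<theta> + Vtt s \<theta>"
definition mu :: "real \<Rightarrow> real" where "mu s = cint (V s) / (2 * pi)"
definition mu1 :: "real \<Rightarrow> real" where "mu1 s = cint (Vs s) / (2 * pi)"
text \<open>Averages the full Laplacian \<open>L\<close>, the quantity that the equation controls,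
  and not \<open>Vss\<close>; by periodicity the difference \<open>Vtt\<close> has integral zero, so
  \<open>mu2\<close> is still the second derivative of \<open>mu\<close>.\<close>

definition mu2 :: "real \<Rightarrow> real" where "mu2 s = cint (L s) / (2 * pi)"

lemma slice:
  assumes "continuous_on ({..<T} \<times> UNIV) (\<lambda>(s, \<theta>). F s \<theta> :: real)" "s < T"
  shows "continuous_on A (F s)"
proof -
  have "continuous_on A (\<lambda>\<theta>. case (s, \<theta>) of (s, \<theta>) \<Rightarrow> F s \<theta>)"
    by (rule continuous_on_compose2[OF assms(1)]) (use assms in \<open>auto intro!: continuous_intros\<close>)
  then show ?thesis by simp
qed

lemmas slices = slice[OF cV] slice[OF cVs] slice[OF cVss] slice[OF cVt] slice[OF cVtt]

lemma cL: "continuous_on ({..<T} \<times> UNIV) (\<lambda>(s, \<theta>). L s \<theta>)"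
  using continuous_on_add[OF cVss cVtt] by (simp add: L_def case_prod_beta')

lemma cint_Vtt: "s < T \<Longrightarrow> cint (Vtt s) = 0"
proof -
  assume s: "s < T"
  have "(Vtt s has_integral Vt s (2*pi) - Vt s 0) {0..2*pi}"
    using dtt[OF s] by (intro fundamental_theorem_of_calculus)
      (auto simp: has_real_derivative_iff_has_vector_derivative[symmetric] intro: DERIV_subset)
  then show ?thesis using per s by (simp add: integral_unique)
qed

lemma cint_Vss: "s < T \<Longrightarrow> cint (Vss s) = cint (L s)"
  unfolding L_def[abs_def] using cint_Vtt slices
  by (subst integral_add) (auto intro!: integrable_continuous_interval)

lemma mu_deriv: "s < T \<Longrightarrow> (mu has_real_derivative mu1 s) (at s)"
  unfolding mu_def[abs_def] mu1_def
  by (intro DERIV_cdivide cint_has_real_derivative[where T = T] ds slices cVs) auto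

lemma mu1_deriv: "s < T \<Longrightarrow> (mu1 has_real_derivative mu2 s) (at s)"
  unfolding mu1_def[abs_def] mu2_def
  by (subst cint_Vss[symmetric], assumption)
     (intro DERIV_cdivide cint_has_real_derivative[where T = T] dss slices cVss; simp)

lemma mu_cont: "continuous_on {..<T} mu"
  using mu_deriv by (intro DERIV_continuous_on) (auto intro: DERIV_subset)

lemma mu1_cont: "continuous_on {..<T} mu1"
  using mu1_deriv by (intro DERIV_continuous_on) (auto intro: DERIV_subset)

lemma mu2_cont: "continuous_on {..<T} mu2"
proof -
  have "continuous_on {..<T} (\<lambda>s. integral (cbox 0 (2*pi)) (L s))"
    by (rule integral_continuous_on_param[OF continuous_on_subset[OF cL]]) auto
  then show ?thesis unfolding mu2_def[abs_def] by (auto intro!: continuous_intros)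
qed

definition En :: "real \<Rightarrow> real" where "En s = cint (\<lambda>\<theta>. (V s \<theta> - mu s)\<^sup>2)"
definition En1 :: "real \<Rightarrow> real" where "En1 s = cint (\<lambda>\<theta>. 2 * (V s \<theta> - mu s) * (Vs s \<theta> - mu1 s))"
definition En2 :: "real \<Rightarrow> real" where
  "En2 s = cint (\<lambda>\<theta>. 2 * (Vs s \<theta> - mu1 s)\<^sup>2 + 2 * (V s \<theta> - mu s) * (Vss s \<theta> - mu2 s))"

lemma cfst:
  assumes "continuous_on {..<T} f"
  shows "continuous_on ({..<T} \<times> UNIV) (\<lambda>(s, \<theta>::real). f s :: real)"
proof -
  have "continuous_on ({..<T} \<times> (UNIV::real set)) (\<lambda>p. f (fst p))"
    by (rule continuous_on_compose2[OF assms]) (auto intro!: continuous_intros)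
  then show ?thesis by (simp add: case_prod_beta')
qed

lemma En_deriv: "s < T \<Longrightarrow> (En has_real_derivative En1 s) (at s)"
  unfolding En_def[abs_def] En1_def
proof (rule cint_has_real_derivative[where T = T])
  show "((\<lambda>s. (V s \<theta> - mu s)\<^sup>2) has_real_derivative 2 * (V s \<theta> - mu s) * (Vs s \<theta> - mu1 s)) (at s)" if "s < T" for s \<theta>
    using ds[OF that] mu_deriv[OF that] by (auto intro!: derivative_eq_intros)
  show "continuous_on UNIV (\<lambda>\<theta>. (V s \<theta> - mu s)\<^sup>2)" if "s < T" for s
    using slices that by (intro continuous_intros)
  show "continuous_on ({..<T} \<times> UNIV) (\<lambda>(s, \<theta>). 2 * (V s \<theta> - mu s) * (Vs s \<theta> - mu1 s))"
    using cV cVs cfst[OF mu_cont] cfst[OF mu1_cont] unfolding case_prod_beta'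
    by (intro continuous_intros)
qed

lemma En1_deriv: "s < T \<Longrightarrow> (En1 has_real_derivative En2 s) (at s)"
  unfolding En1_def[abs_def] En2_def
proof (rule cint_has_real_derivative[where T = T])
  show "((\<lambda>s. 2 * (V s \<theta> - mu s) * (Vs s \<theta> - mu1 s)) has_real_derivative
      2 * (Vs s \<theta> - mu1 s)\<^sup>2 + 2 * (V s \<theta> - mu s) * (Vss s \<theta> - mu2 s)) (at s)" if "s < T" for s \<theta>
    using ds[OF that] dss[OF that] mu_deriv[OF that] mu1_deriv[OF that]
    by (auto intro!: derivative_eq_intros simp: power2_eq_square algebra_simps)
  show "continuous_on UNIV (\<lambda>\<theta>. 2 * (V s \<theta> - mu s) * (Vs s \<theta> - mu1 s))" if "s < T" for s
    using slices that by (intro continuous_intros)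
  show "continuous_on ({..<T} \<times> UNIV) (\<lambda>(s, \<theta>). 2 * (Vs s \<theta> - mu1 s)\<^sup>2 + 2 * (V s \<theta> - mu s) * (Vss s \<theta> - mu2 s))"
    using cV cVs cVss cfst[OF mu_cont] cfst[OF mu1_cont] cfst[OF mu2_cont] unfolding case_prod_beta'
    by (intro continuous_intros)
qed

lemma cint_V_minus_mu: "s < T \<Longrightarrow> cint (\<lambda>\<theta>. V s \<theta> - mu s) = 0"
  using slices by (subst integral_diff) (auto simp: mu_def intro!: integrable_continuous_interval)

lemma mu2_bound:
  assumes s: "s < T" and B: "\<And>\<theta>. \<bar>L s \<theta>\<bar> \<le> B"
  shows "\<bar>mu2 s\<bar> \<le> B"
proof -
  have "\<bar>cint (L s)\<bar> \<le> cint (\<lambda>_. B)"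
    unfolding real_norm_def[symmetric]
    by (rule integral_norm_bound_integral)
       (use B slice[OF cL s] in \<open>auto intro!: integrable_continuous_interval\<close>)
  then show ?thesis by (simp add: mu2_def field_simps)
qed

text \<open>Replacing \<open>Vss\<close> by \<open>L - Vtt\<close> and integrating by parts over the
  circle produces \<open>2 * cint (\<lambda>\<theta>. (Vt s \<theta>)\<^sup>2)\<close>, which
  Wirtinger bounds below by \<open>2 * k * En s\<close> with
  \<open>k = (1 / (2 * pi))\<^sup>2\<close>. Young's inequality for the source costs one of these
  two copies, which leaves the factor \<open>k\<close>.\<close>

lemma En2_lower:
  assumes s: "s < T" and B: "\<And>\<theta>. \<bar>L s \<theta>\<bar> \<le> B"
  shows "En2 s \<ge> (1 / (2 * pi))\<^sup>2 * En s - 32 * pi^3 * B\<^sup>2"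
proof -
  define k where "k = (1 / (2 * pi))\<^sup>2"
  have k: "k > 0" "1 / k = 4 * pi\<^sup>2" by (simp_all add: k_def power_divide)
  let ?W = "\<lambda>\<theta>. V s \<theta> - mu s"
  note I = integrable_continuous_interval
  note c = slices[OF s]
  have parts: "cint (\<lambda>\<theta>. (Vt s \<theta>)\<^sup>2 + ?W \<theta> * Vtt s \<theta>) = 0"
  proof -
    have "((\<lambda>\<theta>. (Vt s \<theta>)\<^sup>2 + ?W \<theta> * Vtt s \<theta>) has_integral ?W (2*pi) * Vt s (2*pi) - ?W 0 * Vt s 0) {0..2*pi}"
    proof (rule fundamental_theorem_of_calculus)
      fix x
      have "((\<lambda>\<theta>. ?W \<theta> * Vt s \<theta>) has_real_derivative (Vt s x)\<^sup>2 + ?W x * Vtt s x) (at x)"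
        using dt[OF s] dtt[OF s] by (auto intro!: derivative_eq_intros simp: power2_eq_square)
      then show "((\<lambda>\<theta>. ?W \<theta> * Vt s \<theta>) has_vector_derivative (Vt s x)\<^sup>2 + ?W x * Vtt s x) (at x within {0..2*pi})"
        by (auto simp: has_real_derivative_iff_has_vector_derivative[symmetric] intro: DERIV_subset)
    qed auto
    then show ?thesis using per[OF s] by (simp add: integral_unique)
  qed
  have wirt: "En s \<le> 4 * pi\<^sup>2 * cint (\<lambda>\<theta>. (Vt s \<theta>)\<^sup>2)"
    unfolding En_def
    by (rule wirtinger_weak) (use dt[OF s] c cint_V_minus_mu[OF s] in \<open>auto intro!: derivative_eq_intros\<close>)
  \<comment> \<open>Completing the square with weight \<open>k\<close>: the source \<open>G\<close>
    satisfies \<open>\<bar>G\<bar> \<le> 2 * B\<close>, and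
    \<open>G\<^sup>2 / k \<le> 16 * pi\<^sup>2 * B\<^sup>2\<close>. The last summand on the right
    has integral zero by \<open>parts\<close>; it trades \<open>Vss\<close> for
    \<open>L\<close>.\<close>
  have pt: "2 * (Vt s \<theta>)\<^sup>2 - k * (?W \<theta>)\<^sup>2 - 16 * pi\<^sup>2 * B\<^sup>2 \<le>
      2 * (Vs s \<theta> - mu1 s)\<^sup>2 + 2 * ?W \<theta> * (Vss s \<theta> - mu2 s) + 2 * ((Vt s \<theta>)\<^sup>2 + ?W \<theta> * Vtt s \<theta>)" for \<theta>
  proof -
    define G where "G = L s \<theta> - mu2 s"
    have "\<bar>G\<bar> \<le> 2 * B" using B[of \<theta>] mu2_bound[OF s B] unfolding G_def by linarith
    then have G2: "G\<^sup>2 \<le> (2 * B)\<^sup>2"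
      using abs_le_square_iff[of G "2 * B"] by simp
    have "0 \<le> k * (?W \<theta> + G / k)\<^sup>2" using k by simp
    also have "\<dots> = k * (?W \<theta>)\<^sup>2 + 2 * ?W \<theta> * G + G\<^sup>2 * (1 / k)"
      using k(1) by (simp add: power2_eq_square field_simps)
    finally have "- (k * (?W \<theta>)\<^sup>2) - G\<^sup>2 * (4 * pi\<^sup>2) \<le> 2 * ?W \<theta> * G" using k by simp
    moreover have "G\<^sup>2 * (4 * pi\<^sup>2) \<le> 16 * pi\<^sup>2 * B\<^sup>2"
      using mult_right_mono[OF G2, of "4 * pi\<^sup>2"] by (simp add: power_mult_distrib mult_ac)
    ultimately have "- (k * (?W \<theta>)\<^sup>2) - 16 * pi\<^sup>2 * B\<^sup>2 \<le> 2 * ?W \<theta> * G"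
      by linarith
    moreover have "0 \<le> 2 * (Vs s \<theta> - mu1 s)\<^sup>2" by simp
    moreover have "2 * ?W \<theta> * (Vss s \<theta> - mu2 s) + 2 * ((Vt s \<theta>)\<^sup>2 + ?W \<theta> * Vtt s \<theta>) = 2 * ?W \<theta> * G + 2 * (Vt s \<theta>)\<^sup>2"
      by (simp add: G_def L_def algebra_simps)
    ultimately show ?thesis by linarith
  qed
  have "2 * cint (\<lambda>\<theta>. (Vt s \<theta>)\<^sup>2) - k * En s - 2 * pi * (16 * pi\<^sup>2 * B\<^sup>2)
     = cint (\<lambda>\<theta>. 2 * (Vt s \<theta>)\<^sup>2 - k * (?W \<theta>)\<^sup>2 - 16 * pi\<^sup>2 * B\<^sup>2)"
    unfolding En_def using c
    by (subst integral_diff integral_mult_right; (intro I continuous_intros)?; simp?)+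
  also have "\<dots> \<le> cint (\<lambda>\<theta>. (2 * (Vs s \<theta> - mu1 s)\<^sup>2 + 2 * ?W \<theta> * (Vss s \<theta> - mu2 s)) + 2 * ((Vt s \<theta>)\<^sup>2 + ?W \<theta> * Vtt s \<theta>))"
    by (rule integral_le) (use c pt in \<open>auto intro!: I continuous_intros\<close>)
  also have "\<dots> = En2 s + 2 * cint (\<lambda>\<theta>. (Vt s \<theta>)\<^sup>2 + ?W \<theta> * Vtt s \<theta>)"
    unfolding En2_def integral_mult_right[symmetric]
    by (rule integral_add) (use c in \<open>auto intro!: I continuous_intros\<close>)
  finally have "2 * cint (\<lambda>\<theta>. (Vt s \<theta>)\<^sup>2) - k * En s - 32 * pi^3 * B\<^sup>2 \<le> En2 s"
    unfolding parts by (simp add: power2_eq_square power3_eq_cube mult_ac)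
  moreover have "k * En s \<le> cint (\<lambda>\<theta>. (Vt s \<theta>)\<^sup>2)"
    using wirt by (simp add: k_def power_divide field_simps)
  ultimately show ?thesis unfolding k_def[symmetric] by linarith
qed

end

subsection \<open>Functions of class C2 on the plane\<close>

text \<open>Carries gradient and Hessian as explicit functions, so that chain rules can compute with
  them and \<open>trace (H x)\<close> is the Laplacian. Continuity is stated for \<open>H\<close>;
  for \<open>v\<close> and \<open>g\<close> it follows from differentiability.\<close>

definition C2_jet :: "(real^2) set \<Rightarrow> (real^2 \<Rightarrow> real) \<Rightarrow> (real^2 \<Rightarrow> real^2) \<Rightarrow> (real^2 \<Rightarrow> real^2^2) \<Rightarrow> bool" where
  "C2_jet S v g H \<longleftrightarrow>
     (\<forall>x\<in>S. (v has_derivative (\<lambda>h. g x \<bullet> h)) (at x)) \<and>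
     (\<forall>x\<in>S. (g has_derivative (\<lambda>h. H x *v h)) (at x)) \<and>
     continuous_on S H"

lemma trace_2: "trace (A :: real^2^2) = A $ 1 $ 1 + A $ 2 $ 2"
  by (simp add: trace_def sum_2)

lemma matrix_vector_mult_2: "((A :: real^2^2) *v x) $ i = A $ i $ 1 * x $ 1 + A $ i $ 2 * x $ 2"
  by (simp add: matrix_vector_mult_def sum_2)

lemma Basis_vec2: "(Basis :: (real^2) set) = {axis 1 1, axis 2 1}"
  by (auto simp: Basis_vec_def UNIV_2)

lemma C2_jet_subset: "C2_jet S v g H \<Longrightarrow> S' \<subseteq> S \<Longrightarrow> C2_jet S' v g H"
  unfolding C2_jet_def by (meson continuous_on_subset subsetD)

lemma C2_jet_continuous: "C2_jet S v g H \<Longrightarrow> A \<subseteq> S \<Longrightarrow> continuous_on A v"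
  unfolding C2_jet_def by (meson continuous_at_imp_continuous_on has_derivative_continuous subsetD)

lemma C2_jet_continuous_grad: "C2_jet S v g H \<Longrightarrow> A \<subseteq> S \<Longrightarrow> continuous_on A g"
  unfolding C2_jet_def by (meson continuous_at_imp_continuous_on has_derivative_continuous subsetD)

lemma C2_jet_lincomb:
  assumes "C2_jet S v g H" "C2_jet S w g' H'"
  shows "C2_jet S (\<lambda>x. a * v x + b * w x) (\<lambda>x. a *\<^sub>R g x + b *\<^sub>R g' x) (\<lambda>x. a *\<^sub>R H x + b *\<^sub>R H' x)"
  using assms unfolding C2_jet_def
  by (auto intro!: derivative_eq_intros continuous_intros
      simp: inner_add_left matrix_vector_mult_add_rdistrib scaleR_matrix_vector_assoc)

lemma C2_jet_uminus:
  assumes "C2_jet S v g H"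
  shows "C2_jet S (\<lambda>x. - v x) (\<lambda>x. - g x) (\<lambda>x. - H x)"
  using C2_jet_lincomb[OF assms assms, of "-1" 0] by simp

lemma C2_jet_const: "C2_jet S (\<lambda>x. c) (\<lambda>x. 0) (\<lambda>x. 0)"
  unfolding C2_jet_def by (auto intro!: derivative_eq_intros continuous_intros)

lemma trace_lincomb: "trace (a *\<^sub>R A + b *\<^sub>R B) = a * trace A + b * trace (B :: real^2^2)"
  by (simp add: trace_2 algebra_simps)

lemma trace_minus: "trace (- A) = - trace (A :: real^2^2)"
  by (simp add: trace_2)

text \<open>The logarithm is the harmonic corrector of the whole argument: multiples of it can be
  subtracted without changing any trace, both to cancel the slope of a circular average and to
  remove the singular term \<open>\<alpha> * ln (norm x)\<close>.\<close>

lemma C2_jet_ln_norm: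
  defines "H \<equiv> \<lambda>x::real^2. \<chi> i j. (if i = j then 1 / (x \<bullet> x) else 0) - 2 * x $ i * x $ j / (x \<bullet> x)\<^sup>2"
  shows "C2_jet (- {0}) (\<lambda>x. ln (norm x)) (\<lambda>x. (1 / (x \<bullet> x)) *\<^sub>R x) H"
    and "x \<noteq> 0 \<Longrightarrow> trace (H x) = 0"
proof -
  show "C2_jet (- {0}) (\<lambda>x. ln (norm x)) (\<lambda>x. (1 / (x \<bullet> x)) *\<^sub>R x) H"
    unfolding C2_jet_def
  proof (intro conjI ballI)
    fix x :: "real^2" assume x: "x \<in> - {0}"
    then have n: "norm x > 0" "x \<noteq> 0" by auto
    show "((\<lambda>x. ln (norm x)) has_derivative (\<lambda>h. ((1 / (x \<bullet> x)) *\<^sub>R x) \<bullet> h)) (at x)"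
    proof -
      have "(norm has_derivative (\<lambda>h. sgn x \<bullet> h)) (at x)"
        using has_derivative_norm[OF n(2)] by (simp only: inner_commute)
      then have "((\<lambda>x. ln (norm x)) has_derivative (\<lambda>h. inverse (norm x) * (sgn x \<bullet> h))) (at x)"
        using n by (auto intro!: derivative_eq_intros)
      then show ?thesis
        by (simp add: sgn_div_norm dot_square_norm power2_eq_square divide_inverse mult.assoc)
    qed
    have "((\<lambda>x. (1 / (x \<bullet> x)) *\<^sub>R x) has_derivative
        (\<lambda>h. (1 / (x \<bullet> x)) *\<^sub>R h + (- (2 * (x \<bullet> h)) / (x \<bullet> x)\<^sup>2) *\<^sub>R x)) (at x)"
      using n by (auto intro!: derivative_eq_intros simp: fun_eq_iff inner_commute power2_eq_square divide_inverse)
    moreover have "(\<lambda>h. (1 / (x \<bullet> x)) *\<^sub>R h + (- (2 * (x \<bullet> h)) / (x \<bullet> x)\<^sup>2) *\<^sub>R x) = (\<lambda>h. H x *v h)"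
      unfolding H_def vec2_eq_iff fun_eq_iff matrix_vector_mult_2 inner_vec2[of x "_ :: real^2"]
      by (auto simp: algebra_simps add_divide_distrib diff_divide_distrib)
    ultimately show "((\<lambda>x. (1 / (x \<bullet> x)) *\<^sub>R x) has_derivative (\<lambda>h. H x *v h)) (at x)" by simp
  next
    show "continuous_on (- {0}) H"
      unfolding H_def
    proof (intro continuous_on_vec_lambda)
      fix i j :: 2
      show "continuous_on (- {0}) (\<lambda>x::real^2. (if i = j then 1 / (x \<bullet> x) else 0) - 2 * x $ i * x $ j / (x \<bullet> x)\<^sup>2)"
        by (cases "i = j") (auto intro!: continuous_intros)
    qed
  qed
  assume x: "x \<noteq> 0"
  have "x \<bullet> x = x $ 1 * x $ 1 + x $ 2 * x $ 2" by (rule inner_vec2)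
  moreover have "trace (H x) = 2 / (x \<bullet> x) - 2 * (x $ 1 * x $ 1 + x $ 2 * x $ 2) / (x \<bullet> x)\<^sup>2"
    by (simp add: trace_2 H_def add_divide_distrib algebra_simps)
  ultimately have "trace (H x) = 2 / (x \<bullet> x) - 2 * (x \<bullet> x) / (x \<bullet> x)\<^sup>2"
    by metis
  also have "\<dots> = 0" using x by (simp add: power2_eq_square)
  finally show "trace (H x) = 0" .
qed

lemma C2_on_imp_C2_jet:
  fixes u :: "real^2 \<Rightarrow> real"
  assumes "C2_on S u"
  shows "\<exists>g H. C2_jet S u g H \<and> (\<forall>x. trace (H x) = laplacian u x)"
proof (intro exI conjI allI)
  define g where "g = (\<lambda>x. \<chi> i. partial_deriv u (axis i 1) x)"
  define H where "H = (\<lambda>x. \<chi> i j. partial_deriv (partial_deriv u (axis i 1)) (axis j 1) x)"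
  have ax: "axis i (1::real) \<in> Basis" for i :: 2 by simp
  have key: "(f has_derivative (\<lambda>h. partial_deriv f (axis 1 1) x * h $ 1 + partial_deriv f (axis 2 1) x * h $ 2)) (at x)"
    if "f differentiable (at x)" for f :: "real^2 \<Rightarrow> real" and x
  proof -
    have D: "(f has_derivative frechet_derivative f (at x)) (at x)"
      using that frechet_derivative_works by blast
    then interpret linear "frechet_derivative f (at x)"
      by (rule has_derivative_linear)
    have "frechet_derivative f (at x) h = partial_deriv f (axis 1 1) x * h $ 1 + partial_deriv f (axis 2 1) x * h $ 2" for h
    proof -
      have "h = h $ 1 *\<^sub>R axis 1 1 + h $ 2 *\<^sub>R axis 2 1"
        by (simp add: vec2_eq_iff axis_def)
      then have "frechet_derivative f (at x) h = frechet_derivative f (at x) (h $ 1 *\<^sub>R axis 1 1 + h $ 2 *\<^sub>R axis 2 1)"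
        by metis
      then show ?thesis by (simp add: add scale partial_deriv_def)
    qed
    then have "frechet_derivative f (at x) = (\<lambda>h. partial_deriv f (axis 1 1) x * h $ 1 + partial_deriv f (axis 2 1) x * h $ 2)"
      by blast
    with D show ?thesis by simp
  qed
  show "C2_jet S u g H"
    unfolding C2_jet_def
  proof (intro conjI ballI)
    fix x assume "x \<in> S"
    then have d: "u differentiable (at x)" "\<And>i. partial_deriv u (axis i 1) differentiable (at x)"
      using assms ax unfolding C2_on_def by blast+
    show "(u has_derivative (\<bullet>) (g x)) (at x)"
    proof -
      have "(\<bullet>) (g x) = (\<lambda>h. partial_deriv u (axis 1 1) x * h $ 1 + partial_deriv u (axis 2 1) x * h $ 2)"
        by (rule ext) (simp add: inner_vec2 g_def)
      with key[OF d(1)] show ?thesis by simp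
    qed
    show "(g has_derivative (*v) (H x)) (at x)"
    proof (subst has_derivative_componentwise_within, rule ballI)
      fix b :: "real^2" assume "b \<in> Basis"
      then obtain i where b: "b = axis i 1" by (auto simp: Basis_vec2)
      show "((\<lambda>x. g x \<bullet> b) has_derivative (\<lambda>h. (H x *v h) \<bullet> b)) (at x)"
        using key[OF d(2)[of i]] by (simp add: b inner_axis g_def H_def matrix_vector_mult_2)
    qed
  next
    show "continuous_on S H"
      unfolding H_def using assms ax unfolding C2_on_def
      by (intro continuous_on_vec_lambda) blast
  qed
  show "trace (H x) = laplacian u x" for x
  proof -
    have "axis 1 1 \<noteq> (axis 2 1 :: real^2)" by (simp add: axis_eq_axis)
    then show ?thesis by (simp add: trace_2 H_def laplacian_def Basis_vec2)
  qed
qed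

text \<open>Conformal invariance: \<open>expolar s \<theta>\<close> and
  \<open>expolar s (q \<theta>)\<close> are orthogonal of length \<open>exp s\<close>, so the two
  Hessian terms add up to \<open>exp (2 * s)\<close> times the trace, while the gradient terms of
  \<open>Vss\<close> and \<open>Vtt\<close> cancel. The centre \<open>c\<close> is arbitrary because
  the same computation serves the puncture and the mean values around other points.\<close>

lemma cylinder_C2_polar:
  assumes jet: "C2_jet S v g H" and "open S" and S: "\<And>s \<theta>. s < T \<Longrightarrow> c + expolar s \<theta> \<in> S"
  defines "q \<equiv> \<lambda>\<theta>::real. \<theta> + pi / 2"
  defines "V \<equiv> \<lambda>s \<theta>. v (c + expolar s \<theta>)"
    and "Vs \<equiv> \<lambda>s \<theta>. g (c + expolar s \<theta>) \<bullet> expolar s \<theta>"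
    and "Vss \<equiv> \<lambda>s \<theta>. g (c + expolar s \<theta>) \<bullet> expolar s \<theta> + (H (c + expolar s \<theta>) *v expolar s \<theta>) \<bullet> expolar s \<theta>"
    and "Vt \<equiv> \<lambda>s \<theta>. g (c + expolar s \<theta>) \<bullet> expolar s (q \<theta>)"
    and "Vtt \<equiv> \<lambda>s \<theta>. - (g (c + expolar s \<theta>) \<bullet> expolar s \<theta>) + (H (c + expolar s \<theta>) *v expolar s (q \<theta>)) \<bullet> expolar s (q \<theta>)"
  shows "cylinder_C2 T V Vs Vss Vt Vtt"
    and "Vss s \<theta> + Vtt s \<theta> = exp (2 * s) * trace (H (c + expolar s \<theta>))"
proof -
  have dv: "(v has_derivative (\<lambda>h. g x \<bullet> h)) (at x within A)" if "x \<in> S" for x A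
    using jet that unfolding C2_jet_def by (meson has_derivative_at_withinI)
  have dg: "(g has_derivative (\<lambda>h. H x *v h)) (at x within A)" if "x \<in> S" for x A
    using jet that unfolding C2_jet_def by (meson has_derivative_at_withinI)
  have ps: "((\<lambda>s. c + expolar s \<theta>) has_derivative (\<lambda>h. h *\<^sub>R expolar s \<theta>)) (at s)" for s \<theta>
    by (auto intro!: derivative_eq_intros)
  have pt: "((\<lambda>\<theta>. c + expolar s \<theta>) has_derivative (\<lambda>h. h *\<^sub>R expolar s (q \<theta>))) (at \<theta>)" for s \<theta>
    unfolding q_def by (auto intro!: derivative_eq_intros)
  have eqq: "expolar s (q (q \<theta>)) = - expolar s \<theta>" for s \<theta>
    by (simp add: vec2_eq_iff q_def sin_add cos_add)
  have ds: "((\<lambda>s. V s \<theta>) has_real_derivative Vs s \<theta>) (at s)" if "s < T" for s \<theta>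
    unfolding V_def Vs_def has_field_derivative_def
    using has_derivative_compose[where f = "\<lambda>s. c + expolar s \<theta>" and g = v, OF ps dv[OF S[OF that]]] by (simp add: mult_commute_abs)
  have dt: "((\<lambda>\<theta>. V s \<theta>) has_real_derivative Vt s \<theta>) (at \<theta>)" if "s < T" for s \<theta>
    unfolding V_def Vt_def has_field_derivative_def
    using has_derivative_compose[where f = "\<lambda>\<theta>. c + expolar s \<theta>" and g = v, OF pt dv[OF S[OF that]]] by (simp add: mult_commute_abs)
  have gs: "((\<lambda>s. g (c + expolar s \<theta>)) has_derivative (\<lambda>h. h *\<^sub>R (H (c + expolar s \<theta>) *v expolar s \<theta>))) (at s)"
    if "s < T" for s \<theta>
    using has_derivative_compose[where f = "\<lambda>s. c + expolar s \<theta>" and g = g, OF ps dg[OF S[OF that]]] by (simp add: matrix_vector_mult_scaleR)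
  have gt: "((\<lambda>\<theta>. g (c + expolar s \<theta>)) has_derivative (\<lambda>h. h *\<^sub>R (H (c + expolar s \<theta>) *v expolar s (q \<theta>)))) (at \<theta>)"
    if "s < T" for s \<theta>
    using has_derivative_compose[where f = "\<lambda>\<theta>. c + expolar s \<theta>" and g = g, OF pt dg[OF S[OF that]]] by (simp add: matrix_vector_mult_scaleR)
  have es: "((\<lambda>s. expolar s \<theta>) has_derivative (\<lambda>h. h *\<^sub>R expolar s \<theta>)) (at s)" for s \<theta>
    by (auto intro!: derivative_eq_intros)
  have et: "((\<lambda>\<theta>. expolar s (q \<theta>)) has_derivative (\<lambda>h. h *\<^sub>R expolar s (q (q \<theta>)))) (at \<theta>)" for s \<theta>
    unfolding q_def by (auto intro!: derivative_eq_intros)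
  have dss: "((\<lambda>s. Vs s \<theta>) has_real_derivative Vss s \<theta>) (at s)" if "s < T" for s \<theta>
    unfolding Vs_def Vss_def has_field_derivative_def
    using has_derivative_inner[OF gs[OF that, where \<theta>=\<theta>] es[where \<theta>=\<theta>]]
    by (simp flip: distrib_left add: mult_commute_abs)
  have dtt: "((\<lambda>\<theta>. Vt s \<theta>) has_real_derivative Vtt s \<theta>) (at \<theta>)" if "s < T" for s \<theta>
    unfolding Vt_def Vtt_def has_field_derivative_def
    by (rule has_derivative_eq_rhs[OF has_derivative_inner[OF gt[OF that, where \<theta>=\<theta>] et[where \<theta>=\<theta> and s=s]]])
       (simp add: eqq fun_eq_iff algebra_simps)
  have cp: "continuous_on ({..<T} \<times> UNIV) (\<lambda>w. c + expolar (fst w) (snd w))"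
    "continuous_on ({..<T} \<times> UNIV) (\<lambda>w. expolar (fst w) (snd w))"
    "continuous_on ({..<T} \<times> UNIV) (\<lambda>w. expolar (fst w) (q (snd w)))"
    unfolding q_def by (intro continuous_intros)+
  have im: "(\<lambda>w. c + expolar (fst w) (snd w)) ` ({..<T} \<times> UNIV) \<subseteq> S"
    using S by auto
  have cv: "continuous_on ({..<T} \<times> UNIV) (\<lambda>w. v (c + expolar (fst w) (snd w)))"
    and cg: "continuous_on ({..<T} \<times> UNIV) (\<lambda>w. g (c + expolar (fst w) (snd w)))"
    and cH: "continuous_on ({..<T} \<times> UNIV) (\<lambda>w. H (c + expolar (fst w) (snd w)))"
    using C2_jet_continuous[OF jet order_refl] C2_jet_continuous_grad[OF jet order_refl] jet
    unfolding C2_jet_def by (auto intro: continuous_on_compose2[OF _ cp(1) im])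
  show "cylinder_C2 T V Vs Vss Vt Vtt"
  proof
    show "continuous_on ({..<T} \<times> UNIV) (\<lambda>(s, \<theta>). V s \<theta>)"
      "continuous_on ({..<T} \<times> UNIV) (\<lambda>(s, \<theta>). Vs s \<theta>)"
      "continuous_on ({..<T} \<times> UNIV) (\<lambda>(s, \<theta>). Vt s \<theta>)"
      unfolding V_def Vs_def Vt_def case_prod_beta'
      by (intro cv cg cp continuous_intros)+
    show "continuous_on ({..<T} \<times> UNIV) (\<lambda>(s, \<theta>). Vss s \<theta>)"
      "continuous_on ({..<T} \<times> UNIV) (\<lambda>(s, \<theta>). Vtt s \<theta>)"
      unfolding Vss_def Vtt_def case_prod_beta' inner_vec2 matrix_vector_mult_2
      by (intro cg cH cp continuous_intros)+
    show "V s (2*pi) = V s 0" for s by (simp add: V_def)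
    have "expolar s (q (2*pi)) = expolar s (q 0)" for s
      unfolding vec2_eq_iff q_def expolar_nth sin_add cos_add by simp
    then show "Vt s (2*pi) = Vt s 0" for s by (simp add: Vt_def)
  qed (fact ds dss dt dtt)+
  define A where "A = H (c + expolar s \<theta>)"
  have "Vss s \<theta> + Vtt s \<theta> = (A *v expolar s \<theta>) \<bullet> expolar s \<theta> + (A *v expolar s (q \<theta>)) \<bullet> expolar s (q \<theta>)"
    by (simp add: Vss_def Vtt_def A_def)
  also have "\<dots> = exp s * exp s * ((A $ 1 $ 1 + A $ 2 $ 2) * ((sin \<theta>)\<^sup>2 + (cos \<theta>)\<^sup>2))"
    unfolding inner_vec2 matrix_vector_mult_2 expolar_nth q_def
    by (simp add: sin_add cos_add power2_eq_square algebra_simps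
        del: sin_cos_squared_add sin_cos_squared_add2 sin_cos_squared_add3)
  also have "\<dots> = exp (2 * s) * trace A"
    unfolding sin_cos_squared_add trace_2 exp_add[symmetric] mult_2 mult_1_right ..
  finally show "Vss s \<theta> + Vtt s \<theta> = exp (2 * s) * trace (H (c + expolar s \<theta>))"
    unfolding A_def .
qed

subsection \<open>Mean value inequalities\<close>

lemma set_integral_eq_cint:
  assumes c: "continuous_on {0..2*pi} f"
  shows "(LINT \<theta>:{0<..<2*pi}|lborel. f \<theta>) = cint f"
proof -
  have i: "set_integrable lborel {0<..<2*pi} f"
    by (rule set_integrable_subset[OF borel_integrable_atLeastAtMost'[OF c]]) auto
  have "(LINT \<theta>:{0<..<2*pi}|lborel. f \<theta>) = integral {0<..<2*pi} f"
    by (rule set_borel_integral_eq_integral(2)[OF i])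
  then show ?thesis by (simp add: integral_open_interval_real)
qed

text \<open>A tangent of negative slope rises without bound towards minus infinity, and a convex
  function stays above its tangent.\<close>

lemma bounded_convex_deriv_nonneg:
  fixes N N1 N2 :: "real \<Rightarrow> real"
  assumes d1: "\<And>s. s < T \<Longrightarrow> (N has_real_derivative N1 s) (at s)"
    and d2: "\<And>s. s < T \<Longrightarrow> (N1 has_real_derivative N2 s) (at s)"
    and N2: "\<And>s. s < T \<Longrightarrow> N2 s \<ge> 0"
    and bd: "\<And>s. s \<le> S \<Longrightarrow> N s \<le> C" and t: "t < T"
  shows "N1 t \<ge> 0"
proof (rule ccontr)
  assume "\<not> N1 t \<ge> 0"
  then have neg: "N1 t < 0" by simp
  have N1: "N1 s \<le> N1 t" if "s \<le> t" for s
    by (rule DERIV_nonneg_imp_nondecreasing[OF that]) (use d2 N2 t in \<open>auto intro: le_less_trans\<close>)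
  have tangent: "N t + N1 t * (s - t) \<le> N s" if "s \<le> t" for s
  proof -
    have "- (N s - N1 t * s) \<le> - (N t - N1 t * t)"
    proof (rule DERIV_nonneg_imp_nondecreasing[OF that])
      fix x assume x: "s \<le> x" "x \<le> t"
      have "((\<lambda>s. - (N s - N1 t * s)) has_real_derivative - (N1 x - N1 t)) (at x)"
        using d1[of x] x t by (auto intro!: derivative_eq_intros)
      moreover have "- (N1 x - N1 t) \<ge> 0" using N1 x by simp
      ultimately show "\<exists>y. ((\<lambda>s. - (N s - N1 t * s)) has_real_derivative y) (at x) \<and> 0 \<le> y" by blast
    qed
    then show ?thesis by (simp add: algebra_simps)
  qed
  define s where "s = min S (min t (t + (C - N t + 1) / N1 t))"
  have s: "s \<le> S" "s \<le> t" "s - t \<le> (C - N t + 1) / N1 t" by (auto simp: s_def)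
  have "N1 t * ((C - N t + 1) / N1 t) \<le> N1 t * (s - t)"
    using s(3) neg by (intro mult_left_mono_neg) auto
  then have "C - N t + 1 \<le> N1 t * (s - t)" using neg by simp
  with tangent[OF s(2)] bd[OF s(1)] show False by simp
qed

lemma cint_near:
  assumes c: "continuous_on {0..2*pi} f" and e: "\<And>\<theta>. \<bar>f \<theta> - a\<bar> \<le> e"
  shows "\<bar>cint f / (2 * pi) - a\<bar> \<le> e"
proof -
  have "\<bar>cint (\<lambda>\<theta>. f \<theta> - a)\<bar> \<le> cint (\<lambda>\<theta>. e)"
    unfolding real_norm_def[symmetric]
    by (rule integral_norm_bound_integral)
       (use c e in \<open>auto intro!: integrable_continuous_interval continuous_intros\<close>)
  also have "cint (\<lambda>\<theta>. f \<theta> - a) = cint f - 2 * pi * a"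
    using c by (subst integral_diff) (auto intro!: integrable_continuous_interval)
  finally have "\<bar>cint f - 2 * pi * a\<bar> \<le> 2 * pi * e" by simp
  also have "cint f - 2 * pi * a = 2 * pi * (cint f / (2 * pi) - a)"
    by (simp add: field_simps)
  finally show ?thesis by (simp add: abs_mult)
qed

lemma polar_cylinder:
  assumes "C2_jet S v g H" "open S" "\<And>s \<theta>. s < T \<Longrightarrow> c + expolar s \<theta> \<in> S"
  obtains Vs Vss Vt Vtt where "cylinder_C2 T (\<lambda>s \<theta>. v (c + expolar s \<theta>)) Vs Vss Vt Vtt"
    "\<And>s \<theta>. Vss s \<theta> + Vtt s \<theta> = exp (2 * s) * trace (H (c + expolar s \<theta>))"
  using cylinder_C2_polar[OF assms] by blast

text \<open>\<open>A / 4 * exp (2 * s)\<close> is the profile of a paraboloid centred at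
  \<open>c\<close> with Laplacian \<open>A\<close>; adding it makes the circular mean convex in
  \<open>s\<close>. The sum stays bounded while the circle shrinks to \<open>c\<close>, hence it is
  nondecreasing, and its limit there is \<open>v c\<close>.\<close>

lemma circle_mean_ge:
  assumes jet: "C2_jet S v g H" and "open S" and S: "ball c b \<subseteq> S" and b: "b > 0" and A: "A \<ge> 0"
    and tr: "\<And>x. x \<in> ball c b \<Longrightarrow> trace (H x) \<ge> - A" and s: "s < ln b"
  shows "2 * pi * v c \<le> cint (\<lambda>\<theta>. v (c + expolar s \<theta>)) + pi / 2 * A * exp (2 * s)"
proof -
  define T where "T = ln b"
  have expT: "exp s < b" if "s < T" for s
    using that b unfolding T_def by (metis exp_less_mono exp_ln)
  have inb: "c + expolar s \<theta> \<in> ball c b" if "s < T" for s \<theta>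
    using expT[OF that] by (simp add: dist_norm)
  have inS: "c + expolar s \<theta> \<in> S" if "s < T" for s \<theta>
    using inb[OF that] S by auto
  obtain Vs Vss Vt Vtt where cyl: "cylinder_C2 T (\<lambda>s \<theta>. v (c + expolar s \<theta>)) Vs Vss Vt Vtt"
    "\<And>s \<theta>. Vss s \<theta> + Vtt s \<theta> = exp (2 * s) * trace (H (c + expolar s \<theta>))"
    using polar_cylinder[where T = T and c = c, OF jet \<open>open S\<close> inS] by blast
  interpret cylinder_C2 T "\<lambda>s \<theta>. v (c + expolar s \<theta>)" Vs Vss Vt Vtt
    by (rule cyl(1))
  have L: "L s \<theta> = exp (2 * s) * trace (H (c + expolar s \<theta>))" for s \<theta>
    unfolding L_def by (rule cyl(2))
  let ?N = "\<lambda>s. mu s + A / 4 * exp (2 * s)"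
  let ?N1 = "\<lambda>s. mu1 s + A / 2 * exp (2 * s)"
  let ?N2 = "\<lambda>s. mu2 s + A * exp (2 * s)"
  have d1: "(?N has_real_derivative ?N1 s) (at s)" if "s < T" for s
    using mu_deriv[OF that] by (auto intro!: derivative_eq_intros)
  have d2: "(?N1 has_real_derivative ?N2 s) (at s)" if "s < T" for s
    using mu1_deriv[OF that] by (auto intro!: derivative_eq_intros)
  have N2: "?N2 s \<ge> 0" if "s < T" for s
  proof -
    have "cint (\<lambda>_. - (A * exp (2 * s))) \<le> cint (L s)"
    proof (rule integral_le)
      show "L s integrable_on {0..2*pi}"
        by (intro integrable_continuous_interval slice[OF cL that])
      fix \<theta>
      have "exp (2 * s) * - A \<le> exp (2 * s) * trace (H (c + expolar s \<theta>))"
        using tr[OF inb[OF that]] by (intro mult_left_mono) auto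
      then show "- (A * exp (2 * s)) \<le> L s \<theta>" by (simp add: L mult.commute)
    qed auto
    then show ?thesis by (simp add: mu2_def field_simps)
  qed
  have lim: "\<exists>S1<T. \<forall>s\<le>S1. \<bar>mu s - v c\<bar> \<le> e" if e: "e > 0" for e
  proof -
    have "isCont v c"
      using C2_jet_continuous[OF jet order_refl] S b \<open>open S\<close>
      by (simp add: continuous_on_eq_continuous_at subset_iff)
    then obtain d where d: "d > 0" "\<And>x. dist x c < d \<Longrightarrow> \<bar>v x - v c\<bar> < e"
      using e unfolding continuous_at_eps_delta dist_norm real_norm_def by blast
    define S1 where "S1 = min (T - 1) (ln d - 1)"
    have "\<bar>mu s - v c\<bar> \<le> e" if "s \<le> S1" for s
    proof -
      have sT: "s < T" "s < ln d" using that by (auto simp: S1_def)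
      then have "exp s < d" using d(1) by (metis exp_less_mono exp_ln)
      then have "\<bar>v (c + expolar s \<theta>) - v c\<bar> \<le> e" for \<theta>
        using d(2)[of "c + expolar s \<theta>"] by (simp add: dist_norm)
      then show ?thesis unfolding mu_def
        by (intro cint_near slices sT)
    qed
    moreover have "S1 < T" by (simp add: S1_def)
    ultimately show ?thesis by blast
  qed
  obtain S1 where S1: "S1 < T" "\<And>s. s \<le> S1 \<Longrightarrow> \<bar>mu s - v c\<bar> \<le> 1"
    using lim[of 1] by auto
  have N1: "?N1 s \<ge> 0" if "s < T" for s
  proof (rule bounded_convex_deriv_nonneg[where N = ?N and ?N1.0 = ?N1 and ?N2.0 = ?N2 and T = T and S = S1 and C = "v c + 1 + A / 4 * exp (2 * S1)"])
    show "?N s \<le> v c + 1 + A / 4 * exp (2 * S1)" if "s \<le> S1" for s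
      using S1(2)[OF that] that A by (intro add_mono mult_left_mono) auto
  qed (fact d1 d2 N2 that)+
  have "v c \<le> ?N s"
  proof (rule field_le_epsilon)
    fix e :: real assume "e > 0"
    then obtain S2 where S2: "S2 < T" "\<And>s. s \<le> S2 \<Longrightarrow> \<bar>mu s - v c\<bar> \<le> e" using lim by blast
    let ?r = "min S2 s"
    have "?N ?r \<le> ?N s"
    proof (rule DERIV_nonneg_imp_nondecreasing[where f = ?N])
      show "\<exists>y. (?N has_real_derivative y) (at x) \<and> 0 \<le> y" if "min S2 s \<le> x" "x \<le> s" for x
        using d1[of x] N1[of x] that s unfolding T_def by auto
    qed simp
    moreover have "\<bar>mu ?r - v c\<bar> \<le> e" by (rule S2) simp
    moreover have "0 \<le> A / 4 * exp (2 * ?r)" using A by simp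
    ultimately show "v c \<le> ?N s + e" by linarith
  qed
  then have "2 * pi * v c \<le> 2 * pi * ?N s" by (intro mult_left_mono) auto
  then show ?thesis by (simp add: mu_def algebra_simps)
qed

text \<open>
  A Lipschitz kernel, so that the averages around two nearby points can be compared in
  \<open>holder_estimate\<close>.
\<close>

definition tent :: "real \<Rightarrow> real^2 \<Rightarrow> real" where
  "tent b z = max 0 (b - norm z)"

lemma tent_bounds: "0 \<le> tent b z" "b \<ge> 0 \<Longrightarrow> tent b z \<le> b"
  by (auto simp: tent_def)

lemma tent_outside: "b \<le> norm z \<Longrightarrow> tent b z = 0"
  by (simp add: tent_def)

lemma tent_lipschitz: "\<bar>tent b z - tent b w\<bar> \<le> norm (z - w)"
  using norm_triangle_ineq2[of z w] norm_triangle_ineq2[of w z]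
  by (auto simp: tent_def max_def norm_minus_commute)

lemma continuous_on_tent: "continuous_on A (\<lambda>z. tent b (z - c))"
  unfolding tent_def by (intro continuous_intros)

lemma tent_expolar: "tent b (expolar s \<theta>) = max 0 (b - exp s)"
  by (simp add: tent_def)

abbreviation tent_mass :: "real \<Rightarrow> real" where
  "tent_mass b \<equiv> (\<integral>z. tent b z \<partial>lborel)"

lemma tent_mult_integrable:
  assumes "continuous_on (cball c b) v"
  shows "integrable lborel (\<lambda>z. tent b (z - c) * v z)"
proof -
  have "integrable lborel (\<lambda>z. indicator (cball c b) z *\<^sub>R (tent b (z - c) * v z))"
    by (intro borel_integrable_compact continuous_intros assms continuous_on_tent) auto
  moreover have "(\<lambda>z. indicator (cball c b) z *\<^sub>R (tent b (z - c) * v z)) = (\<lambda>z. tent b (z - c) * v z)"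
    by (auto simp: fun_eq_iff indicator_def dist_norm norm_minus_commute intro!: tent_outside)
  ultimately show ?thesis by simp
qed

lemma tent_integrable: "integrable lborel (\<lambda>z. tent b z)"
  using tent_mult_integrable[of 0 b "\<lambda>_. 1"] by simp

text \<open>The tent is at least \<open>b / 2\<close> on the ball of radius \<open>b / 2\<close>.
  The constant is crude, but the order \<open>b^3\<close> is the true one, which is all that the
  ratios below depend on.\<close>

lemma tent_mass_ge:
  assumes "b > 0"
  shows "tent_mass b \<ge> pi * b^3 / 8"
proof -
  have "(\<integral>z. b / 2 * indicator (ball (0 :: real^2) (b/2)) z \<partial>lborel) \<le> tent_mass b"
  proof (rule integral_mono)
    show "integrable lborel (\<lambda>z. b / 2 * indicator (ball (0 :: real^2) (b/2)) z :: real)"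
      by (intro integrable_mult_right integrable_real_indicator emeasure_lborel_ball_finite) auto
    show "b / 2 * indicator (ball (0 :: real^2) (b/2)) z \<le> tent b z" for z
      using assms by (auto simp: tent_def indicator_def)
  qed (rule tent_integrable)
  moreover have "(\<integral>z. b / 2 * indicator (ball (0 :: real^2) (b/2)) z \<partial>lborel) = b / 2 * (pi * (b/2)^2)"
    using circle_area[of "b / 2" 0] assms by (subst integral_mult_right_zero) simp
  moreover have "b / 2 * (pi * (b/2)^2) = pi * b^3 / 8"
    by (simp add: power2_eq_square power3_eq_cube)
  ultimately show ?thesis by linarith
qed

lemma tent_mass_pos: "b > 0 \<Longrightarrow> tent_mass b > 0"
  using tent_mass_ge[of b] by (smt (verit) divide_pos_pos mult_pos_pos pi_gt_zero zero_less_power)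

text \<open>In polar coordinates the tent is the weight
  \<open>exp (2 * s) * max 0 (b - exp s)\<close>, so the inequality on circles can be integrated
  over \<open>s\<close>; the error \<open>A / 4 * exp (2 * s)\<close> is at most
  \<open>A * b\<^sup>2 / 4\<close> on the support.\<close>

lemma tent_mean_value:
  assumes jet: "C2_jet S v g H" and "open S" and S: "cball c b \<subseteq> S" and b: "b > 0" and A: "A \<ge> 0"
    and tr: "\<And>x. x \<in> ball c b \<Longrightarrow> trace (H x) \<ge> - A"
  shows "v c * tent_mass b \<le> (\<integral>z. tent b (z - c) * v z \<partial>lborel) + A * b\<^sup>2 / 4 * tent_mass b"
proof -
  have cv: "continuous_on (cball c b) v" by (rule C2_jet_continuous[OF jet S])
  note i = tent_mult_integrable[OF cv]
  have i': "integrable lborel (\<lambda>z. tent b z * v (c + z))"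
  proof -
    have "continuous_on (cball 0 b) (\<lambda>z. v (c + z))"
      by (rule continuous_on_compose2[OF cv]) (auto intro!: continuous_intros simp: dist_norm)
    then show ?thesis using tent_mult_integrable[of 0 b "\<lambda>z. v (c + z)"] by simp
  qed
  have shift: "(\<integral>z. tent b (z - c) * v z \<partial>lborel) = (\<integral>z. tent b z * v (c + z) \<partial>lborel)"
    by (subst lborel_distr_plus[of c, symmetric], subst integral_distr)
       (use i in \<open>auto dest: borel_measurable_integrable\<close>)
  have ti: "integrable lborel (\<lambda>z. (v c - A * b\<^sup>2 / 4) * tent b z)"
    by (intro integrable_mult_right tent_integrable)
  have "(\<integral>z. (v c - A * b\<^sup>2 / 4) * tent b z \<partial>lborel) \<le> (\<integral>z. tent b z * v (c + z) \<partial>lborel)"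
    unfolding integral_polar(1)[OF ti] integral_polar(1)[OF i']
  proof (rule integral_mono[OF integral_polar(2)[OF ti] integral_polar(2)[OF i']])
    fix s :: real
    show "exp (2 * s) * (LINT \<theta>:{0<..<2 * pi}|lborel. (v c - A * b\<^sup>2 / 4) * tent b (expolar s \<theta>))
       \<le> exp (2 * s) * (LINT \<theta>:{0<..<2 * pi}|lborel. tent b (expolar s \<theta>) * v (c + expolar s \<theta>))"
    proof (cases "s < ln b")
      case True
      then have es: "exp s < b" using b by (metis exp_less_mono exp_ln)
      have cvs: "continuous_on {0..2*pi} (\<lambda>\<theta>. v (c + expolar s \<theta>))"
        by (rule continuous_on_compose2[OF cv]) (use es in \<open>auto intro!: continuous_intros simp: dist_norm\<close>)
      have "2 * pi * v c \<le> cint (\<lambda>\<theta>. v (c + expolar s \<theta>)) + pi / 2 * A * exp (2 * s)"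
        by (rule circle_mean_ge[OF jet \<open>open S\<close> _ b A tr True]) (use S in auto)
      moreover have "pi / 2 * A * exp (2 * s) \<le> pi / 2 * A * b\<^sup>2"
      proof -
        have "exp (2 * s) = (exp s)\<^sup>2" by (simp add: power2_eq_square flip: exp_add)
        also have "\<dots> \<le> b\<^sup>2" using es by (intro power_mono) auto
        finally show ?thesis using A by (intro mult_left_mono) auto
      qed
      ultimately have "2 * pi * (v c - A * b\<^sup>2 / 4) \<le> cint (\<lambda>\<theta>. v (c + expolar s \<theta>))"
        by (simp add: algebra_simps)
      then have "(b - exp s) * ((v c - A * b\<^sup>2 / 4) * (2 * pi)) \<le> (b - exp s) * cint (\<lambda>\<theta>. v (c + expolar s \<theta>))"
        using es by (intro mult_left_mono) (auto simp: mult.commute)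
      moreover have "cint (\<lambda>\<theta>. (v c - A * b\<^sup>2 / 4) * max 0 (b - exp s)) = (b - exp s) * ((v c - A * b\<^sup>2 / 4) * (2 * pi))"
        using es by simp
      moreover have "cint (\<lambda>\<theta>. max 0 (b - exp s) * v (c + expolar s \<theta>)) = (b - exp s) * cint (\<lambda>\<theta>. v (c + expolar s \<theta>))"
        using es by simp
      moreover have "continuous_on {0..2*pi} (\<lambda>\<theta>. max 0 (b - exp s) * v (c + expolar s \<theta>))"
        by (intro continuous_intros cvs)
      ultimately show ?thesis
        unfolding tent_expolar using es
        by (subst (1 2) set_integral_eq_cint) (simp_all only: continuous_on_const exp_ge_zero mult_left_mono)
    next
      case False
      then have "b \<le> exp s" using b by (metis exp_le_cancel_iff exp_ln linorder_not_le)
      then show ?thesis by (simp add: tent_expolar)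
    qed
  qed
  also have "(\<integral>z. (v c - A * b\<^sup>2 / 4) * tent b z \<partial>lborel) = (v c - A * b\<^sup>2 / 4) * tent_mass b"
    by (rule integral_mult_right_zero)
  finally show ?thesis unfolding shift by (simp add: algebra_simps)
qed

subsection \<open>Decay of the oscillation on circles\<close>

text \<open>The factor \<open>8 / (pi * b\<^sup>2)\<close> is the height \<open>b\<close> of the
  tent divided by the lower bound \<open>pi * b^3 / 8\<close> for its mass.\<close>

lemma subharmonic_le_L1:
  assumes jet: "C2_jet S v g H" and "open S" and S: "cball c b \<subseteq> S" and b: "b > 0" and A: "A \<ge> 0"
    and tr: "\<And>x. x \<in> ball c b \<Longrightarrow> trace (H x) \<ge> - A"
  shows "v c \<le> 8 / (pi * b\<^sup>2) * (LINT z:cball c b|lborel. \<bar>v z\<bar>) + A * b\<^sup>2 / 4"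
proof -
  let ?Z = "tent_mass b" and ?I = "LINT z:cball c b|lborel. \<bar>v z\<bar>"
  have cv: "continuous_on (cball c b) v" by (rule C2_jet_continuous[OF jet S])
  have ia: "integrable lborel (\<lambda>z. indicator (cball c b) z *\<^sub>R \<bar>v z\<bar>)"
    by (intro borel_integrable_compact continuous_intros cv) auto
  have "(\<integral>z. tent b (z - c) * v z \<partial>lborel) \<le> (\<integral>z. b * (indicator (cball c b) z *\<^sub>R \<bar>v z\<bar>) \<partial>lborel)"
  proof (rule integral_mono[OF tent_mult_integrable[OF cv] integrable_mult_right[OF ia]])
    fix z
    show "tent b (z - c) * v z \<le> b * (indicator (cball c b) z *\<^sub>R \<bar>v z\<bar>)"
    proof (cases "z \<in> cball c b")
      case True
      have "tent b (z - c) * v z \<le> tent b (z - c) * \<bar>v z\<bar>"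
        by (intro mult_left_mono) (auto simp: tent_bounds)
      also have "\<dots> \<le> b * \<bar>v z\<bar>" using b by (intro mult_right_mono tent_bounds) auto
      finally show ?thesis using True by simp
    next
      case False
      then have "tent b (z - c) = 0" by (intro tent_outside) (auto simp: dist_norm norm_minus_commute)
      then show ?thesis using False by simp
    qed
  qed
  also have "\<dots> = b * ?I" by (simp add: set_lebesgue_integral_def)
  finally have "v c * ?Z \<le> b * ?I + A * b\<^sup>2 / 4 * ?Z"
    using tent_mean_value[OF jet \<open>open S\<close> S b A tr] by simp
  then have "(v c - A * b\<^sup>2 / 4) * ?Z \<le> b * ?I" by (simp add: algebra_simps)
  then have "v c - A * b\<^sup>2 / 4 \<le> b * ?I / ?Z"
    using tent_mass_pos[OF b] by (simp add: pos_le_divide_eq)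
  also have "\<dots> \<le> b * ?I / (pi * b^3 / 8)"
  proof (rule divide_left_mono)
    have "0 \<le> ?I" unfolding set_lebesgue_integral_def by (rule integral_nonneg_AE) auto
    then show "0 \<le> b * ?I" using b by simp
    show "0 < ?Z * (pi * b ^ 3 / 8)" using b tent_mass_pos[OF b] by simp
  qed (rule tent_mass_ge[OF b])
  also have "\<dots> = 8 / (pi * b\<^sup>2) * ?I"
    using b by (simp add: power2_eq_square power3_eq_cube field_simps)
  finally show ?thesis by simp
qed

section \<open>Pointwise bounds on annuli from integrals over circles\<close>

definition annulus :: "real \<Rightarrow> real \<Rightarrow> (real^2) set" where
  "annulus p q = {z. p \<le> norm z \<and> norm z \<le> q}"

lemma compact_annulus: "compact (annulus p q)"
proof -
  have "annulus p q = cball 0 q \<inter> {z. p \<le> norm z}" by (auto simp: annulus_def)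
  moreover have "closed {z::real^2. p \<le> norm z}" by (intro closed_Collect_le continuous_intros)
  ultimately show ?thesis by (simp add: compact_Int_closed)
qed

lemma expolar_in_annulus:
  assumes "p > 0" "q > 0"
  shows "expolar s \<theta> \<in> annulus p q \<longleftrightarrow> s \<in> {ln p..ln q}"
  using exp_le_cancel_iff[of "ln p" s] exp_le_cancel_iff[of s "ln q"] assms by (simp add: annulus_def)

lemma annulus_integral_le:
  assumes cv: "continuous_on (annulus p q) v" and pq: "0 < p" "p \<le> q"
    and Q: "\<And>s. s \<in> {ln p..ln q} \<Longrightarrow> cint (\<lambda>\<theta>. \<bar>v (expolar s \<theta>)\<bar>) \<le> Q"
  shows "(LINT z:annulus p q|lborel. \<bar>v z\<bar>) \<le> q\<^sup>2 * Q * ln (q / p)"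
proof -
  have q: "q > 0" using pq by simp
  let ?h = "\<lambda>z. indicator (annulus p q) z *\<^sub>R \<bar>v z\<bar>"
  have ih: "integrable lborel ?h"
    by (intro borel_integrable_compact compact_annulus continuous_intros cv)
  have cvs: "continuous_on {0..2*pi} (\<lambda>\<theta>. \<bar>v (expolar s \<theta>)\<bar>)" if "s \<in> {ln p..ln q}" for s
    by (intro continuous_intros continuous_on_compose2[OF cv])
       (use that pq q expolar_in_annulus[of p q] in auto)
  have Q0: "Q \<ge> 0"
  proof -
    have "0 \<le> cint (\<lambda>\<theta>. \<bar>v (expolar (ln p) \<theta>)\<bar>)"
      using pq q by (intro integral_nonneg integrable_continuous_interval cvs) auto
    also have "\<dots> \<le> Q" using pq q by (intro Q) auto
    finally show ?thesis .
  qed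
  have "(LINT z:annulus p q|lborel. \<bar>v z\<bar>) = (\<integral>s. exp (2 * s) * (LINT \<theta>:{0<..<2*pi}|lborel. ?h (expolar s \<theta>)) \<partial>lborel)"
    unfolding set_lebesgue_integral_def[of lborel "annulus p q"] by (rule integral_polar(1)[OF ih])
  also have "\<dots> \<le> (\<integral>s. q\<^sup>2 * Q * indicator {ln p..ln q} s \<partial>lborel)"
  proof (rule integral_mono[OF integral_polar(2)[OF ih]])
    fix s
    show "exp (2 * s) * (LINT \<theta>:{0<..<2*pi}|lborel. ?h (expolar s \<theta>)) \<le> q\<^sup>2 * Q * indicator {ln p..ln q} s"
    proof (cases "s \<in> {ln p..ln q}")
      case True
      then have "expolar s \<theta> \<in> annulus p q" for \<theta> using expolar_in_annulus pq q by blast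
      then have "(LINT \<theta>:{0<..<2*pi}|lborel. ?h (expolar s \<theta>)) = cint (\<lambda>\<theta>. \<bar>v (expolar s \<theta>)\<bar>)"
        using set_integral_eq_cint[OF cvs[OF True]] by simp
      also have "\<dots> \<le> Q" by (rule Q[OF True])
      finally have "exp (2 * s) * (LINT \<theta>:{0<..<2*pi}|lborel. ?h (expolar s \<theta>)) \<le> exp (2 * s) * Q"
        by (intro mult_left_mono) auto
      also have "exp (2 * s) \<le> q\<^sup>2"
      proof -
        have "exp s \<le> q" using True q by (metis atLeastAtMost_iff exp_le_cancel_iff exp_ln)
        then have "(exp s)\<^sup>2 \<le> q\<^sup>2" by (intro power_mono) auto
        then show ?thesis by (simp add: power2_eq_square flip: exp_add)
      qed
      finally show ?thesis using True Q0 by (simp add: mult_right_mono)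
    next
      case False
      then have "expolar s \<theta> \<notin> annulus p q" for \<theta> using expolar_in_annulus pq q by blast
      then show ?thesis using False by simp
    qed
  qed (intro integrable_mult_right integrable_real_indicator; simp add: emeasure_lborel_Icc_eq)
  also have "\<dots> = q\<^sup>2 * Q * ln (q / p)"
  proof -
    have "ln p \<le> ln q" using pq q by simp
    then show ?thesis using pq q by (simp add: ln_div)
  qed
  finally show ?thesis .
qed

text \<open>The ball of radius \<open>norm x / 2\<close> around \<open>x\<close> lies in the
  annulus, so the sub-mean value inequality applies at the scale of \<open>x\<close> itself. The
  trace is multiplied by \<open>(norm x)\<^sup>2\<close> to make the estimate scale invariant. The
  factor 48 comes from \<open>144 / pi\<close> and \<open>pi > 3\<close>.\<close>

lemma pointwise_bound:
  assumes jet: "C2_jet S v g H" and "open S" and x: "x \<noteq> 0" and S: "annulus (norm x / 2) (3 * norm x / 2) \<subseteq> S"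
    and A: "A \<ge> 0" and tr: "\<And>z. z \<in> annulus (norm x / 2) (3 * norm x / 2) \<Longrightarrow> trace (H z) * (norm x)\<^sup>2 \<ge> - A"
    and Q: "\<And>s. s \<in> {ln (norm x / 2)..ln (3 * norm x / 2)} \<Longrightarrow> cint (\<lambda>\<theta>. \<bar>v (expolar s \<theta>)\<bar>) \<le> Q"
  shows "v x \<le> 48 * Q + A"
proof -
  define r where "r = norm x"
  have r: "r > 0" using x by (simp add: r_def)
  have cb: "cball x (r / 2) \<subseteq> annulus (r / 2) (3 * r / 2)"
  proof
    fix z assume "z \<in> cball x (r / 2)"
    then have "norm (z - x) \<le> r / 2" by (simp add: dist_norm norm_minus_commute)
    then show "z \<in> annulus (r / 2) (3 * r / 2)"
      using norm_triangle_ineq2[of x z] norm_triangle_ineq2[of z x]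
      by (auto simp: annulus_def r_def norm_minus_commute)
  qed
  have cv: "continuous_on (annulus (r / 2) (3 * r / 2)) v"
    by (rule C2_jet_continuous[OF jet]) (use S in \<open>simp add: r_def\<close>)
  have ia: "integrable lborel (\<lambda>z. indicator (annulus (r / 2) (3 * r / 2)) z *\<^sub>R \<bar>v z\<bar>)"
    by (intro borel_integrable_compact compact_annulus continuous_intros cv)
  have ic: "integrable lborel (\<lambda>z. indicator (cball x (r / 2)) z *\<^sub>R \<bar>v z\<bar>)"
    by (intro borel_integrable_compact continuous_intros continuous_on_subset[OF cv cb]) auto
  have "(LINT z:cball x (r / 2)|lborel. \<bar>v z\<bar>) \<le> (LINT z:annulus (r / 2) (3 * r / 2)|lborel. \<bar>v z\<bar>)"
    unfolding set_lebesgue_integral_def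
    by (rule integral_mono[OF ic ia]) (use cb in \<open>auto simp: indicator_def\<close>)
  also have "\<dots> \<le> (3 * r / 2)\<^sup>2 * Q * ln ((3 * r / 2) / (r / 2))"
    by (rule annulus_integral_le[OF cv]) (use r Q in \<open>auto simp: r_def\<close>)
  also have "(3 * r / 2) / (r / 2) = 3" using r by simp
  finally have I: "(LINT z:cball x (r / 2)|lborel. \<bar>v z\<bar>) \<le> (9 / 4) * r\<^sup>2 * Q * ln 3"
    by (simp add: power2_eq_square)
  have Q0: "Q \<ge> 0"
  proof -
    have "continuous_on {0..2*pi} (\<lambda>\<theta>. \<bar>v (expolar (ln r) \<theta>)\<bar>)"
      by (intro continuous_intros continuous_on_compose2[OF cv])
         (use r in \<open>auto simp: annulus_def\<close>)
    then have "0 \<le> cint (\<lambda>\<theta>. \<bar>v (expolar (ln r) \<theta>)\<bar>)"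
      by (intro integral_nonneg integrable_continuous_interval) auto
    also have "\<dots> \<le> Q" using r by (intro Q) (auto simp: r_def)
    finally show ?thesis .
  qed
  have "ln (3::real) \<le> 2" using ln_le_minus_one[of "3::real"] by simp
  then have "(9 / 4) * r\<^sup>2 * Q * ln 3 \<le> (9 / 4) * r\<^sup>2 * Q * 2" using Q0 by (intro mult_left_mono) auto
  moreover have "(9 / 4) * r\<^sup>2 * Q * 2 = (9 / 2) * r\<^sup>2 * Q" by simp
  ultimately have I2: "(LINT z:cball x (r / 2)|lborel. \<bar>v z\<bar>) \<le> (9 / 2) * r\<^sup>2 * Q" using I by linarith
  have "v x \<le> 8 / (pi * (r / 2)\<^sup>2) * (LINT z:cball x (r / 2)|lborel. \<bar>v z\<bar>) + (A / r\<^sup>2) * (r / 2)\<^sup>2 / 4"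
  proof (rule subharmonic_le_L1[OF jet \<open>open S\<close>])
    show "cball x (r / 2) \<subseteq> S" using cb S by (auto simp: r_def)
    show "trace (H z) \<ge> - (A / r\<^sup>2)" if "z \<in> ball x (r / 2)" for z
    proof -
      have "z \<in> annulus (r / 2) (3 * r / 2)" using that cb by (meson ball_subset_cball subsetD)
      then have "- A \<le> trace (H z) * r\<^sup>2" using tr[of z] by (simp add: r_def)
      then have "(- A) / r\<^sup>2 \<le> trace (H z)" using r by (subst pos_divide_le_eq) simp_all
      then show ?thesis by simp
    qed
  qed (use r A in auto)
  also have "\<dots> \<le> 8 / (pi * (r / 2)\<^sup>2) * ((9 / 2) * r\<^sup>2 * Q) + A"
    using I2 r A by (intro add_mono mult_left_mono) (auto simp: power_divide)
  also have "8 / (pi * (r / 2)\<^sup>2) * ((9 / 2) * r\<^sup>2 * Q) = 144 / pi * Q"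
    using r by (simp add: power_divide)
  also have "144 / pi * Q \<le> 48 * Q"
    using Q0 pi_gt3 by (intro mult_right_mono) (auto simp: field_simps)
  finally show ?thesis by simp
qed

lemma taylor_second_order:
  fixes f f1 f2 :: "real \<Rightarrow> real"
  assumes d1: "\<And>z. z \<in> closed_segment t s \<Longrightarrow> (f has_real_derivative f1 z) (at z)"
    and d2: "\<And>z. z \<in> closed_segment t s \<Longrightarrow> (f1 has_real_derivative f2 z) (at z)"
    and K: "\<And>z. z \<in> closed_segment t s \<Longrightarrow> \<bar>f2 z\<bar> \<le> K"
  shows "\<bar>f s - f t - f1 t * (s - t)\<bar> \<le> K * \<bar>s - t\<bar>\<^sup>2"
proof -
  have K0: "K \<ge> 0" using K[of t] by (meson abs_ge_zero ends_in_segment(1) order_trans)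
  have f1: "\<bar>f1 z - f1 t\<bar> \<le> K * \<bar>s - t\<bar>" if z: "z \<in> closed_segment t s" for z
  proof -
    have "norm (f1 z - f1 t) \<le> K * norm (z - t)"
      by (rule field_differentiable_bound[of "closed_segment t s" f1 f2])
         (use d2 K z in \<open>auto intro: DERIV_subset\<close>)
    also have "\<dots> \<le> K * \<bar>s - t\<bar>"
      using z K0 by (intro mult_left_mono) (auto simp: closed_segment_eq_real_ivl split: if_splits)
    finally show ?thesis by simp
  qed
  have "norm ((f s - f1 t * s) - (f t - f1 t * t)) \<le> K * \<bar>s - t\<bar> * norm (s - t)"
  proof (rule field_differentiable_bound[of "closed_segment t s" "\<lambda>z. f z - f1 t * z" "\<lambda>z. f1 z - f1 t"])
    show "((\<lambda>z. f z - f1 t * z) has_real_derivative f1 z - f1 t) (at z within closed_segment t s)"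
      if "z \<in> closed_segment t s" for z
      using has_field_derivative_at_within[OF d1[OF that]] by (auto intro!: derivative_eq_intros)
  qed (use f1 in auto)
  then show ?thesis by (simp add: algebra_simps power2_eq_square)
qed

definition circ_avg :: "(real^2 \<Rightarrow> real) \<Rightarrow> real \<Rightarrow> real" where
  "circ_avg v s = cint (\<lambda>\<theta>. v (expolar s \<theta>)) / (2 * pi)"

lemma oscillation_decay:
  assumes jet: "C2_jet (ball 0 R - {0}) v g H" and R: "R > 0"
    and \<gamma>: "0 \<le> \<gamma>" "\<gamma> \<le> 1 / 16" and B: "B \<ge> 0"
    and tr: "\<And>x. x \<in> ball 0 R - {0} \<Longrightarrow> (norm x)\<^sup>2 * \<bar>trace (H x)\<bar> \<le> B * exp (\<gamma> * ln (norm x))"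
    and growth: "\<And>x. x \<in> ball 0 R - {0} \<Longrightarrow> \<bar>v x\<bar> \<le> C * exp (- ln (norm x) / 32)"
  shows "\<exists>D. \<forall>x\<in>ball 0 (R / 2) - {0}. \<bar>v x - circ_avg v (ln (norm x))\<bar> \<le> D * exp (\<gamma> * ln (norm x))"
proof -
  let ?S = "ball (0 :: real^2) R - {0}"
  have opS: "open ?S" by auto
  define T where "T = ln R"
  have expT: "exp s < R" if "s < T" for s
    using that R unfolding T_def by (metis exp_less_mono exp_ln)
  have inS: "0 + expolar s \<theta> \<in> ?S" if "s < T" for s \<theta>
    using expT[OF that] by simp
  obtain Vs Vss Vt Vtt where cyl: "cylinder_C2 T (\<lambda>s \<theta>. v (0 + expolar s \<theta>)) Vs Vss Vt Vtt"
    "\<And>s \<theta>. Vss s \<theta> + Vtt s \<theta> = exp (2 * s) * trace (H (0 + expolar s \<theta>))"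
    using polar_cylinder[where T = T and c = 0, OF jet opS inS] by blast
  interpret cylinder_C2 T "\<lambda>s \<theta>. v (expolar s \<theta>)" Vs Vss Vt Vtt
    using cyl(1) by simp
  have avg: "circ_avg v s = mu s" for s by (simp add: circ_avg_def mu_def)
  have LB: "\<bar>L s \<theta>\<bar> \<le> B * exp (\<gamma> * s)" if "s < T" for s \<theta>
  proof -
    have "L s \<theta> = (norm (expolar s \<theta>))\<^sup>2 * trace (H (expolar s \<theta>))"
      using cyl(2)[of s \<theta>] by (simp add: L_def exp_double)
    then show ?thesis using tr[of "expolar s \<theta>"] inS[OF that] by (simp add: abs_mult)
  qed
  have VC: "\<bar>v (expolar s \<theta>)\<bar> \<le> C * exp (- s / 32)" if "s < T" for s \<theta>
    using growth[of "expolar s \<theta>"] inS[OF that] by simp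
  have C: "C \<ge> 0"
    using order_trans[OF abs_ge_zero VC[of "T - 1" 0]] by (simp add: zero_le_mult_iff)
  \<comment> \<open>A point with \<open>norm x < R / 2\<close> sees circles of radius at most
    \<open>3 * norm x / 2\<close>, hence below \<open>3 * R / 4\<close>; and strictly below
    \<open>T\<close> the derivatives exist on a closed half-line, as
    \<open>exponential_decay\<close> requires.\<close>
  define T' where "T' = ln (3 * R / 4)"
  have T': "T' < T" using R by (simp add: T'_def T_def)
  have "\<exists>D. \<forall>s\<le>T'. En s \<le> D * exp ((2 * \<gamma>) * s)"
  proof (rule exponential_decay[where l = "1 / (2 * pi)" and b = "1 / 16" and ?E1.0 = En1 and ?E2.0 = En2
        and B = "32 * pi^3 * B\<^sup>2" and C = "8 * pi * C\<^sup>2"])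
    have "1 / 8 < 1 / (2 * pi)" using pi_less_4 by (simp add: field_simps)
    moreover have "2 * \<gamma> \<le> 1 / 8" using \<gamma> by simp
    ultimately show "2 * \<gamma> < 1 / (2 * pi)" "1 / 16 < 1 / (2 * pi)" by linarith+
    fix s assume "s \<le> T'"
    then have s: "s < T" using T' by simp
    show "(En has_real_derivative En1 s) (at s)" "(En1 has_real_derivative En2 s) (at s)"
      using En_deriv[OF s] En1_deriv[OF s] .
    have "(exp (\<gamma> * s))\<^sup>2 = exp (2 * \<gamma> * s)"
      by (simp add: mult.assoc flip: exp_double)
    then show "(1 / (2 * pi))\<^sup>2 * En s - 32 * pi^3 * B\<^sup>2 * exp (2 * \<gamma> * s) \<le> En2 s"
      using En2_lower[OF s LB[OF s]] by (simp add: power_mult_distrib mult.assoc)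
    have "\<bar>mu s - 0\<bar> \<le> C * exp (- s / 32)"
      unfolding mu_def by (rule cint_near) (use slices[OF s] VC[OF s] in auto)
    then have "\<bar>v (expolar s \<theta>) - mu s\<bar> \<le> 2 * (C * exp (- s / 32))" for \<theta>
      using VC[OF s, of \<theta>] by linarith
    then have sq: "(v (expolar s \<theta>) - mu s)\<^sup>2 \<le> (2 * (C * exp (- s / 32)))\<^sup>2" for \<theta>
      using power_mono[OF _ abs_ge_zero, of _ _ 2] by (metis power2_abs)
    have "En s \<le> cint (\<lambda>_. (2 * (C * exp (- s / 32)))\<^sup>2)"
      unfolding En_def
      by (rule integral_le) (use sq slices[OF s] in \<open>auto intro!: integrable_continuous_interval continuous_intros\<close>)
    also have "\<dots> = 8 * pi * C\<^sup>2 * (exp (- s / 32))\<^sup>2"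
      by (simp add: power_mult_distrib)
    also have "(exp (- s / 32))\<^sup>2 = exp (- (1 / 16) * s)"
      by (simp flip: exp_double)
    finally show "En s \<le> 8 * pi * C\<^sup>2 * exp (- (1 / 16) * s)" .
  qed (use \<gamma> in auto)
  then obtain D where D: "\<And>s. s \<le> T' \<Longrightarrow> En s \<le> D * exp (2 * \<gamma> * s)" by auto
  define D1 where "D1 = sqrt (2 * pi * \<bar>D\<bar>)"
  have D1: "cint (\<lambda>\<theta>. \<bar>v (expolar s \<theta>) - mu s\<bar>) \<le> D1 * exp (\<gamma> * s)" if "s \<le> T'" for s
  proof -
    have s: "s < T" using that T' by simp
    have "(cint (\<lambda>\<theta>. \<bar>v (expolar s \<theta>) - mu s\<bar>))\<^sup>2 \<le> 2 * pi * cint (\<lambda>\<theta>. \<bar>v (expolar s \<theta>) - mu s\<bar>\<^sup>2)"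
      by (rule integral_square_ge) (use slices[OF s] in \<open>auto intro!: continuous_intros\<close>)
    also have "\<dots> = 2 * pi * En s" by (simp add: En_def)
    also have "\<dots> \<le> 2 * pi * (\<bar>D\<bar> * exp (2 * \<gamma> * s))"
      by (intro mult_left_mono order_trans[OF D[OF that]] mult_right_mono) auto
    also have "\<dots> = (D1 * exp (\<gamma> * s))\<^sup>2"
      by (simp add: D1_def power_mult_distrib mult.assoc flip: exp_double)
    finally show ?thesis
      by (rule power2_le_imp_le) (simp add: D1_def)
  qed
  have D10: "D1 \<ge> 0" by (simp add: D1_def)
  \<comment> \<open>\<open>2 * D1\<close> accounts for the oscillation on neighbouring circles,
    \<open>4 * pi * B\<close> for the Taylor error of the average integrated over the circle. Both
    contain the factor 2 from
    \<open>exp (\<gamma> * s) \<le> 2 * exp (\<gamma> * t)\<close>.\<close>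
  define Q where "Q = 2 * D1 + 4 * pi * B"
  have bound: "\<bar>v x - mu (ln (norm x))\<bar> \<le> (48 * Q + 8 * B) * exp (\<gamma> * ln (norm x))"
    if x: "x \<in> ball 0 (R / 2) - {0}" for x
  proof -
    define r t where "r = norm x" and "t = ln r"
    have r: "0 < r" "r < R / 2" "exp t = r" using x by (auto simp: r_def t_def)
    have lnr: "ln (r / 2) = t - ln 2" "ln (3 * r / 2) = t + ln (3 / 2)"
      using r by (simp_all add: t_def ln_div ln_mult)
    have ln2: "0 < ln (2::real)" "ln (2::real) \<le> 1" "0 < ln (3/2 :: real)" "ln (3/2::real) \<le> 1"
      using ln_le_minus_one[of "2::real"] ln_le_minus_one[of "3/2::real"] by auto
    have rng: "s \<le> T' \<and> \<bar>s - t\<bar> \<le> 1 \<and> exp (\<gamma> * s) \<le> 2 * exp (\<gamma> * t)" if "s \<in> {ln (r / 2)..ln (3 * r / 2)}" for s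
    proof (intro conjI)
      have "ln (3 * r / 2) \<le> T'" unfolding T'_def using r R by simp
      then show "s \<le> T'" using that by simp
      show st: "\<bar>s - t\<bar> \<le> 1" using that ln2 unfolding lnr by auto
      have "s \<le> t + ln 2"
      proof -
        have "ln (3/2 :: real) \<le> ln 2" by simp
        then show ?thesis using that unfolding lnr atLeastAtMost_iff by linarith
      qed
      then have "\<gamma> * s \<le> \<gamma> * t + ln 2"
      proof -
        assume "s \<le> t + ln 2"
        then have "\<gamma> * s \<le> \<gamma> * t + \<gamma> * ln 2" using \<gamma> by (simp add: mult_left_mono flip: distrib_left)
        also have "\<gamma> * ln 2 \<le> 1 * ln 2" using \<gamma> ln2 by (intro mult_right_mono) auto
        finally show ?thesis by simp
      qed
      then have "exp (\<gamma> * s) \<le> exp (\<gamma> * t + ln 2)" by simp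
      then show "exp (\<gamma> * s) \<le> 2 * exp (\<gamma> * t)" by (simp add: exp_add)
    qed
    have ann: "annulus (norm x / 2) (3 * norm x / 2) \<subseteq> ?S"
      using r by (auto simp: annulus_def r_def)
    let ?H0 = "\<lambda>x::real^2. \<chi> i j. (if i = j then 1 / (x \<bullet> x) else 0) - 2 * x $ i * x $ j / (x \<bullet> x)\<^sup>2"
    have jl: "C2_jet ?S (\<lambda>x. ln (norm x)) (\<lambda>x. (1 / (x \<bullet> x)) *\<^sub>R x) ?H0"
      by (rule C2_jet_subset[OF C2_jet_ln_norm(1)]) auto
    have jw: "C2_jet ?S (\<lambda>y. a * v y + (- a * mu1 t) * ln (norm y) + b)
        (\<lambda>y. (a *\<^sub>R g y + (- a * mu1 t) *\<^sub>R ((1 / (y \<bullet> y)) *\<^sub>R y)))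
        (\<lambda>y. a *\<^sub>R H y + (- a * mu1 t) *\<^sub>R ?H0 y)" for a b
      using C2_jet_lincomb[OF C2_jet_lincomb[OF jet jl, of a "- a * mu1 t"] C2_jet_const[of ?S b], of 1 1] by simp
    \<comment> \<open>Subtracting a multiple of the harmonic function \<open>ln |y|\<close> cancels the first-order part of the
      average, so that only its second derivative enters the error.\<close>
    have side: "a * v x + (- a * mu1 t) * ln (norm x) + (- a * mu t + a * mu1 t * t) \<le> 48 * (Q * exp (\<gamma> * t)) + 8 * B * exp (\<gamma> * t)"
      if a: "\<bar>a\<bar> = 1" for a
    proof (rule pointwise_bound[OF jw opS _ ann])
      show "x \<noteq> 0" using x by simp
      show "0 \<le> 8 * B * exp (\<gamma> * t)" using B by simp
      fix z assume z: "z \<in> annulus (norm x / 2) (3 * norm x / 2)"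
      then have zS: "z \<in> ?S" and z0: "z \<noteq> 0" using ann by auto
      have zr: "r / 2 \<le> norm z" "norm z \<le> 3 * r / 2" using z by (auto simp: annulus_def r_def)
      have tre: "trace (a *\<^sub>R H z + (- a * mu1 t) *\<^sub>R ?H0 z) = a * trace (H z)"
        by (simp only: trace_lincomb C2_jet_ln_norm(2)[OF z0] mult_zero_right add_0_right)
      \<comment> \<open>The 8 is 4 times 2: \<open>r \<le> 2 * norm z\<close> enters squared, and
        comparing the exponentials at \<open>z\<close> and at \<open>x\<close> costs another
        2.\<close>
      have "\<bar>trace (H z)\<bar> * r\<^sup>2 \<le> 8 * B * exp (\<gamma> * t)"
      proof -
        have "r\<^sup>2 \<le> (2 * norm z)\<^sup>2" using zr r by (intro power_mono) auto
        then have "\<bar>trace (H z)\<bar> * r\<^sup>2 \<le> \<bar>trace (H z)\<bar> * (2 * norm z)\<^sup>2" by (intro mult_left_mono) auto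
        also have "\<dots> = 4 * ((norm z)\<^sup>2 * \<bar>trace (H z)\<bar>)" by (simp add: power_mult_distrib)
        also have "\<dots> \<le> 4 * (B * exp (\<gamma> * ln (norm z)))" using tr[OF zS] by simp
        also have "\<dots> \<le> 4 * (B * (2 * exp (\<gamma> * t)))"
        proof -
          have "ln (norm z) \<in> {ln (r / 2)..ln (3 * r / 2)}"
            using zr r z0 by auto
          then show ?thesis using rng B by (intro mult_left_mono) auto
        qed
        finally show ?thesis by simp
      qed
      moreover have "\<bar>a * trace (H z)\<bar> * r\<^sup>2 = \<bar>trace (H z)\<bar> * r\<^sup>2" using a by (simp add: abs_mult)
      moreover have "- (\<bar>a * trace (H z)\<bar> * r\<^sup>2) \<le> a * trace (H z) * r\<^sup>2"
        unfolding minus_mult_left by (intro mult_right_mono) auto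
      ultimately show "- (8 * B * exp (\<gamma> * t)) \<le> trace (a *\<^sub>R H z + (- a * mu1 t) *\<^sub>R ?H0 z) * (norm x)\<^sup>2"
        unfolding r_def[symmetric] tre by linarith
    next
      fix s assume s: "s \<in> {ln (norm x / 2)..ln (3 * norm x / 2)}"
      then have sr: "s \<in> {ln (r / 2)..ln (3 * r / 2)}" by (simp add: r_def)
      note rs = rng[OF sr]
      have sT: "s < T" using rs T' by simp
      have seg: "z < T \<and> \<bar>mu2 z\<bar> \<le> B * (2 * exp (\<gamma> * t))" if "z \<in> closed_segment t s" for z
      proof -
        have "z \<in> {ln (r / 2)..ln (3 * r / 2)}"
        proof -
          have "t - ln 2 \<le> s" "s \<le> t + ln (3/2)" using sr unfolding lnr by auto
          moreover have "t \<le> z \<and> z \<le> s \<or> s \<le> z \<and> z \<le> t"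
            using that by (auto simp: closed_segment_eq_real_ivl split: if_splits)
          ultimately show ?thesis unfolding lnr atLeastAtMost_iff using ln2 by linarith
        qed
        then have zz: "z < T" "exp (\<gamma> * z) \<le> 2 * exp (\<gamma> * t)" using rng[of z] T' by auto
        have "\<bar>mu2 z\<bar> \<le> B * exp (\<gamma> * z)" by (rule mu2_bound[OF zz(1) LB[OF zz(1)]])
        also have "\<dots> \<le> B * (2 * exp (\<gamma> * t))" using zz B by (intro mult_left_mono) auto
        finally show ?thesis using zz by simp
      qed
      have "\<bar>mu s - mu t - mu1 t * (s - t)\<bar> \<le> B * (2 * exp (\<gamma> * t)) * \<bar>s - t\<bar>\<^sup>2"
        by (rule taylor_second_order[OF mu_deriv mu1_deriv]) (use seg in auto)
      also have "\<dots> \<le> B * (2 * exp (\<gamma> * t)) * 1"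
        using rs B by (intro mult_left_mono) (auto simp: abs_square_le_1)
      finally have tay: "\<bar>mu s - mu t - mu1 t * (s - t)\<bar> \<le> B * (2 * exp (\<gamma> * t))" by simp
      have "cint (\<lambda>\<theta>. \<bar>a * v (expolar s \<theta>) + (- a * mu1 t) * ln (norm (expolar s \<theta>)) + (- a * mu t + a * mu1 t * t)\<bar>)
          \<le> cint (\<lambda>\<theta>. \<bar>v (expolar s \<theta>) - mu s\<bar> + B * (2 * exp (\<gamma> * t)))"
      proof (rule integral_le)
        fix \<theta>
        have "a * v (expolar s \<theta>) + (- a * mu1 t) * ln (norm (expolar s \<theta>)) + (- a * mu t + a * mu1 t * t)
          = a * ((v (expolar s \<theta>) - mu s) + (mu s - mu t - mu1 t * (s - t)))"
          by (simp add: algebra_simps)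
        then have "\<bar>a * v (expolar s \<theta>) + (- a * mu1 t) * ln (norm (expolar s \<theta>)) + (- a * mu t + a * mu1 t * t)\<bar>
          = \<bar>(v (expolar s \<theta>) - mu s) + (mu s - mu t - mu1 t * (s - t))\<bar>"
          using a by (simp only: abs_mult) simp
        then show "\<bar>a * v (expolar s \<theta>) + (- a * mu1 t) * ln (norm (expolar s \<theta>)) + (- a * mu t + a * mu1 t * t)\<bar>
          \<le> \<bar>v (expolar s \<theta>) - mu s\<bar> + B * (2 * exp (\<gamma> * t))"
          using tay by linarith
      qed (use slices[OF sT] in \<open>auto intro!: integrable_continuous_interval continuous_intros\<close>)
      also have "\<dots> = cint (\<lambda>\<theta>. \<bar>v (expolar s \<theta>) - mu s\<bar>) + 2 * pi * (B * (2 * exp (\<gamma> * t)))"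
        using slices[OF sT] by (subst integral_add) (auto intro!: integrable_continuous_interval continuous_intros)
      also have "cint (\<lambda>\<theta>. \<bar>v (expolar s \<theta>) - mu s\<bar>) \<le> D1 * (2 * exp (\<gamma> * t))"
        by (rule order_trans[OF D1 mult_left_mono]) (use rs D10 in auto)
      finally show "cint (\<lambda>\<theta>. \<bar>a * v (expolar s \<theta>) + (- a * mu1 t) * ln (norm (expolar s \<theta>)) + (- a * mu t + a * mu1 t * t)\<bar>)
          \<le> Q * exp (\<gamma> * t)"
        by (simp add: Q_def algebra_simps)
    qed
    have "v x - mu t \<le> (48 * Q + 8 * B) * exp (\<gamma> * t)"
      using side[of 1] by (simp add: t_def r_def algebra_simps)
    moreover have "- (v x - mu t) \<le> (48 * Q + 8 * B) * exp (\<gamma> * t)"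
      using side[of "-1"] by (simp add: t_def r_def algebra_simps)
    ultimately show ?thesis unfolding t_def r_def by linarith
  qed
  show ?thesis unfolding avg using bound by blast
qed

subsection \<open>Average, small energy regularity and Hoelder estimate\<close>

text \<open>Concavity makes \<open>m1\<close> nonincreasing and \<open>C1\<close> bounds its total
  variation, so the supremum \<open>\<alpha>\<close> of \<open>m1\<close> is finite and is its limit
  at minus infinity.\<close>

lemma concave_average:
  fixes m m1 m2 :: "real \<Rightarrow> real"
  assumes d1: "\<And>s. s < 0 \<Longrightarrow> (m has_real_derivative m1 s) (at s)"
    and d2: "\<And>s. s < 0 \<Longrightarrow> (m1 has_real_derivative m2 s) (at s)"
    and m2: "\<And>s. s < 0 \<Longrightarrow> m2 s \<le> 0"
    and C1: "\<And>t0 t1. t0 \<le> t1 \<Longrightarrow> t1 < 0 \<Longrightarrow> m1 t0 - m1 t1 \<le> C1"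
    and C2: "\<And>t0 t1. t0 \<le> t1 \<Longrightarrow> t1 < 0 \<Longrightarrow> integral {t0..t1} (\<lambda>s. exp (2 * s + m s)) \<le> C2"
  shows "\<exists>\<alpha>>-2. (\<forall>s<0. m1 s \<le> \<alpha>) \<and> (\<forall>s<0. \<alpha> - C1 \<le> m1 s) \<and> (\<forall>e>0. \<exists>s0<0. \<forall>s\<le>s0. \<alpha> - e \<le> m1 s)"
proof -
  have mono: "m1 t \<le> m1 s" if "s \<le> t" "t < 0" for s t
    by (rule DERIV_nonpos_imp_nonincreasing[OF that(1)]) (use d2 m2 that in \<open>auto intro: le_less_trans\<close>)
  have C10: "C1 \<ge> 0" using C1[of "-1" "-1"] by simp
  have diff: "m1 t - m1 s \<le> C1" if "s < 0" "t < 0" for s t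
    using C1[of t s] mono[of s t] C10 that by (cases "t \<le> s") auto
  define \<alpha> where "\<alpha> = (SUP s\<in>{..<0}. m1 s)"
  have bdd: "bdd_above (m1 ` {..<0})"
    using diff[of "-1"] by (intro bdd_aboveI2[of _ _ "m1 (-1) + C1"]) (auto simp: algebra_simps)
  have up: "m1 s \<le> \<alpha>" if "s < 0" for s
    unfolding \<alpha>_def using that by (intro cSUP_upper bdd) auto
  have low: "\<alpha> - C1 \<le> m1 s" if "s < 0" for s
  proof -
    have "\<alpha> \<le> m1 s + C1"
      unfolding \<alpha>_def using diff[OF that] by (intro cSUP_least) (auto simp: algebra_simps)
    then show ?thesis by simp
  qed
  have lim: "\<exists>s0<0. \<forall>s\<le>s0. \<alpha> - e \<le> m1 s" if "e > 0" for e
  proof -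
    have "\<exists>s0\<in>{..<0}. \<alpha> - e < m1 s0"
      using that bdd less_cSUP_iff[of "{..<0}" m1 "\<alpha> - e"] by (auto simp: \<alpha>_def)
    then show ?thesis using mono by (meson lessThan_iff less_imp_le order_trans)
  qed
  have "\<alpha> > -2"
  proof (rule ccontr)
    assume "\<not> \<alpha> > -2"
    then have a: "\<alpha> \<le> -2" by simp
    have lower: "m (-1) - 2 * (s + 1) \<le> m s" if "s \<le> -1" for s
    proof -
      have "m (-1) + 2 * (-1) \<le> m s + 2 * s"
      proof (rule DERIV_nonpos_imp_nonincreasing[OF that, where f = "\<lambda>s. m s + 2 * s"])
        fix x :: real assume "s \<le> x" "x \<le> -1"
        then have x: "x < 0" by simp
        have "((\<lambda>s. m s + 2 * s) has_real_derivative m1 x + 2) (at x)"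
          using d1[OF x] by (auto intro!: derivative_eq_intros)
        moreover have "m1 x + 2 \<le> 0" using up[OF x] a by simp
        ultimately show "\<exists>y. ((\<lambda>s. m s + 2 * s) has_real_derivative y) (at x) \<and> y \<le> 0" by blast
      qed
      then show ?thesis by simp
    qed
    \<comment> \<open>If \<open>\<alpha> \<le> -2\<close>, then \<open>c\<close> bounds the
      integrand from below on all of \<open>s \<le> -1\<close>; \<open>t0\<close> makes the interval
      long enough for the integral to reach \<open>\<bar>C2\<bar> + 1\<close>.\<close>
    define c where "c = exp (m (-1) - 2)"
    define t0 where "t0 = - 1 - (\<bar>C2\<bar> + 1) / c"
    have c: "c > 0" by (simp add: c_def)
    have t0: "t0 \<le> -1" using c by (simp add: t0_def)
    have cm: "continuous_on {t0..-1} m"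
      by (rule DERIV_continuous_on[where D = m1], rule has_field_derivative_at_within, rule d1) auto
    have "integral {t0..-1} (\<lambda>s. c) \<le> integral {t0..-1} (\<lambda>s. exp (2 * s + m s))"
    proof (rule integral_le)
      show "(\<lambda>s. exp (2 * s + m s)) integrable_on {t0..-1}"
        by (intro integrable_continuous_interval continuous_intros cm)
      show "c \<le> exp (2 * s + m s)" if "s \<in> {t0..-1}" for s
        using lower[of s] that by (simp add: c_def)
    qed auto
    also have "\<dots> \<le> C2" by (rule C2) (use t0 in auto)
    finally have "c * (- 1 - t0) \<le> C2" using t0 by (simp add: mult.commute)
    moreover have "c * (- 1 - t0) = \<bar>C2\<bar> + 1" using c by (simp add: t0_def)
    ultimately show False by simp
  qed
  with up low lim show ?thesis by blast
qed

text \<open>Two integrations from minus infinity. The first puts \<open>m1\<close> within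
  \<open>K / \<gamma> * exp (\<gamma> * s)\<close> below \<open>\<alpha>\<close>. Then
  \<open>p = m - \<alpha> * s\<close> is nonincreasing while \<open>p + X\<close> is nondecreasing,
  so the limit of \<open>p\<close>, available as its supremum, lies between \<open>p\<close> and
  \<open>p + X\<close>.\<close>

lemma average_asymptotics:
  fixes m m1 m2 :: "real \<Rightarrow> real"
  assumes d1: "\<And>s. s \<le> S \<Longrightarrow> (m has_real_derivative m1 s) (at s)"
    and d2: "\<And>s. s \<le> S \<Longrightarrow> (m1 has_real_derivative m2 s) (at s)"
    and m2: "\<And>s. s \<le> S \<Longrightarrow> \<bar>m2 s\<bar> \<le> K * exp (\<gamma> * s)" and \<gamma>: "\<gamma> > 0"
    and up: "\<And>s. s \<le> S \<Longrightarrow> m1 s \<le> \<alpha>" and lim: "\<And>e. e > 0 \<Longrightarrow> \<exists>s0. \<forall>s\<le>s0. \<alpha> - e \<le> m1 s"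
  shows "\<exists>c. \<forall>s\<le>S. \<bar>m s - \<alpha> * s - c\<bar> \<le> K / \<gamma>\<^sup>2 * exp (\<gamma> * s)"
proof -
  have low: "\<alpha> - K / \<gamma> * exp (\<gamma> * s) \<le> m1 s" if s: "s \<le> S" for s
  proof -
    have "\<alpha> \<le> m1 s + K / \<gamma> * exp (\<gamma> * s)"
    proof (rule field_le_epsilon)
      fix e :: real assume "e > 0"
      then obtain s0 where s0: "\<And>s. s \<le> s0 \<Longrightarrow> \<alpha> - e \<le> m1 s" using lim by blast
      let ?t = "min s s0"
      have "m1 ?t + K / \<gamma> * exp (\<gamma> * ?t) \<le> m1 s + K / \<gamma> * exp (\<gamma> * s)"
      proof (rule DERIV_nonneg_imp_nondecreasing[where f = "\<lambda>s. m1 s + K / \<gamma> * exp (\<gamma> * s)"])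
        fix x assume "?t \<le> x" "x \<le> s"
        then have x: "x \<le> S" using s by simp
        have "((\<lambda>s. m1 s + K / \<gamma> * exp (\<gamma> * s)) has_real_derivative m2 x + K * exp (\<gamma> * x)) (at x)"
          using d2[OF x] \<gamma> by (auto intro!: derivative_eq_intros)
        moreover have "0 \<le> m2 x + K * exp (\<gamma> * x)" using m2[OF x] by (simp add: abs_le_iff)
        ultimately show "\<exists>y. ((\<lambda>s. m1 s + K / \<gamma> * exp (\<gamma> * s)) has_real_derivative y) (at x) \<and> 0 \<le> y" by blast
      qed simp
      moreover have "\<alpha> - e \<le> m1 ?t" by (rule s0) simp
      moreover have "0 \<le> K / \<gamma> * exp (\<gamma> * ?t)"
      proof -
        have "?t \<le> S" using s by (rule min.coboundedI1)
        then have "0 \<le> K * exp (\<gamma> * ?t)" using m2[of ?t] by (meson abs_ge_zero order_trans)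
        then show ?thesis using \<gamma> by simp
      qed
      ultimately show "\<alpha> \<le> m1 s + K / \<gamma> * exp (\<gamma> * s) + e" by linarith
    qed
    then show ?thesis by simp
  qed
  define p where "p = (\<lambda>s. m s - \<alpha> * s)"
  define X where "X = (\<lambda>s. K / \<gamma>\<^sup>2 * exp (\<gamma> * s))"
  have dp: "(p has_real_derivative m1 s - \<alpha>) (at s)" if "s \<le> S" for s
    unfolding p_def using d1[OF that] by (auto intro!: derivative_eq_intros)
  have dX: "(X has_real_derivative K / \<gamma> * exp (\<gamma> * s)) (at s)" for s
    unfolding X_def using \<gamma> by (auto intro!: derivative_eq_intros simp: power2_eq_square)
  have pmono: "p t \<le> p s" if "s \<le> t" "t \<le> S" for s t
    by (rule DERIV_nonpos_imp_nonincreasing[OF that(1)])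
       (use dp up that in \<open>meson diff_le_0_iff_le order_trans\<close>)
  have pX: "p s + X s \<le> p t + X t" if "s \<le> t" "t \<le> S" for s t
  proof (rule DERIV_nonneg_imp_nondecreasing[OF that(1), where f = "\<lambda>s. p s + X s"])
    fix x assume "s \<le> x" "x \<le> t"
    then have x: "x \<le> S" using that by simp
    have "((\<lambda>s. p s + X s) has_real_derivative (m1 x - \<alpha>) + K / \<gamma> * exp (\<gamma> * x)) (at x)"
      by (intro DERIV_add dp dX x)
    moreover have "0 \<le> (m1 x - \<alpha>) + K / \<gamma> * exp (\<gamma> * x)" using low[OF x] by simp
    ultimately show "\<exists>y. ((\<lambda>s. p s + X s) has_real_derivative y) (at x) \<and> 0 \<le> y" by blast
  qed
  have X0: "X s \<ge> 0" if "s \<le> S" for s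
  proof -
    have "0 \<le> K * exp (\<gamma> * s)" using m2[OF that] by (meson abs_ge_zero order_trans)
    then show ?thesis by (simp add: X_def zero_le_mult_iff)
  qed
  have pXle: "p t \<le> p s + X s" if "s \<le> S" "t \<le> S" for s t
  proof (cases "t \<le> s")
    case True
    then show ?thesis using pX[of t s] X0[OF that(2)] that by simp
  next
    case False
    then show ?thesis using pmono[of s t] X0[OF that(1)] that by simp
  qed
  define c where "c = (SUP s\<in>{..S}. p s)"
  have bdd: "bdd_above (p ` {..S})"
    by (rule bdd_aboveI2[of _ _ "p S + X S"]) (auto intro: pXle)
  have "\<bar>p s - c\<bar> \<le> X s" if s: "s \<le> S" for s
  proof -
    have "p s \<le> c" unfolding c_def by (rule cSUP_upper[OF _ bdd]) (use s in auto)
    moreover have "c \<le> p s + X s" unfolding c_def by (rule cSUP_least) (auto intro: pXle s)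
    ultimately show ?thesis by simp
  qed
  then show ?thesis unfolding p_def X_def by blast
qed

section \<open>Small energy regularity near the puncture\<close>

lemma small_ball_integral:
  fixes h :: "real^2 \<Rightarrow> real"
  assumes h: "integrable lborel h" and e: "e > 0"
  shows "\<exists>R>0. R \<le> 1 \<and> (\<integral>z. indicator (ball 0 R - {0}) z * h z \<partial>lborel) < e"
proof -
  have [measurable]: "h \<in> borel_measurable borel" using h by auto
  let ?s = "\<lambda>n z. indicator (ball 0 (1 / real (Suc n)) - {0}) z * h z"
  have "(\<lambda>n. \<integral>z. ?s n z \<partial>lborel) \<longlonglongrightarrow> (\<integral>z. 0 \<partial>(lborel :: (real^2) measure))"
  proof (rule integral_dominated_convergence[where s = ?s and f = "\<lambda>z. 0" and w = "\<lambda>z. \<bar>h z\<bar>"])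
    show "AE z in lborel. (\<lambda>n. ?s n z) \<longlonglongrightarrow> 0"
    proof (rule AE_I2)
      fix z :: "real^2"
      show "(\<lambda>n. ?s n z) \<longlonglongrightarrow> 0"
      proof (cases "z = 0")
        case False
        then obtain N where N: "1 / real (Suc N) < norm z"
          using reals_Archimedean[of "norm z"] by (auto simp: inverse_eq_divide)
        have "?s n z = 0" if "n \<ge> N" for n
        proof -
          have "1 / real (Suc n) \<le> 1 / real (Suc N)" using that by (simp add: frac_le)
          then show ?thesis using N by (simp add: indicator_def)
        qed
        then show ?thesis by (intro tendsto_eventually) (auto simp: eventually_sequentially)
      qed simp
    qed
  qed (use h in \<open>auto simp: indicator_def\<close>)
  then have "eventually (\<lambda>n. (\<integral>z. ?s n z \<partial>lborel) < e) sequentially"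
    using e by (simp add: order_tendstoD(2))
  then obtain n where "(\<integral>z. ?s n z \<partial>lborel) < e" by (auto simp: eventually_sequentially)
  then show ?thesis by (intro exI[of _ "1 / real (Suc n)"]) auto
qed

lemma tent_mass_shift: "(\<integral>z. tent b (z - c) \<partial>lborel) = tent_mass b"
proof -
  have [measurable]: "(\<lambda>z. tent b (z - c)) \<in> borel_measurable borel"
    by (intro borel_measurable_continuous_onI continuous_on_tent)
  show ?thesis
    by (subst lborel_distr_plus[of c, symmetric], subst integral_distr) auto
qed

text \<open>
  Schoen's point-picking: maximise \<open>(r - dist y x)\<^sup>2 * exp (u y)\<close>. If the maximum were large, then
  on a ball of radius \<open>\<delta> = exp (- u y0 / 2)\<close> around the maximiser \<open>y0\<close> the scale-invariant problem
  would be uniformly bounded, and the mean value inequality would put a fixed amount of energy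
  into that ball.
\<close>

lemma eps_regularity:
  assumes jet: "C2_jet (ball 0 1 - {0}) u g H" and M: "M \<ge> 0"
    and tr: "\<And>x. x \<in> ball 0 1 - {0} \<Longrightarrow> trace (H x) \<ge> - (M * exp (u x))"
    and int: "integrable lborel (\<lambda>z. indicator (ball 0 1 - {0}) z * exp (u z))"
  shows "\<exists>R>0. R \<le> 1 \<and> (\<forall>x\<in>ball 0 R - {0}. exp (u x) * (norm x)\<^sup>2 \<le> 16)"
proof -
  let ?S = "ball (0 :: real^2) 1 - {0}"
  define h where "h = (\<lambda>z. indicator ?S z * exp (u z))"
  \<comment> \<open>This is the energy forced into the ball around the maximiser:
    \<open>exp (u y0 - M) * (pi * \<delta>^3 / 8) = \<delta> * e\<close>, by the normalisation
    \<open>\<delta>\<^sup>2 * exp (u y0) = 1\<close>.\<close>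
  define e where "e = exp (- M) * pi / 8"
  have "e > 0" by (simp add: e_def)
  then obtain R where R: "R > 0" "R \<le> 1" "(\<integral>z. indicator (ball 0 R - {0}) z * h z \<partial>lborel) < e"
    using small_ball_integral[OF int[folded h_def]] by blast
  have "exp (u x) * (norm x)\<^sup>2 \<le> 16" if x: "x \<in> ball 0 (R / 2) - {0}" for x
  proof (rule ccontr)
    assume big: "\<not> exp (u x) * (norm x)\<^sup>2 \<le> 16"
    define r where "r = norm x / 2"
    have r: "r > 0" "norm x = 2 * r" "4 * r < R" using x by (auto simp: r_def)
    have inR: "z \<in> ball 0 R - {0}" if "dist z x \<le> r" for z
    proof -
      have "norm z \<le> norm x + dist z x" "norm x \<le> norm z + dist z x"
        using norm_triangle_ineq2[of z x] norm_triangle_ineq2[of x z]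
        by (auto simp: dist_norm norm_minus_commute)
      then show ?thesis using that r by auto
    qed
    have RS: "ball 0 R - {0} \<subseteq> ?S" using R by auto
    have cu: "continuous_on (cball x r) u"
    proof (rule C2_jet_continuous[OF jet])
      have "cball x r \<subseteq> ball 0 R - {0}" using inR unfolding subset_iff mem_cball by (simp add: dist_commute)
      then show "cball x r \<subseteq> ?S" using RS by (rule subset_trans)
    qed
    let ?Q = "\<lambda>y. (r - dist y x)\<^sup>2 * exp (u y)"
    have "\<exists>y0\<in>cball x r. \<forall>y\<in>cball x r. ?Q y \<le> ?Q y0"
      by (rule continuous_attains_sup) (use r cu in \<open>auto intro!: continuous_intros\<close>)
    then obtain y0 where "y0 \<in> cball x r" "\<forall>y\<in>cball x r. ?Q y \<le> ?Q y0" by blast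
    then have y0: "dist y0 x \<le> r" "\<And>y. dist y x \<le> r \<Longrightarrow> ?Q y \<le> ?Q y0"
      unfolding mem_cball Ball_def by (simp_all add: dist_commute)
    define d where "d = r - dist y0 x"
    define \<delta> where "\<delta> = exp (- u y0 / 2)"
    have \<delta>: "\<delta> > 0" by (simp add: \<delta>_def)
    have \<delta>2: "\<delta>\<^sup>2 * exp (u y0) = 1"
      unfolding \<delta>_def by (simp flip: exp_double exp_add)
    \<comment> \<open>The bound 16 enters here: as \<open>r\<close> is half of
      \<open>norm x\<close>, its failure says \<open>?Q x > 4\<close>. Maximality carries this over
      to \<open>y0\<close> and yields \<open>2 * \<delta> < d\<close>, so points within
      \<open>\<delta>\<close> of \<open>y0\<close> keep at least half of the distance
      \<open>d\<close> to the boundary of the disc.\<close>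
    have "4 < ?Q x" using big r by (simp add: power_mult_distrib mult.commute)
    also have "?Q x \<le> d\<^sup>2 * exp (u y0)" using y0(2)[of x] r by (simp add: d_def)
    finally have "4 * \<delta>\<^sup>2 < d\<^sup>2 * exp (u y0) * \<delta>\<^sup>2" using \<delta> by simp
    also have "\<dots> = d\<^sup>2" using \<delta>2 by (simp add: mult_ac)
    finally have "(2 * \<delta>)\<^sup>2 < d\<^sup>2" by (simp add: power_mult_distrib)
    then have d: "2 * \<delta> < d" by (rule power2_less_imp_less) (use y0 in \<open>simp add: d_def\<close>)
    have near: "dist z x \<le> r \<and> d / 2 \<le> r - dist z x" if "dist y0 z \<le> \<delta>" for z
      using dist_triangle[of z x y0] that d \<delta> by (simp add: d_def dist_commute)
    have eu: "exp (u z) \<le> 4 * exp (u y0)" if z: "dist y0 z \<le> \<delta>" for z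
    proof -
      have "(d / 2)\<^sup>2 * exp (u z) \<le> ?Q z"
        using near[OF z] d \<delta> by (intro mult_right_mono power_mono) auto
      also have "\<dots> \<le> d\<^sup>2 * exp (u y0)" using y0(2)[of z] near[OF z] by (simp add: d_def)
      finally have "d\<^sup>2 * exp (u z) \<le> d\<^sup>2 * (4 * exp (u y0))" by (simp add: power_divide)
      then show ?thesis using d \<delta> by simp
    qed
    have cb: "cball y0 \<delta> \<subseteq> ?S" using near inR RS by (auto simp: subset_iff)
    have A: "4 * M / \<delta>\<^sup>2 * \<delta>\<^sup>2 / 4 = M" using \<delta> by simp
    \<comment> \<open>On this ball \<open>exp u\<close> is at most
      \<open>4 / \<delta>\<^sup>2\<close>, so the mean value error at radius \<open>\<delta>\<close>
      is just \<open>M\<close>, however small \<open>\<delta>\<close> may be.\<close>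
    have mv: "u y0 * tent_mass \<delta> \<le> (\<integral>z. tent \<delta> (z - y0) * u z \<partial>lborel) + 4 * M / \<delta>\<^sup>2 * \<delta>\<^sup>2 / 4 * tent_mass \<delta>"
    proof (rule tent_mean_value[OF jet _ cb \<delta>])
      show "- (4 * M / \<delta>\<^sup>2) \<le> trace (H z)" if "z \<in> ball y0 \<delta>" for z
      proof -
        have z: "dist y0 z \<le> \<delta>" using that by simp
        have "M * exp (u z) \<le> M * (4 * exp (u y0))" using eu[OF z] M by (intro mult_left_mono) auto
        also have "exp (u y0) = 1 / \<delta>\<^sup>2" using \<delta>2 \<delta> by (simp add: field_simps)
        finally have "M * exp (u z) \<le> 4 * M / \<delta>\<^sup>2" by (simp add: mult.commute)
        moreover have "z \<in> ?S" using cb z by (meson mem_cball subsetD)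
        ultimately show ?thesis using tr[of z] by linarith
      qed
    qed (use M \<delta> in auto)
    \<comment> \<open>Jensen's inequality for the tent: \<open>a\<close> is a lower bound for the
      weighted mean of \<open>u\<close>, and \<open>exp\<close> lies above its tangent line at
      \<open>a\<close>.\<close>
    define a where "a = u y0 - M"
    let ?Z = "tent_mass \<delta>"
    have cuy: "continuous_on (cball y0 \<delta>) u" by (rule C2_jet_continuous[OF jet cb])
    have ti: "integrable lborel (\<lambda>z. tent \<delta> (z - y0))"
      using tent_mult_integrable[of y0 \<delta> "\<lambda>_. 1"] by simp
    have il: "integrable lborel (\<lambda>z. exp a * (1 - a) * tent \<delta> (z - y0) + exp a * (tent \<delta> (z - y0) * u z))"
      by (intro Bochner_Integration.integrable_add integrable_mult_right ti tent_mult_integrable cuy)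
    have ie: "integrable lborel (\<lambda>z. tent \<delta> (z - y0) * exp (u z))"
      by (intro tent_mult_integrable continuous_intros cuy)
    have iR: "integrable lborel (\<lambda>z. indicator (ball 0 R - {0}) z * h z)"
      using integrable_real_mult_indicator[OF _ int[folded h_def], of "ball 0 R - {0}"] by (simp add: mult.commute)
    have "exp a * ?Z = exp a * (1 - a) * ?Z + exp a * (a * ?Z)" by (simp add: algebra_simps)
    also have "\<dots> \<le> exp a * (1 - a) * ?Z + exp a * (\<integral>z. tent \<delta> (z - y0) * u z \<partial>lborel)"
      using mv unfolding A by (intro add_left_mono mult_left_mono) (auto simp: a_def algebra_simps)
    also have "\<dots> = (\<integral>z. exp a * (1 - a) * tent \<delta> (z - y0) + exp a * (tent \<delta> (z - y0) * u z) \<partial>lborel)"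
      by (subst Bochner_Integration.integral_add)
         (auto intro!: integrable_mult_right ti tent_mult_integrable cuy simp: tent_mass_shift)
    also have "\<dots> \<le> (\<integral>z. tent \<delta> (z - y0) * exp (u z) \<partial>lborel)"
    proof (rule integral_mono[OF il ie])
      fix z
      have "exp a * (1 + (u z - a)) \<le> exp a * exp (u z - a)"
        by (intro mult_left_mono exp_ge_add_one_self) auto
      also have "\<dots> = exp (u z)" by (simp flip: exp_add)
      finally have "tent \<delta> (z - y0) * (exp a * (1 + (u z - a))) \<le> tent \<delta> (z - y0) * exp (u z)"
        by (intro mult_left_mono tent_bounds)
      then show "exp a * (1 - a) * tent \<delta> (z - y0) + exp a * (tent \<delta> (z - y0) * u z) \<le> tent \<delta> (z - y0) * exp (u z)"
        by (simp add: algebra_simps)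
    qed
    also have "\<dots> \<le> (\<integral>z. \<delta> * (indicator (ball 0 R - {0}) z * h z) \<partial>lborel)"
    proof (rule integral_mono[OF ie integrable_mult_right[OF iR]])
      fix z
      show "tent \<delta> (z - y0) * exp (u z) \<le> \<delta> * (indicator (ball 0 R - {0}) z * h z)"
      proof (cases "dist y0 z \<le> \<delta>")
        case True
        then have "z \<in> ball 0 R - {0}" using near inR by blast
        moreover have "tent \<delta> (z - y0) * exp (u z) \<le> \<delta> * exp (u z)"
          using \<delta> by (intro mult_right_mono tent_bounds) auto
        ultimately show ?thesis using RS by (auto simp: h_def)
      next
        case False
        then have "tent \<delta> (z - y0) = 0" by (intro tent_outside) (simp add: dist_norm norm_minus_commute)
        then show ?thesis using \<delta> by (simp add: h_def)
      qed
    qed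
    also have "\<dots> = \<delta> * (\<integral>z. indicator (ball 0 R - {0}) z * h z \<partial>lborel)" by simp
    also have "\<dots> < \<delta> * e" using R \<delta> by simp
    finally have "exp a * ?Z < \<delta> * e" .
    moreover have "exp a * (pi * \<delta>^3 / 8) \<le> exp a * ?Z"
      by (intro mult_left_mono tent_mass_ge \<delta>) auto
    moreover have "exp a * (pi * \<delta>^3 / 8) = (\<delta>\<^sup>2 * exp (u y0)) * (\<delta> * e)"
      by (simp add: a_def e_def exp_diff exp_minus power2_eq_square power3_eq_cube field_simps)
    ultimately show False unfolding \<delta>2 by linarith
  qed
  then show ?thesis using R by (intro exI[of _ "R / 2"]) auto
qed

text \<open>For points that are far apart relative to \<open>L = norm x\<close>, the decay of
  \<open>v\<close> is enough. For close points \<open>v x\<close> and \<open>v y\<close> are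
  compared through tent averages of radius \<open>b\<close>. All errors have the size
  \<open>L powr \<gamma> * w\<^sup>2\<close> with \<open>w^3 = d / L\<close>, and
  \<open>w\<^sup>2 \<le> w powr (3 * \<gamma>)\<close> because \<open>3 * \<gamma> \<le> 2\<close>,
  so the powers of \<open>L\<close> cancel and \<open>d powr \<gamma>\<close> remains.\<close>

lemma holder_estimate:
  assumes jet: "C2_jet (ball 0 R - {0}) v g H"
    and \<gamma>: "0 < \<gamma>" "\<gamma> \<le> 1 / 16" and C: "C \<ge> 0"
    and v: "\<And>x. x \<in> ball 0 R - {0} \<Longrightarrow> \<bar>v x\<bar> \<le> C * norm x powr \<gamma>"
    and tr: "\<And>x. x \<in> ball 0 R - {0} \<Longrightarrow> (norm x)\<^sup>2 * \<bar>trace (H x)\<bar> \<le> C * norm x powr \<gamma>"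
    and x: "x \<in> ball 0 (R / 2) - {0}" and y: "y \<in> ball 0 (R / 2) - {0}" and yx: "norm y \<le> norm x"
  shows "\<bar>v x - v y\<bar> \<le> 128 * C * dist x y powr \<gamma>"
proof (cases "x = y")
  case False
  let ?S = "ball (0 :: real^2) R - {0}"
  define L d where "L = norm x" and "d = dist x y"
  have L: "L > 0" "2 * L < R" using x by (auto simp: L_def)
  have d: "d > 0" using False by (simp add: d_def)
  have "norm x < R / 2" "norm y < R / 2" using x y by auto
  then have "norm x < R" "norm y < R" using norm_ge_zero[of x] norm_ge_zero[of y] by linarith+
  then have xy: "x \<in> ?S" "y \<in> ?S" using x y by auto
  have vL: "\<bar>v x\<bar> \<le> C * L powr \<gamma>" "\<bar>v y\<bar> \<le> C * L powr \<gamma>"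
  proof -
    show "\<bar>v x\<bar> \<le> C * L powr \<gamma>" using v[OF xy(1)] by (simp add: L_def)
    have "norm y powr \<gamma> \<le> L powr \<gamma>" unfolding L_def using yx \<gamma> by (intro powr_mono2) auto
    then show "\<bar>v y\<bar> \<le> C * L powr \<gamma>" using v[OF xy(2)] C by (meson mult_left_mono order_trans)
  qed
  have pow_le: "t powr \<gamma> \<le> t" if "t \<ge> 1" for t :: real
    using powr_mono[of \<gamma> 1 t] \<gamma> that by simp
  show ?thesis
  \<comment> \<open>The cutoff is \<open>4^3\<close>: above it the cube root \<open>w\<close> is
    less than \<open>1 / 4\<close>, whence \<open>4 * b < L\<close> and the balls used stay away
    from the origin. Below it the two bounds on \<open>v\<close> add up to
    \<open>2 * C * 64\<close>, the source of the final constant 128.\<close>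
  proof (cases "L \<le> 64 * d")
    case True
    have "L powr \<gamma> \<le> (64 * d) powr \<gamma>" using True L \<gamma> by (intro powr_mono2) auto
    also have "\<dots> = 64 powr \<gamma> * d powr \<gamma>" using d by (simp add: powr_mult)
    also have "\<dots> \<le> 64 * d powr \<gamma>" by (intro mult_right_mono pow_le) auto
    finally have "C * L powr \<gamma> \<le> C * (64 * d powr \<gamma>)" using C by (intro mult_left_mono)
    then show ?thesis using vL unfolding d_def[symmetric] by linarith
  next
    case False
    define w where "w = root 3 (d / L)"
    have w: "w > 0" "w^3 = d / L" using d L by (auto simp: w_def)
    have "d / L < 1 / 64" using False L by (simp add: field_simps)
    then have "w^3 < (1/4)^3" unfolding w(2) by (simp add: power3_eq_cube)
    then have w4: "w < 1 / 4" using power_less_imp_less_base by fastforce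
    have dw: "d = L * w^3" using w L by simp
    \<comment> \<open>The radius \<open>b\<close> balances the mean value error, of relative size \<open>(b / L)\<^sup>2\<close>, against the cost
      \<open>d / b\<close> of moving the kernel.\<close>
    define b where "b = L * w"
    have b: "b > 0" "4 * b < L" using L w w4 by (auto simp: b_def)
    have "w * w\<^sup>2 \<le> w * 1"
      using w w4 by (intro mult_left_mono) (auto simp: power2_eq_square intro!: mult_le_one)
    then have db: "d \<le> b" using L by (simp add: dw b_def power3_eq_cube power2_eq_square)
    have near: "L / 2 \<le> norm z \<and> norm z \<le> 3 * L / 2 \<and> z \<in> ?S" if "dist x z \<le> 2 * b" for z
    proof -
      have "norm z \<le> norm x + dist x z" "norm x \<le> norm z + dist x z"
        using norm_triangle_ineq2[of z x] norm_triangle_ineq2[of x z]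
        by (auto simp: dist_norm norm_minus_commute)
      then show ?thesis using that b L unfolding L_def[symmetric] by auto
    qed
    have LL: "norm z powr \<gamma> \<le> 2 * L powr \<gamma>" if "dist x z \<le> 2 * b" for z
    proof -
      have "norm z powr \<gamma> \<le> (2 * L) powr \<gamma>"
        using near[OF that] L \<gamma> by (intro powr_mono2) auto
      also have "\<dots> = 2 powr \<gamma> * L powr \<gamma>" using L by (simp add: powr_mult)
      also have "\<dots> \<le> 2 * L powr \<gamma>" by (intro mult_right_mono pow_le) auto
      finally show ?thesis .
    qed
    define V where "V = 2 * C * L powr \<gamma>"
    have vV: "\<bar>v z\<bar> \<le> V" if "dist x z \<le> 2 * b" for z
    proof -
      have "C * norm z powr \<gamma> \<le> C * (2 * L powr \<gamma>)" using LL[OF that] C by (rule mult_left_mono)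
      then show ?thesis using v[of z] near[OF that] by (simp add: V_def)
    qed
    have V0: "V \<ge> 0" using C by (simp add: V_def)
    define A where "A = 4 * V / L\<^sup>2"
    have A0: "A \<ge> 0" using V0 by (simp add: A_def)
    have trA: "\<bar>trace (H z)\<bar> \<le> A" if "dist x z \<le> 2 * b" for z
    proof -
      have "(L / 2)\<^sup>2 * \<bar>trace (H z)\<bar> \<le> (norm z)\<^sup>2 * \<bar>trace (H z)\<bar>"
        using near[OF that] L by (intro mult_right_mono power_mono) auto
      also have "\<dots> \<le> C * norm z powr \<gamma>" using tr near[OF that] by blast
      also have "\<dots> \<le> C * (2 * L powr \<gamma>)" using LL[OF that] C by (rule mult_left_mono)
      finally have "(L / 2)\<^sup>2 * \<bar>trace (H z)\<bar> \<le> V" by (simp add: V_def)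
      then show ?thesis using L by (simp add: A_def power_divide field_simps)
    qed
    let ?Z = "tent_mass b"
    let ?T = "\<lambda>p. \<integral>z. tent b (z - p) * v z \<partial>lborel"
    have subb: "dist x z \<le> 2 * b" if "p = x \<or> p = y" "dist p z \<le> b" for p z
      using that db b dist_triangle[of x z y] by (auto simp: d_def)
    have cv: "continuous_on (cball p b) v" if "p = x \<or> p = y" for p
      by (rule C2_jet_continuous[OF jet]) (use subb[OF that] near in \<open>unfold subset_iff mem_cball, blast\<close>)
    have mv: "\<bar>v p * ?Z - ?T p\<bar> \<le> A * b\<^sup>2 / 4 * ?Z" if p: "p = x \<or> p = y" for p
    proof -
      have sub: "cball p b \<subseteq> ?S" using subb[OF p] near unfolding subset_iff mem_cball by blast
      have t: "- A \<le> trace (H z)" "- A \<le> trace (- H z)" if "z \<in> ball p b" for z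
        using trA[of z] subb[OF p, of z] that by (auto simp: trace_minus abs_le_iff)
      have "v p * ?Z \<le> ?T p + A * b\<^sup>2 / 4 * ?Z"
        by (rule tent_mean_value[OF jet _ sub b(1) A0 t(1)]) auto
      moreover have "- v p * ?Z \<le> (\<integral>z. tent b (z - p) * - v z \<partial>lborel) + A * b\<^sup>2 / 4 * ?Z"
        by (rule tent_mean_value[OF C2_jet_uminus[OF jet] _ sub b(1) A0 t(2)]) auto
      moreover have "(\<integral>z. tent b (z - p) * - v z \<partial>lborel) = - ?T p" by simp
      ultimately show ?thesis unfolding minus_mult_left[symmetric] by linarith
    qed
    \<comment> \<open>The two kernels differ by at most \<open>d\<close> and both live in
      \<open>cball x (2 * b)\<close>, so moving the centre costs \<open>d * V\<close> times the area
      of that ball.\<close>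
    have "?T x - ?T y = (\<integral>z. tent b (z - x) * v z - tent b (z - y) * v z \<partial>lborel)"
      by (rule Bochner_Integration.integral_diff[symmetric]; rule tent_mult_integrable[OF cv]; simp)
    also have "\<bar>\<dots>\<bar> \<le> (\<integral>z. d * V * indicator (cball x (2 * b)) z \<partial>lborel)"
    proof (rule Bochner_Integration.integral_norm_bound_integral[of lborel "\<lambda>z. tent b (z - x) * v z - tent b (z - y) * v z", unfolded real_norm_def])
      show "integrable lborel (\<lambda>z. tent b (z - x) * v z - tent b (z - y) * v z)"
        by (rule Bochner_Integration.integrable_diff; rule tent_mult_integrable[OF cv]; simp)
      show "integrable lborel (\<lambda>z. d * V * indicator (cball x (2 * b)) z)"
        by (intro integrable_mult_right integrable_real_indicator emeasure_lborel_cball_finite) auto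
      fix z
      show "\<bar>tent b (z - x) * v z - tent b (z - y) * v z\<bar> \<le> d * V * indicator (cball x (2 * b)) z"
      proof (cases "dist x z \<le> 2 * b")
        case True
        have "\<bar>tent b (z - x) - tent b (z - y)\<bar> \<le> d"
          using tent_lipschitz[of b "z - x" "z - y"] by (simp add: d_def dist_norm norm_minus_commute)
        then have "\<bar>tent b (z - x) - tent b (z - y)\<bar> * \<bar>v z\<bar> \<le> d * V"
          using vV[OF True] d by (intro mult_mono) auto
        then show ?thesis using True by (simp add: abs_mult flip: left_diff_distrib)
      next
        case False
        then have "\<not> dist x z \<le> b" "\<not> dist y z \<le> b" using subb by blast+
        then have "tent b (z - x) = 0" "tent b (z - y) = 0"
          by (auto intro!: tent_outside simp: dist_norm norm_minus_commute)
        then show ?thesis using d V0 by simp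
      qed
    qed
    also have "\<dots> = d * V * (pi * (2 * b)\<^sup>2)"
    proof -
      have "measure lborel (cball x (2 * b)) = pi * (2 * b)\<^sup>2"
        using content_cball[of "2 * b" x] b by (simp add: unit_ball_vol_2)
      then show ?thesis by simp
    qed
    finally have T: "\<bar>?T x - ?T y\<bar> \<le> d * V * (pi * (2 * b)\<^sup>2)" .
    have "\<bar>v x - v y\<bar> * ?Z = \<bar>v x * ?Z - v y * ?Z\<bar>"
      using tent_mass_pos[OF b(1)] by (simp add: abs_mult flip: left_diff_distrib)
    also have "\<dots> \<le> A * b\<^sup>2 / 2 * ?Z + d * V * (pi * (2 * b)\<^sup>2)"
    proof -
      have "A * b\<^sup>2 / 2 * ?Z = A * b\<^sup>2 / 4 * ?Z + A * b\<^sup>2 / 4 * ?Z" by simp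
      moreover have "\<bar>v x * ?Z - ?T x\<bar> \<le> A * b\<^sup>2 / 4 * ?Z" "\<bar>v y * ?Z - ?T y\<bar> \<le> A * b\<^sup>2 / 4 * ?Z"
        by (rule mv; simp)+
      ultimately show ?thesis using T by linarith
    qed
    also have "d * V * (pi * (2 * b)\<^sup>2) = 32 * d * V / b * (pi * b^3 / 8)"
      using b by (simp add: power2_eq_square power3_eq_cube)
    also have "\<dots> \<le> 32 * d * V / b * ?Z"
      using d V0 b by (intro mult_left_mono tent_mass_ge) auto
    finally have "\<bar>v x - v y\<bar> * ?Z \<le> (A * b\<^sup>2 / 2 + 32 * d * V / b) * ?Z"
      by (simp add: algebra_simps)
    then have "\<bar>v x - v y\<bar> \<le> A * b\<^sup>2 / 2 + 32 * d * V / b"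
      using tent_mass_pos[OF b(1)] by simp
    also have "A * b\<^sup>2 / 2 = 4 * C * L powr \<gamma> * w\<^sup>2"
      using L by (simp add: A_def V_def b_def power_mult_distrib)
    also have "32 * d * V / b = 64 * C * L powr \<gamma> * w\<^sup>2"
      using L w(1) by (simp add: dw V_def b_def power2_eq_square power3_eq_cube)
    also have "4 * C * L powr \<gamma> * w\<^sup>2 + 64 * C * L powr \<gamma> * w\<^sup>2 = 68 * C * (L powr \<gamma> * w\<^sup>2)"
      by simp
    also have "L powr \<gamma> * w\<^sup>2 \<le> d powr \<gamma>"
    proof -
      have "w\<^sup>2 = w powr 2" using w by simp
      also have "\<dots> \<le> w powr (3 * \<gamma>)" using w w4 \<gamma> by (intro powr_mono') auto
      also have "\<dots> = (w powr 3) powr \<gamma>" by (simp add: powr_powr)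
      also have "w powr 3 = w^3" using w by simp
      finally have "L powr \<gamma> * w\<^sup>2 \<le> L powr \<gamma> * (w^3) powr \<gamma>" by (intro mult_left_mono) auto
      also have "\<dots> = d powr \<gamma>" unfolding dw using L w(1) by (simp add: powr_mult)
      finally show ?thesis .
    qed
    finally have "\<bar>v x - v y\<bar> \<le> 68 * C * d powr \<gamma>" using C by (simp add: mult_left_mono)
    also have "\<dots> \<le> 128 * C * d powr \<gamma>" using C by (intro mult_right_mono) auto
    finally show ?thesis by (simp add: d_def)
  qed
qed simp

subsection \<open>The singular expansion\<close>

text \<open>The set where the bound fails is open, and a nonempty open set is not negligible. This
  turns the essential bounds on \<open>K\<close> into pointwise ones.\<close>

lemma AE_continuous_le_imp_le:
  fixes k :: "'a::euclidean_space \<Rightarrow> real"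
  assumes "open S" "continuous_on S k" and ae: "AE x in lebesgue. x \<in> S \<longrightarrow> k x \<le> c"
  shows "\<forall>x\<in>S. k x \<le> c"
proof (rule ccontr)
  assume "\<not> (\<forall>x\<in>S. k x \<le> c)"
  then have ne: "S \<inter> k -` {c<..} \<noteq> {}" by force
  have op: "open (S \<inter> k -` {c<..})"
    using assms(1,2) by (intro continuous_open_preimage) auto
  have "AE x in lebesgue. x \<notin> S \<inter> k -` {c<..}"
    using ae by eventually_elim auto
  then have "S \<inter> k -` {c<..} \<in> null_sets lebesgue"
    using op by (subst AE_iff_null_sets) auto
  then show False using open_not_negligible[OF op ne] by (simp add: negligible_iff_null_sets)
qed

text \<open>The bound on \<open>m2\<close> is exported as an implication over all \<open>B\<close>
  because the decay rate of the right-hand side becomes known only later, with the help of the other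
  conclusions.\<close>

lemma circ_avg_properties:
  assumes jet: "C2_jet (ball 0 1 - {0}) u g H" and M: "M \<ge> 0"
    and tr: "\<And>x. x \<in> ball 0 1 - {0} \<Longrightarrow> - (M * exp (u x)) \<le> trace (H x)"
            "\<And>x. x \<in> ball 0 1 - {0} \<Longrightarrow> trace (H x) \<le> 0"
    and int: "integrable lborel (\<lambda>z. indicator (ball 0 1 - {0}) z * exp (u z))"
  obtains \<alpha> C m1 m2 where "\<alpha> > -2"
    "\<forall>s<0. (circ_avg u has_real_derivative m1 s) (at s)"
    "\<forall>s<0. (m1 has_real_derivative m2 s) (at s)"
    "\<forall>s<0. \<forall>B. (\<forall>\<theta>. exp (2 * s) * \<bar>trace (H (expolar s \<theta>))\<bar> \<le> B) \<longrightarrow> \<bar>m2 s\<bar> \<le> B"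
    "\<forall>s<0. m1 s \<le> \<alpha>" "\<forall>s<0. \<bar>m1 s\<bar> \<le> C"
    "\<forall>e>0. \<exists>s0<0. \<forall>s\<le>s0. \<alpha> - e \<le> m1 s"
proof -
  let ?S = "ball (0 :: real^2) 1 - {0}"
  have inS: "0 + expolar s \<theta> \<in> ?S" if "s < 0" for s \<theta>
    using that by simp
  have opS: "open ?S" by auto
  obtain Vs Vss Vt Vtt where cyl: "cylinder_C2 0 (\<lambda>s \<theta>. u (0 + expolar s \<theta>)) Vs Vss Vt Vtt"
    "\<And>s \<theta>. Vss s \<theta> + Vtt s \<theta> = exp (2 * s) * trace (H (0 + expolar s \<theta>))"
    using polar_cylinder[where T = 0 and c = 0, OF jet opS inS] by blast
  interpret cylinder_C2 0 "\<lambda>s \<theta>. u (expolar s \<theta>)" Vs Vss Vt Vtt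
    using cyl(1) by simp
  have avg: "circ_avg u = mu" by (simp add: fun_eq_iff circ_avg_def mu_def)
  have L: "L s \<theta> = exp (2 * s) * trace (H (expolar s \<theta>))" for s \<theta>
    using cyl(2)[of s \<theta>] by (simp add: L_def)
  define h where "h = (\<lambda>z. indicator ?S z * exp (u z))"
  define I where "I = (\<integral>z. h z \<partial>lborel)"
  \<comment> \<open>The energy per unit of \<open>s\<close>. Both inputs of
    \<open>concave_average\<close> come from its integral being at most \<open>I\<close>:
    \<open>- mu2\<close> is at most a multiple of \<open>p\<close>, and by Jensen's inequality
    \<open>p\<close> dominates \<open>2 * pi * exp (2 * s + mu s)\<close>.\<close>
  define p where "p = (\<lambda>s. exp (2 * s) * cint (\<lambda>\<theta>. exp (u (expolar s \<theta>))))"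
  note slV = slices(1)
  have cexp: "continuous_on A (\<lambda>\<theta>. exp (u (expolar s \<theta>)))" if "s < 0" for s A
    by (intro continuous_intros slV that)
  have cp: "continuous_on {..<0} p"
  proof -
    have "continuous_on ({..<0} \<times> cbox 0 (2 * pi)) (\<lambda>w. exp (u (expolar (fst w) (snd w))))"
      using cV unfolding case_prod_beta' by (intro continuous_on_exp) (rule continuous_on_subset, auto)
    then have "continuous_on {..<0} (\<lambda>s. integral (cbox 0 (2*pi)) (\<lambda>\<theta>. exp (u (expolar s \<theta>))))"
      by (intro integral_continuous_on_param) (simp add: case_prod_beta')
    then show ?thesis unfolding p_def by (auto intro!: continuous_intros)
  qed
  have p_integral: "integral {t0..t1} p \<le> I" if t: "t0 \<le> t1" "t1 < 0" for t0 t1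
  proof -
    let ?P = "\<lambda>s. exp (2 * s) * (LINT \<theta>:{0<..<2*pi}|lborel. h (expolar s \<theta>))"
    have c: "continuous_on {t0..t1} p" by (rule continuous_on_subset[OF cp]) (use t in auto)
    have i: "set_integrable lborel {t0..t1} p" by (rule borel_integrable_atLeastAtMost'[OF c])
    have "integral {t0..t1} p = (LINT s:{t0..t1}|lborel. p s)"
      by (rule set_borel_integral_eq_integral(2)[OF i, symmetric])
    also have "\<dots> \<le> (\<integral>s. ?P s \<partial>lborel)"
      unfolding set_lebesgue_integral_def[of lborel "{t0..t1}"]
    proof (rule integral_mono)
      show "integrable lborel (\<lambda>s. indicator {t0..t1} s *\<^sub>R p s)"
        using i by (simp add: set_integrable_def)
      show "integrable lborel ?P"
        by (rule integral_polar(2)) (use int in \<open>simp add: h_def\<close>)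
      fix s
      show "indicator {t0..t1} s *\<^sub>R p s \<le> ?P s"
      proof (cases "s < 0")
        case True
        have "h (expolar s \<theta>) = exp (u (expolar s \<theta>))" for \<theta>
          using inS[OF True] by (simp add: h_def)
        then have eq: "?P s = p s"
          using set_integral_eq_cint[OF cexp[OF True]] by (simp add: p_def)
        have "0 \<le> p s"
          unfolding p_def by (intro mult_nonneg_nonneg integral_nonneg integrable_continuous_interval cexp True) auto
        then show ?thesis unfolding eq by (auto simp: indicator_def)
      next
        case False
        have "0 \<le> ?P s"
          unfolding set_lebesgue_integral_def
          by (intro mult_nonneg_nonneg Bochner_Integration.integral_nonneg) (auto simp: h_def)
        then show ?thesis using False t by (auto simp: indicator_def)
      qed
    qed
    also have "\<dots> = I"
      unfolding I_def by (rule integral_polar(1)[symmetric]) (use int in \<open>simp add: h_def\<close>)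
    finally show ?thesis .
  qed
  have mu2_le: "mu2 s \<le> 0" and mu2_ge: "- (M / (2 * pi)) * p s \<le> mu2 s" if s: "s < 0" for s
  proof -
    have iL: "L s integrable_on {0..2*pi}"
      by (intro integrable_continuous_interval slice[OF cL] s)
    have "cint (L s) \<le> cint (\<lambda>_. 0)"
    proof (rule integral_le[OF iL])
      show "L s \<theta> \<le> 0" for \<theta>
        using tr(2)[of "expolar s \<theta>"] inS[OF s] by (simp add: L mult_nonneg_nonpos)
    qed auto
    then show "mu2 s \<le> 0" by (simp add: mu2_def divide_nonpos_pos)
    have "cint (\<lambda>\<theta>. - (M * exp (2 * s)) * exp (u (expolar s \<theta>))) \<le> cint (L s)"
    proof (rule integral_le[OF _ iL])
      show "(\<lambda>\<theta>. - (M * exp (2 * s)) * exp (u (expolar s \<theta>))) integrable_on {0..2*pi}"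
        by (intro integrable_continuous_interval continuous_intros slV s)
      show "- (M * exp (2 * s)) * exp (u (expolar s \<theta>)) \<le> L s \<theta>" for \<theta>
      proof -
        have "exp (2 * s) * - (M * exp (u (expolar s \<theta>))) \<le> L s \<theta>"
          unfolding L using tr(1)[of "expolar s \<theta>"] inS[OF s] by (intro mult_left_mono) auto
        then show ?thesis by (simp add: mult_ac)
      qed
    qed
    also have "cint (\<lambda>\<theta>. - (M * exp (2 * s)) * exp (u (expolar s \<theta>))) = - M * p s"
      by (subst integral_mult_right) (simp add: p_def mult_ac)
    finally have "- M * p s / (2 * pi) \<le> mu2 s"
      unfolding mu2_def by (intro divide_right_mono) auto
    then show "- (M / (2 * pi)) * p s \<le> mu2 s" by simp
  qed
  have C1: "mu1 t0 - mu1 t1 \<le> M / (2 * pi) * I" if t: "t0 \<le> t1" "t1 < 0" for t0 t1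
  proof -
    have "(mu2 has_integral mu1 t1 - mu1 t0) {t0..t1}"
    proof (rule fundamental_theorem_of_calculus[OF t(1)])
      fix s assume "s \<in> {t0..t1}"
      then show "(mu1 has_vector_derivative mu2 s) (at s within {t0..t1})"
        using mu1_deriv[of s] t
        by (auto simp: has_real_derivative_iff_has_vector_derivative[symmetric] intro: DERIV_subset)
    qed
    then have hi: "((\<lambda>s. - mu2 s) has_integral mu1 t0 - mu1 t1) {t0..t1}"
      using has_integral_neg[of mu2 "mu1 t1 - mu1 t0" "{t0..t1}"] by simp
    have c: "continuous_on {t0..t1} p" by (rule continuous_on_subset[OF cp]) (use t in auto)
    have "mu1 t0 - mu1 t1 = integral {t0..t1} (\<lambda>s. - mu2 s)"
      by (rule integral_unique[OF hi, symmetric])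
    also have "\<dots> \<le> integral {t0..t1} (\<lambda>s. M / (2 * pi) * p s)"
    proof (rule integral_le)
      show "(\<lambda>s. - mu2 s) integrable_on {t0..t1}" by (rule has_integral_integrable[OF hi])
      show "(\<lambda>s. M / (2 * pi) * p s) integrable_on {t0..t1}"
        by (intro integrable_continuous_interval continuous_intros c)
      show "- mu2 s \<le> M / (2 * pi) * p s" if "s \<in> {t0..t1}" for s
        using mu2_ge[of s] that t by simp
    qed
    also have "\<dots> = M / (2 * pi) * integral {t0..t1} p" by (rule integral_mult_right)
    also have "\<dots> \<le> M / (2 * pi) * I"
      using M by (intro mult_left_mono p_integral t) auto
    finally show ?thesis .
  qed
  have jensen: "2 * pi * exp (mu s) \<le> cint (\<lambda>\<theta>. exp (u (expolar s \<theta>)))" if s: "s < 0" for s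
  proof -
    have "cint (\<lambda>\<theta>. exp (mu s) * (1 + (u (expolar s \<theta>) - mu s))) \<le> cint (\<lambda>\<theta>. exp (u (expolar s \<theta>)))"
    proof (rule integral_le)
      fix \<theta>
      have "exp (mu s) * (1 + (u (expolar s \<theta>) - mu s)) \<le> exp (mu s) * exp (u (expolar s \<theta>) - mu s)"
        by (intro mult_left_mono exp_ge_add_one_self) auto
      then show "exp (mu s) * (1 + (u (expolar s \<theta>) - mu s)) \<le> exp (u (expolar s \<theta>))"
        by (simp flip: exp_add)
    qed (intro integrable_continuous_interval continuous_intros slV s)+
    also have "cint (\<lambda>\<theta>. exp (mu s) * (1 + (u (expolar s \<theta>) - mu s))) = exp (mu s) * (2 * pi + cint (\<lambda>\<theta>. u (expolar s \<theta>) - mu s))"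
      by (subst integral_mult_right, subst integral_add)
         (auto intro!: integrable_continuous_interval continuous_intros slV s)
    finally show ?thesis using cint_V_minus_mu[OF s] by (simp add: mult.commute)
  qed
  have C2: "integral {t0..t1} (\<lambda>s. exp (2 * s + mu s)) \<le> I / (2 * pi)" if t: "t0 \<le> t1" "t1 < 0" for t0 t1
  proof -
    have c: "continuous_on {t0..t1} p" by (rule continuous_on_subset[OF cp]) (use t in auto)
    have cm: "continuous_on {t0..t1} mu" by (rule continuous_on_subset[OF mu_cont]) (use t in auto)
    have "integral {t0..t1} (\<lambda>s. exp (2 * s + mu s)) \<le> integral {t0..t1} (\<lambda>s. 1 / (2 * pi) * p s)"
    proof (rule integral_le)
      show "(\<lambda>s. exp (2 * s + mu s)) integrable_on {t0..t1}" "(\<lambda>s. 1 / (2 * pi) * p s) integrable_on {t0..t1}"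
        by (intro integrable_continuous_interval continuous_intros c cm)+
      fix s assume "s \<in> {t0..t1}"
      then have s: "s < 0" using t by auto
      have "exp (2 * s) * (2 * pi * exp (mu s)) \<le> p s"
        unfolding p_def by (intro mult_left_mono jensen s) auto
      then show "exp (2 * s + mu s) \<le> 1 / (2 * pi) * p s" by (simp add: exp_add field_simps)
    qed
    also have "\<dots> = 1 / (2 * pi) * integral {t0..t1} p" by (rule integral_mult_right)
    also have "\<dots> \<le> 1 / (2 * pi) * I" by (intro mult_left_mono p_integral t) auto
    finally show ?thesis by simp
  qed
  obtain \<alpha> where \<alpha>: "\<alpha> > -2" "\<And>s. s < 0 \<Longrightarrow> mu1 s \<le> \<alpha>" "\<And>s. s < 0 \<Longrightarrow> \<alpha> - M / (2 * pi) * I \<le> mu1 s"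
      "\<And>e. e > 0 \<Longrightarrow> \<exists>s0<0. \<forall>s\<le>s0. \<alpha> - e \<le> mu1 s"
    using concave_average[OF mu_deriv mu1_deriv mu2_le C1 C2] by blast
  show ?thesis
  proof (rule that[of \<alpha> mu1 mu2 "\<bar>\<alpha>\<bar> + \<bar>M / (2 * pi) * I\<bar>"])
    have "\<bar>mu2 s\<bar> \<le> B" if "s < 0" "\<forall>\<theta>. exp (2 * s) * \<bar>trace (H (expolar s \<theta>))\<bar> \<le> B" for s B
      by (rule mu2_bound[OF that(1)]) (use that(2) in \<open>simp add: L abs_mult\<close>)
    then show "\<forall>s<0. \<forall>B. (\<forall>\<theta>. exp (2 * s) * \<bar>trace (H (expolar s \<theta>))\<bar> \<le> B) \<longrightarrow> \<bar>mu2 s\<bar> \<le> B"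
      by blast
    have "\<bar>mu1 s\<bar> \<le> \<bar>\<alpha>\<bar> + \<bar>M / (2 * pi) * I\<bar>" if "s < 0" for s
      using \<alpha>(2,3)[OF that] by linarith
    then show "\<forall>s<0. \<bar>mu1 s\<bar> \<le> \<bar>\<alpha>\<bar> + \<bar>M / (2 * pi) * I\<bar>" by blast
  qed (use \<alpha> mu_deriv mu1_deriv avg in auto)
qed

text \<open>An upper bound for \<open>u\<close> and a lower bound for its average control the
  integral of \<open>\<bar>u\<bar>\<close> on circles, through
  \<open>\<bar>u\<bar> \<le> 2 * (16 - 2 * s) - u\<close>. As \<open>- u\<close> is subharmonic,
  this gives a pointwise lower bound for \<open>u\<close>. The logarithm is finally relaxed to a
  power with exponent \<open>1 / 32\<close>, the form that \<open>oscillation_decay\<close> takes as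
  input.\<close>

lemma logarithmic_growth:
  assumes jet: "C2_jet (ball 0 R - {0}) u g H" and R: "0 < R" "R \<le> 1 / 3"
    and tr: "\<And>x. x \<in> ball 0 R - {0} \<Longrightarrow> trace (H x) \<le> 0"
    and up: "\<And>x. x \<in> ball 0 R - {0} \<Longrightarrow> exp (u x) * (norm x)\<^sup>2 \<le> 16"
    and m1: "\<And>s. s < 0 \<Longrightarrow> (circ_avg u has_real_derivative m1 s) (at s)"
    and C: "\<And>s. s < 0 \<Longrightarrow> \<bar>m1 s\<bar> \<le> C"
  shows "\<exists>E. \<forall>x\<in>ball 0 (R / 2) - {0}. \<bar>u x\<bar> \<le> E * exp (- ln (norm x) / 32)"
proof -
  let ?S = "ball (0 :: real^2) R - {0}"
  define a where "a = \<bar>circ_avg u (-1)\<bar>"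
  have C0: "C \<ge> 0" using C[of "-1"] by simp
  \<comment> \<open>\<open>R \<le> 1 / 3\<close> serves to get \<open>ln R \<le> -1\<close>: the
    average is estimated leftwards from its value at \<open>-1\<close>, and
    \<open>- ln (norm x)\<close> is then at least 1.\<close>
  have "exp 1 \<le> (3::real)" by (rule exp_le)
  then have "1 \<le> ln (3::real)" by (simp add: ln_ge_iff)
  then have "ln (1/3::real) \<le> -1" by (simp add: ln_div)
  moreover have "ln R \<le> ln (1/3)" using R by simp
  ultimately have lnR: "ln R \<le> -1" by linarith
  have expR: "exp s < R" if "s < ln R" for s
    using that R by (metis exp_less_mono exp_ln)
  have inS: "expolar s \<theta> \<in> ?S" if "s < ln R" for s \<theta>
    using expR[OF that] by simp
  have avg: "\<bar>circ_avg u s\<bar> \<le> a + C * (- s)" if s: "s \<le> -1" for s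
  proof -
    have "norm (circ_avg u s - circ_avg u (-1)) \<le> C * norm (s - (-1))"
    proof (rule field_differentiable_bound[of "{s..-1}" _ m1])
      show "(circ_avg u has_real_derivative m1 z) (at z within {s..-1})" if "z \<in> {s..-1}" for z
        using m1[of z] that by (auto intro: DERIV_subset)
    qed (use C s in auto)
    also have "\<dots> \<le> C * (- s)" using s C0 by (intro mult_left_mono) auto
    finally show ?thesis by (simp add: a_def)
  qed
  have upper: "u z \<le> 16 - 2 * ln (norm z)" if z: "z \<in> ?S" for z
  proof -
    have "exp (u z + 2 * ln (norm z)) = exp (u z) * (norm z)\<^sup>2"
      using z by (simp add: exp_add exp_double)
    then have "exp (u z + 2 * ln (norm z)) \<le> 16" using up[OF z] by simp
    then have "1 + (u z + 2 * ln (norm z)) \<le> 16" using exp_ge_add_one_self order_trans by blast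
    then show ?thesis by simp
  qed
  have cint_abs: "cint (\<lambda>\<theta>. \<bar>u (expolar s \<theta>)\<bar>) \<le> 2 * pi * (32 + a + (4 + C) * (- s))" if s: "s < ln R" for s
  proof -
    have c: "continuous_on {0..2*pi} (\<lambda>\<theta>. u (expolar s \<theta>))"
      by (rule continuous_on_compose2[OF C2_jet_continuous[OF jet order_refl]])
         (use inS[OF s] in \<open>auto intro!: continuous_intros\<close>)
    have "cint (\<lambda>\<theta>. \<bar>u (expolar s \<theta>)\<bar>) \<le> cint (\<lambda>\<theta>. 2 * (16 - 2 * s) - u (expolar s \<theta>))"
    proof (rule integral_le)
      show "\<bar>u (expolar s \<theta>)\<bar> \<le> 2 * (16 - 2 * s) - u (expolar s \<theta>)" for \<theta>
      proof -
        have "u (expolar s \<theta>) \<le> 16 - 2 * s" using upper[OF inS[OF s, of \<theta>]] by simp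
        moreover have "s \<le> 0" using s lnR by simp
        ultimately show ?thesis by (simp add: abs_le_iff)
      qed
    qed (auto intro!: integrable_continuous_interval continuous_intros c)
    also have "\<dots> = 2 * pi * (2 * (16 - 2 * s) - circ_avg u s)"
      using c by (subst integral_diff) (auto intro!: integrable_continuous_interval simp: circ_avg_def field_simps)
    also have "\<dots> \<le> 2 * pi * (32 + a + (4 + C) * (- s))"
    proof -
      have "- circ_avg u s \<le> a + C * (- s)" using avg[of s] s lnR by (simp add: abs_le_iff)
      moreover have "(4 + C) * (- s) = - 4 * s + C * (- s)" by (simp add: distrib_right)
      ultimately show ?thesis by (intro mult_left_mono) auto
    qed
    finally show ?thesis .
  qed
  define Q where "Q = 2 * pi * (32 + a + (4 + C))"
  have Q0: "Q \<ge> 0" using C0 by (simp add: Q_def a_def)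
  have "\<bar>u x\<bar> \<le> ((48 * Q + 16) * 32) * exp (- ln (norm x) / 32)" if x: "x \<in> ball 0 (R / 2) - {0}" for x
  proof -
    define l where "l = - ln (norm x)"
    have n: "norm x > 0" "norm x < R / 2" using x by auto
    have l: "l \<ge> 1"
    proof -
      have "norm x \<le> R" using n R by linarith
      then have "ln (norm x) \<le> ln R" using n R by simp
      then show ?thesis using lnR by (simp add: l_def)
    qed
    have "(\<lambda>x. - u x) x \<le> 48 * (Q * (1 + l)) + 0"
    proof (rule pointwise_bound[OF C2_jet_uminus[OF jet]])
      show ann: "annulus (norm x / 2) (3 * norm x / 2) \<subseteq> ?S"
        using n by (auto simp: annulus_def)
      show "- 0 \<le> trace (- H z) * (norm x)\<^sup>2" if "z \<in> annulus (norm x / 2) (3 * norm x / 2)" for z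
      proof -
        have "z \<in> ?S" using that ann by blast
        from tr[OF this] show ?thesis by (simp add: trace_minus mult_nonpos_nonneg)
      qed
      fix s assume s: "s \<in> {ln (norm x / 2)..ln (3 * norm x / 2)}"
      have "3 * norm x / 2 < R" using n R by linarith
      then have "ln (3 * norm x / 2) < ln R" using n R by simp
      then have sR: "s < ln R" using s by simp
      have "ln (2::real) \<le> 1" using ln_le_minus_one[of "2::real"] by simp
      then have sl: "- s \<le> 1 + l" using s n by (simp add: l_def ln_div)
      have "cint (\<lambda>\<theta>. \<bar>- u (expolar s \<theta>)\<bar>) \<le> 2 * pi * (32 + a + (4 + C) * (- s))"
        using cint_abs[OF sR] by simp
      also have "\<dots> \<le> 2 * pi * ((32 + a) * (1 + l) + (4 + C) * (1 + l))"
      proof -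
        have "(4 + C) * (- s) \<le> (4 + C) * (1 + l)" using sl C0 by (intro mult_left_mono) auto
        moreover have "(32 + a) * 1 \<le> (32 + a) * (1 + l)" using l by (intro mult_left_mono) (auto simp: a_def)
        ultimately show ?thesis by (intro mult_left_mono) auto
      qed
      also have "\<dots> = Q * (1 + l)" by (simp add: Q_def algebra_simps)
      finally show "cint (\<lambda>\<theta>. \<bar>- u (expolar s \<theta>)\<bar>) \<le> Q * (1 + l)" .
    qed (use n in auto)
    then have low: "- u x \<le> 48 * Q * (1 + l)" by simp
    have "norm x < R" using n R by linarith
    then have "x \<in> ?S" using x by simp
    from upper[OF this] have "u x \<le> 16 * (1 + l)" using l by (simp add: l_def)
    moreover have "0 \<le> 48 * Q * (1 + l)" "0 \<le> 16 * (1 + l)" using Q0 l by auto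
    ultimately have "\<bar>u x\<bar> \<le> 48 * Q * (1 + l) + 16 * (1 + l)" using low by linarith
    also have "\<dots> = (48 * Q + 16) * (1 + l)" by (simp add: algebra_simps)
    also have "\<dots> \<le> (48 * Q + 16) * (32 * exp (l / 32))"
    proof (rule mult_left_mono)
      show "1 + l \<le> 32 * exp (l / 32)" using exp_ge_add_one_self[of "l / 32"] by linarith
    qed (use Q0 in simp)
    finally show ?thesis unfolding l_def mult.assoc .
  qed
  then show ?thesis by blast
qed

lemma singular_expansion:
  assumes jet: "C2_jet (ball 0 1 - {0}) u g H" and M: "M \<ge> 0"
    and tr: "\<And>x. x \<in> ball 0 1 - {0} \<Longrightarrow> - (M * exp (u x)) \<le> trace (H x)"
            "\<And>x. x \<in> ball 0 1 - {0} \<Longrightarrow> trace (H x) \<le> 0"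
    and int: "integrable lborel (\<lambda>z. indicator (ball 0 1 - {0}) z * exp (u z))"
  shows "\<exists>\<alpha>>-2. \<exists>\<rho>\<in>{0<..<1}. \<exists>\<gamma>\<in>{0<..<1}. \<exists>\<phi>.
           holder_on \<gamma> (ball 0 \<rho>) \<phi> \<and> (\<forall>x\<in>ball 0 \<rho> - {0}. u x = \<alpha> * ln (norm x) + \<phi> x)"
proof -
  obtain \<alpha> C m1 m2 where \<alpha>: "\<alpha> > -2" and avg:
    "\<forall>s<0. (circ_avg u has_real_derivative m1 s) (at s)"
    "\<forall>s<0. (m1 has_real_derivative m2 s) (at s)"
    "\<forall>s<0. \<forall>B. (\<forall>\<theta>. exp (2 * s) * \<bar>trace (H (expolar s \<theta>))\<bar> \<le> B) \<longrightarrow> \<bar>m2 s\<bar> \<le> B"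
    "\<forall>s<0. m1 s \<le> \<alpha>" "\<forall>s<0. \<bar>m1 s\<bar> \<le> C"
    "\<forall>e>0. \<exists>s0<0. \<forall>s\<le>s0. \<alpha> - e \<le> m1 s"
    by (rule circ_avg_properties[OF jet M tr int], assumption, assumption, rule that; assumption)
  note m1 = avg(1)[rule_format] and m2 = avg(2)[rule_format] and m2b = avg(3)[rule_format]
    and m1\<alpha> = avg(4)[rule_format] and m1C = avg(5)[rule_format] and m1lim = avg(6)[rule_format]
  obtain R1 where R1: "R1 > 0" "\<And>x. x \<in> ball 0 R1 - {0} \<Longrightarrow> exp (u x) * (norm x)\<^sup>2 \<le> 16"
    using eps_regularity[OF jet M tr(1) int] by blast
  define R where "R = min R1 (1 / 3)"
  have R: "R > 0" "R \<le> 1 / 3" "R \<le> R1" using R1 by (auto simp: R_def)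
  have sub: "ball 0 R' - {0} \<subseteq> ball (0 :: real^2) 1 - {0}" if "R' \<le> 1" for R'
    using that by auto
  have trabs: "(norm x)\<^sup>2 * \<bar>trace (H x)\<bar> \<le> M * (exp (u x) * (norm x)\<^sup>2)" if "x \<in> ball 0 1 - {0}" for x
  proof -
    have "\<bar>trace (H x)\<bar> \<le> M * exp (u x)" using tr[OF that] by linarith
    then have "(norm x)\<^sup>2 * \<bar>trace (H x)\<bar> \<le> (norm x)\<^sup>2 * (M * exp (u x))" by (intro mult_left_mono) auto
    then show ?thesis by (simp add: mult_ac)
  qed
  have up: "exp (u x) * (norm x)\<^sup>2 \<le> 16" if "x \<in> ball 0 R - {0}" for x
    by (rule R1(2)) (use that R in auto)
  have "\<exists>E. \<forall>x\<in>ball 0 (R / 2) - {0}. \<bar>u x\<bar> \<le> E * exp (- ln (norm x) / 32)"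
    by (rule logarithmic_growth[OF C2_jet_subset[OF jet sub] R(1,2) tr(2) up m1 m1C]) (use R in auto)
  then obtain E where E: "\<And>x. x \<in> ball 0 (R / 2) - {0} \<Longrightarrow> \<bar>u x\<bar> \<le> E * exp (- ln (norm x) / 32)"
    by blast
  \<comment> \<open>First pass, with exponent 0: so far the right-hand side on the cylinder is
    merely bounded, by \<open>16 * M\<close>.\<close>
  have "\<exists>D. \<forall>x\<in>ball 0 (R / 2 / 2) - {0}. \<bar>u x - circ_avg u (ln (norm x))\<bar> \<le> D * exp (0 * ln (norm x))"
  proof (rule oscillation_decay[OF C2_jet_subset[OF jet sub], where B = "16 * M"])
    show "(norm x)\<^sup>2 * \<bar>trace (H x)\<bar> \<le> 16 * M * exp (0 * ln (norm x))" if "x \<in> ball 0 (R / 2) - {0}" for x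
    proof -
      have x: "x \<in> ball 0 R - {0}" "x \<in> ball 0 1 - {0}" using that R by auto
      have "M * (exp (u x) * (norm x)\<^sup>2) \<le> M * 16" using up[OF x(1)] M by (rule mult_left_mono)
      then show ?thesis using trabs[OF x(2)] by simp
    qed
  qed (use R M E in auto)
  then obtain D where "\<forall>x\<in>ball 0 (R / 4) - {0}. \<bar>u x - circ_avg u (ln (norm x))\<bar> \<le> D"
    by auto
  note D = bspec[OF this]
  \<comment> \<open>Half of the gap to \<open>-2\<close>, so that
    \<open>\<alpha> - \<eta> = \<eta> - 2\<close>: once the slope of the average is at least
    \<open>\<alpha> - \<eta>\<close>, the sum \<open>circ_avg u s + 2 * s\<close> tends to minus
    infinity at rate \<open>\<eta>\<close>.\<close>
  define \<eta> where "\<eta> = (\<alpha> + 2) / 2"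
  have \<eta>: "\<eta> > 0" using \<alpha> by (simp add: \<eta>_def)
  obtain s0 where s0: "s0 < 0" "\<And>s. s \<le> s0 \<Longrightarrow> \<alpha> - \<eta> \<le> m1 s" using m1lim[OF \<eta>] by blast
  define c0 where "c0 = circ_avg u s0 - (\<alpha> - \<eta>) * s0"
  have avg_up: "circ_avg u s + 2 * s \<le> \<eta> * s + c0" if s: "s \<le> s0" for s
  proof -
    have "circ_avg u s - (\<alpha> - \<eta>) * s \<le> circ_avg u s0 - (\<alpha> - \<eta>) * s0"
    proof (rule DERIV_nonneg_imp_nondecreasing[OF s, where f = "\<lambda>s. circ_avg u s - (\<alpha> - \<eta>) * s"])
      fix x assume x: "s \<le> x" "x \<le> s0"
      have "((\<lambda>s. circ_avg u s - (\<alpha> - \<eta>) * s) has_real_derivative m1 x - (\<alpha> - \<eta>)) (at x)"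
        using m1[of x] x s0 by (auto intro!: derivative_eq_intros)
      moreover have "0 \<le> m1 x - (\<alpha> - \<eta>)" using s0(2)[OF x(2)] by simp
      ultimately show "\<exists>y. ((\<lambda>s. circ_avg u s - (\<alpha> - \<eta>) * s) has_real_derivative y) (at x) \<and> 0 \<le> y" by blast
    qed
    moreover have "(\<alpha> - \<eta>) * s = \<eta> * s - 2 * s" by (simp add: \<eta>_def field_simps)
    ultimately show ?thesis unfolding c0_def by linarith
  qed
  define \<gamma> where "\<gamma> = min \<eta> (1 / 16)"
  have \<gamma>: "\<gamma> > 0" "\<gamma> \<le> 1 / 16" "\<gamma> \<le> \<eta>" using \<eta> by (auto simp: \<gamma>_def)
  define R2 where "R2 = min (R / 4) (exp s0)"
  have R2: "R2 > 0" "R2 \<le> R / 4" "R2 \<le> exp s0" "R2 < 1" using R by (auto simp: R2_def)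
  define B where "B = M * exp (D + c0)"
  have B: "B \<ge> 0" using M by (simp add: B_def)
  have trB: "(norm x)\<^sup>2 * \<bar>trace (H x)\<bar> \<le> B * exp (\<gamma> * ln (norm x))" if x: "x \<in> ball 0 R2 - {0}" for x
  proof -
    have n: "norm x > 0" "norm x < R / 4" "norm x < exp s0" "norm x < 1" using x R2 by auto
    have ls0: "ln (norm x) \<le> s0"
      using n by (metis exp_le_cancel_iff exp_ln less_imp_le)
    have l0: "ln (norm x) < 0" using n by simp
    have "u x \<le> D + circ_avg u (ln (norm x))" using D[of x] n x by (auto simp: abs_le_iff)
    then have "u x + 2 * ln (norm x) \<le> D + c0 + \<eta> * ln (norm x)" using avg_up[OF ls0] by linarith
    also have "\<eta> * ln (norm x) \<le> \<gamma> * ln (norm x)" using \<gamma> l0 by (intro mult_right_mono_neg) auto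
    finally have "exp (u x + 2 * ln (norm x)) \<le> exp (D + c0 + \<gamma> * ln (norm x))" by simp
    then have "exp (u x) * (norm x)\<^sup>2 \<le> exp (D + c0) * exp (\<gamma> * ln (norm x))"
      using n by (simp add: exp_add exp_double)
    then have "M * (exp (u x) * (norm x)\<^sup>2) \<le> M * (exp (D + c0) * exp (\<gamma> * ln (norm x)))"
      using M by (rule mult_left_mono)
    moreover have "x \<in> ball 0 1 - {0}" using n x by simp
    ultimately show ?thesis unfolding B_def mult.assoc using trabs order_trans by blast
  qed
  \<comment> \<open>Second pass, now with the power decay \<open>trB\<close> of the right-hand
    side.\<close>
  have "\<exists>D. \<forall>x\<in>ball 0 (R2 / 2) - {0}. \<bar>u x - circ_avg u (ln (norm x))\<bar> \<le> D * exp (\<gamma> * ln (norm x))"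
  proof (rule oscillation_decay[OF C2_jet_subset[OF jet sub] R2(1) _ \<gamma>(2) B trB])
    show "\<bar>u x\<bar> \<le> E * exp (- ln (norm x) / 32)" if "x \<in> ball 0 R2 - {0}" for x
      by (rule E) (use that R2 R in auto)
  qed (use R2 \<gamma> in auto)
  then obtain D2 where D2: "\<And>x. x \<in> ball 0 (R2 / 2) - {0} \<Longrightarrow>
      \<bar>u x - circ_avg u (ln (norm x))\<bar> \<le> D2 * exp (\<gamma> * ln (norm x))" by blast
  have "\<exists>c. \<forall>s\<le>ln (R2 / 2). \<bar>circ_avg u s - \<alpha> * s - c\<bar> \<le> B / \<gamma>\<^sup>2 * exp (\<gamma> * s)"
  proof (rule average_asymptotics[where m = "circ_avg u" and ?m1.0 = m1 and ?m2.0 = m2])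
    fix s assume s: "s \<le> ln (R2 / 2)"
    have e: "exp s \<le> R2 / 2" using s R2 exp_le_cancel_iff[of s "ln (R2 / 2)"] by simp
    then have s1: "exp s < R2" using R2 by linarith
    then have "exp s < 1" using R2 by linarith
    then have sneg: "s < 0" by simp
    show "(circ_avg u has_real_derivative m1 s) (at s)" by (rule m1[OF sneg])
    show "(m1 has_real_derivative m2 s) (at s)" by (rule m2[OF sneg])
    show "m1 s \<le> \<alpha>" by (rule m1\<alpha>[OF sneg])
    show "\<bar>m2 s\<bar> \<le> B * exp (\<gamma> * s)"
    proof (rule m2b[OF sneg])
      show "exp (2 * s) * \<bar>trace (H (expolar s \<theta>))\<bar> \<le> B * exp (\<gamma> * s)" for \<theta>
        using trB[of "expolar s \<theta>"] s1 by (simp add: exp_double)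
    qed
  qed (use \<gamma> m1lim in blast)+
  then obtain c where c: "\<And>s. s \<le> ln (R2 / 2) \<Longrightarrow> \<bar>circ_avg u s - \<alpha> * s - c\<bar> \<le> B / \<gamma>\<^sup>2 * exp (\<gamma> * s)" by blast
  define R3 where "R3 = R2 / 2"
  have R3: "R3 > 0" "R3 < 1" using R2 by (auto simp: R3_def)
  define v where "v = (\<lambda>x. u x - \<alpha> * ln (norm x) - c)"
  \<comment> \<open>One constant has to serve both hypotheses of \<open>holder_estimate\<close>: the
    first two terms bound \<open>v\<close>, and \<open>B\<close> bounds the trace.\<close>
  define C3 where "C3 = \<bar>D2\<bar> + B / \<gamma>\<^sup>2 + B"
  have C3: "C3 \<ge> 0" using B by (simp add: C3_def)
  have vb: "\<bar>v x\<bar> \<le> C3 * norm x powr \<gamma>" if x: "x \<in> ball 0 R3 - {0}" for x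
  proof -
    have n: "norm x > 0" "norm x \<le> R2 / 2" using x by (auto simp: R3_def)
    have "ln (norm x) \<le> ln (R2 / 2)" using n R2 by simp
    then have "\<bar>circ_avg u (ln (norm x)) - \<alpha> * ln (norm x) - c\<bar> \<le> B / \<gamma>\<^sup>2 * exp (\<gamma> * ln (norm x))" by (rule c)
    moreover have "\<bar>u x - circ_avg u (ln (norm x))\<bar> \<le> D2 * exp (\<gamma> * ln (norm x))"
      by (rule D2) (use x in \<open>simp add: R3_def\<close>)
    moreover have "D2 * exp (\<gamma> * ln (norm x)) \<le> \<bar>D2\<bar> * exp (\<gamma> * ln (norm x))" by (intro mult_right_mono) auto
    moreover have "0 \<le> B * exp (\<gamma> * ln (norm x))" using B by simp
    ultimately have "\<bar>v x\<bar> \<le> \<bar>D2\<bar> * exp (\<gamma> * ln (norm x)) + B / \<gamma>\<^sup>2 * exp (\<gamma> * ln (norm x)) + B * exp (\<gamma> * ln (norm x))"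
      unfolding v_def by linarith
    then show ?thesis using n by (simp add: C3_def powr_def distrib_right)
  qed
  let ?H0 = "\<lambda>x::real^2. \<chi> i j. (if i = j then 1 / (x \<bullet> x) else 0) - 2 * x $ i * x $ j / (x \<bullet> x)\<^sup>2"
  let ?g0 = "\<lambda>x::real^2. (1 / (x \<bullet> x)) *\<^sub>R x"
  have sub3: "ball 0 R3 - {0} \<subseteq> ball (0 :: real^2) 1 - {0}" "ball 0 R3 - {0} \<subseteq> - {0 :: real^2}"
    using R3 by auto
  have jv: "C2_jet (ball 0 R3 - {0}) v (\<lambda>x. 1 *\<^sub>R g x + (- \<alpha>) *\<^sub>R ?g0 x) (\<lambda>x. 1 *\<^sub>R H x + (- \<alpha>) *\<^sub>R ?H0 x)"
  proof -
    have "C2_jet (ball 0 R3 - {0}) (\<lambda>x. 1 * u x + (- \<alpha>) * ln (norm x))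
        (\<lambda>x. 1 *\<^sub>R g x + (- \<alpha>) *\<^sub>R ?g0 x) (\<lambda>x. 1 *\<^sub>R H x + (- \<alpha>) *\<^sub>R ?H0 x)"
      by (rule C2_jet_lincomb[OF C2_jet_subset[OF jet sub3(1)] C2_jet_subset[OF C2_jet_ln_norm(1) sub3(2)]])
    from C2_jet_lincomb[OF this C2_jet_const[of _ "- c"], of 1 1]
    show ?thesis by (simp add: v_def)
  qed
  have trv: "(norm x)\<^sup>2 * \<bar>trace (1 *\<^sub>R H x + (- \<alpha>) *\<^sub>R ?H0 x)\<bar> \<le> C3 * norm x powr \<gamma>"
    if x: "x \<in> ball 0 R3 - {0}" for x
  proof -
    have x0: "x \<noteq> 0" and x2: "x \<in> ball 0 R2 - {0}" using x R2 by (auto simp: R3_def)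
    have "trace (1 *\<^sub>R H x + (- \<alpha>) *\<^sub>R ?H0 x) = trace (H x)"
      by (simp only: trace_lincomb C2_jet_ln_norm(2)[OF x0] mult_zero_right add_0_right mult_1)
    moreover have "(norm x)\<^sup>2 * \<bar>trace (H x)\<bar> \<le> B * norm x powr \<gamma>"
      using trB[OF x2] x0 by (simp add: powr_def)
    moreover have "B * norm x powr \<gamma> \<le> C3 * norm x powr \<gamma>"
      using B by (intro mult_right_mono) (auto simp: C3_def)
    ultimately show ?thesis by simp
  qed
  \<comment> \<open>The value 0 is the continuous extension, since \<open>v\<close> is of order
    \<open>norm x powr \<gamma>\<close>; the constant \<open>c\<close> is added back at the
    end.\<close>
  define \<phi> where "\<phi> = (\<lambda>x. if x = 0 then 0 else v x)"
  have hv: "\<bar>v x - v y\<bar> \<le> 128 * C3 * dist x y powr \<gamma>"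
    if xy: "x \<in> ball 0 (R3 / 2) - {0}" "y \<in> ball 0 (R3 / 2) - {0}" for x y
  proof (cases "norm y \<le> norm x")
    case True
    show ?thesis by (rule holder_estimate[OF jv \<gamma>(1,2) C3 vb trv xy True]; assumption)
  next
    case False
    then have le: "norm x \<le> norm y" by simp
    have "\<bar>v y - v x\<bar> \<le> 128 * C3 * dist y x powr \<gamma>"
      by (rule holder_estimate[OF jv \<gamma>(1,2) C3 vb trv xy(2,1) le]; assumption)
    then show ?thesis by (simp add: dist_commute abs_minus_commute)
  qed
  have v0: "\<bar>v x\<bar> \<le> 128 * C3 * norm x powr \<gamma>" if "x \<in> ball 0 (R3 / 2) - {0}" for x
  proof -
    have "x \<in> ball 0 R3 - {0}" using that R3 by auto
    then have "\<bar>v x\<bar> \<le> C3 * norm x powr \<gamma>" by (rule vb)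
    also have "\<dots> \<le> 128 * C3 * norm x powr \<gamma>" using C3 by (intro mult_right_mono) auto
    finally show ?thesis .
  qed
  have "holder_on \<gamma> (ball 0 (R3 / 2)) \<phi>"
    unfolding holder_on_def
  proof (intro exI ballI)
    fix x y :: "real^2" assume xy: "x \<in> ball 0 (R3 / 2)" "y \<in> ball 0 (R3 / 2)"
    show "\<bar>\<phi> x - \<phi> y\<bar> \<le> 128 * C3 * dist x y powr \<gamma>"
      using hv[of x y] v0[of x] v0[of y] xy by (auto simp: \<phi>_def)
  qed
  moreover have "\<forall>x\<in>ball 0 (R3 / 2) - {0}. u x = \<alpha> * ln (norm x) + (\<phi> x + c)"
    by (simp add: \<phi>_def v_def)
  moreover have "holder_on \<gamma> (ball 0 (R3 / 2)) (\<lambda>x. \<phi> x + c)"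
    using calculation(1) by (simp add: holder_on_def)
  moreover have "R3 / 2 \<in> {0<..<1}" "\<gamma> \<in> {0<..<1}" using R3 \<gamma> by auto
  ultimately show ?thesis using \<alpha> by blast
qed

theorem theorem1p1:
  fixes K u :: "real^2 \<Rightarrow> real"
  assumes K_meas: "set_borel_measurable lebesgue (ball 0 1) K"
    and K_Linf: "\<exists>M. AE x in lebesgue. x \<in> ball 0 1 \<longrightarrow> \<bar>K x\<bar> \<le> M"
    and K_nonneg: "AE x in lebesgue. x \<in> ball 0 1 \<longrightarrow> K x \<ge> 0"
    and u_C2: "C2_on (ball 0 1 - {0}) u"
    and eq: "\<forall>x\<in>ball 0 1 - {0}. - laplacian u x = K x * exp (u x)"
    and fin: "(\<integral>\<^sup>+ x\<in>ball 0 1 - {0}. ennreal (exp (u x)) \<partial>lebesgue) < \<infinity>"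
  shows "\<exists>\<alpha>>-2. \<exists>\<rho>\<in>{0<..<1}. \<exists>\<gamma>\<in>{0<..<1}. \<exists>\<phi> :: real^2 \<Rightarrow> real.
           holder_on \<gamma> (ball 0 \<rho>) \<phi> \<and>
           (\<forall>x\<in>ball 0 \<rho> - {0}. u x = \<alpha> * ln (norm x) + \<phi> x)"
proof -
  let ?S = "ball (0 :: real^2) 1 - {0}"
  have opS: "open ?S" by auto
  obtain g H where jet: "C2_jet ?S u g H" and trl: "\<And>x. trace (H x) = laplacian u x"
    using C2_on_imp_C2_jet[OF u_C2] by blast
  have trK: "trace (H x) = - (K x * exp (u x))" if "x \<in> ?S" for x
  proof -
    have "- laplacian u x = K x * exp (u x)" using eq that by blast
    then show ?thesis by (simp add: trl)
  qed
  have cu: "continuous_on ?S u" by (rule C2_jet_continuous[OF jet order_refl])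
  \<comment> \<open>The equation itself makes \<open>K\<close> continuous off the origin, as it can
    be solved for \<open>K\<close>; hence its bounds, given almost everywhere, hold at every point
    of the punctured disc.\<close>
  have "continuous_on ?S (\<lambda>x. - trace (H x) * exp (- u x))"
    using jet unfolding C2_jet_def trace_2 by (intro continuous_intros cu) auto
  then have cK: "continuous_on ?S K"
    by (rule continuous_on_eq) (simp add: trK exp_minus)
  obtain M0 where M0: "AE x in lebesgue. x \<in> ball 0 1 \<longrightarrow> \<bar>K x\<bar> \<le> M0" using K_Linf by blast
  define M where "M = max 0 M0"
  have "AE x in lebesgue. x \<in> ?S \<longrightarrow> K x \<le> M"
    using M0 by eventually_elim (auto simp: M_def)
  then have KM: "\<forall>x\<in>?S. K x \<le> M" by (rule AE_continuous_le_imp_le[OF opS cK])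
  have "AE x in lebesgue. x \<in> ?S \<longrightarrow> - K x \<le> 0"
    using K_nonneg by eventually_elim auto
  then have K0: "\<forall>x\<in>?S. - K x \<le> 0"
    by (intro AE_continuous_le_imp_le[OF opS]) (intro continuous_intros cK)
  have meas: "(\<lambda>z. indicator ?S z * exp (u z)) \<in> borel_measurable borel"
    using borel_measurable_continuous_on_indicator[of ?S "\<lambda>z. exp (u z)"] cu
    by (auto intro!: continuous_intros)
  have "integrable lborel (\<lambda>z. indicator ?S z * exp (u z))"
  proof (rule integrableI_nonneg)
    have "(\<integral>\<^sup>+z. ennreal (indicator ?S z * exp (u z)) \<partial>lborel) = (\<integral>\<^sup>+z. ennreal (indicator ?S z * exp (u z)) \<partial>lebesgue)"
      using meas by (subst nn_integral_completion) auto
    also have "\<dots> = (\<integral>\<^sup>+ x\<in>?S. ennreal (exp (u x)) \<partial>lebesgue)"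
      by (intro nn_integral_cong) (auto simp: indicator_def)
    finally show "(\<integral>\<^sup>+z. ennreal (indicator ?S z * exp (u z)) \<partial>lborel) < \<infinity>" using fin by simp
  qed (use meas in auto)
  moreover have "- (M * exp (u x)) \<le> trace (H x)" "trace (H x) \<le> 0" if "x \<in> ?S" for x
    using KM K0 that by (auto simp: trK mult_right_mono)
  moreover have "M \<ge> 0" by (simp add: M_def)
  ultimately show ?thesis using singular_expansion[OF jet] by blast
qed

end
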